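(* If $G$ is a tree and the vertex-color graph $H$ is a forest, then \textsc{List-Colored Graph Motif} can be solved in $\mathcal{O}((M_C+1)^{\ell+1}\cdot 3^{\ell}\cdot n)$ time, where $M_C:=\max_{c\in C}M(c)$, $n=|V|$ and $\ell=|V|-|M|$.
   Context: \textsc{List-Colored Graph Motif}: the input is a multiset $M$ built on a set $C$ of colors, an undirected graph $G=(V,E)$, and a list-coloring $\mathcal{L}:V\to 2^C$; the question is whether there is $S\subseteq V$ such that $G[S]$ is connected and there is a one-to-one mapping $f$ from $S$ to $M$ (respecting multiplicities) with $f(v)\in\mathcal{L}(v)$ for all $v\in S$. $M(c)$ is the multiplicity of $c$ in $M$, $|M|$ counted with multiplicity. The vertex-color graph $H$ is the bipartite graph with vertex set $V\cup C$ and edges $\{v,c\}$ for $v\in V$, $c\in\mathcal{L}(v)$. *)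

theory Defs
  imports Main "HOL-Library.Multiset"
begin

section \<open>Undirected graphs\<close>

record 'a ugraph =
  verts :: "'a set"
  edges :: "'a set set"

definition ugraph :: "'a ugraph \<Rightarrow> bool" where
  "ugraph G \<longleftrightarrow> finite (verts G) \<and> (\<forall>e\<in>edges G. e \<subseteq> verts G \<and> card e = 2)"

definition induced :: "'a ugraph \<Rightarrow> 'a set \<Rightarrow> 'a ugraph" where
  "induced G S = \<lparr>verts = S, edges = {e \<in> edges G. e \<subseteq> S}\<rparr>"

definition adj :: "'a ugraph \<Rightarrow> 'a rel" where
  "adj G = {(u, v). {u, v} \<in> edges G}"

text \<open>The graph without vertices does not count as connected.\<close>

definition connected :: "'a ugraph \<Rightarrow> bool" where
  "connected G \<longleftrightarrow> verts G \<noteq> {} \<and> (\<forall>u\<in>verts G. \<forall>v\<in>verts G. (u, v) \<in> (adj G)\<^sup>*)"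

text \<open>A cycle is the list of its pairwise distinct vertices; the last one is joined to the first.\<close>

definition cycle :: "'a ugraph \<Rightarrow> 'a list \<Rightarrow> bool" where
  "cycle G p \<longleftrightarrow> 3 \<le> length p \<and> distinct p \<and>
     (\<forall>i<length p. {p ! i, p ! (Suc i mod length p)} \<in> edges G)"

definition forest :: "'a ugraph \<Rightarrow> bool" where
  "forest G \<longleftrightarrow> ugraph G \<and> (\<nexists>p. cycle G p)"

definition tree :: "'a ugraph \<Rightarrow> bool" where
  "tree G \<longleftrightarrow> forest G \<and> connected G"


section \<open>List-Colored Graph Motif\<close>

record ('v, 'c) lcgm =
  graph :: "'v ugraph"
  motif :: "'c multiset"
  clist :: "'v \<Rightarrow> 'c set"

text \<open>
  The color set is the underlying set of the motif: every color has multiplicity at least one.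
\<close>

definition colors :: "('v, 'c) lcgm \<Rightarrow> 'c set" where
  "colors I = set_mset (motif I)"

definition lcgm_instance :: "('v, 'c) lcgm \<Rightarrow> bool" where
  "lcgm_instance I \<longleftrightarrow> ugraph (graph I) \<and> (\<forall>v\<in>verts (graph I). clist I v \<subseteq> colors I)"

text \<open>
  The last conjunct says that \<open>f\<close> is a one-to-one correspondence between \<open>S\<close> and the motif:
  every color \<open>c\<close> is the image of exactly \<open>count (motif I) c\<close> vertices of \<open>S\<close>.
\<close>

definition has_motif :: "('v, 'c) lcgm \<Rightarrow> bool" where
  "has_motif I \<longleftrightarrow> (\<exists>S f. S \<subseteq> verts (graph I) \<and> connected (induced (graph I) S) \<and>
     (\<forall>v\<in>S. f v \<in> clist I v) \<and> image_mset f (mset_set S) = motif I)"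

definition vertex_color_graph :: "('v, 'c) lcgm \<Rightarrow> ('v + 'c) ugraph" where
  "vertex_color_graph I =
     \<lparr>verts = Inl ` verts (graph I) \<union> Inr ` colors I,
      edges = {{Inl v, Inr c} | v c. v \<in> verts (graph I) \<and> c \<in> clist I v}\<rparr>"

definition max_mult :: "('v, 'c) lcgm \<Rightarrow> nat" where
  "max_mult I = Max (count (motif I) ` colors I)"

definition num_verts :: "('v, 'c) lcgm \<Rightarrow> nat" where
  "num_verts I = card (verts (graph I))"

text \<open>
  Truncated subtraction. If the motif is larger than the vertex set, the instance is a
  no-instance and the parameter is \<open>0\<close>.
\<close>

definition ell :: "('v, 'c) lcgm \<Rightarrow> nat" where
  "ell I = num_verts I - size (motif I)"


section \<open>A unit-cost random access machine\<close>

text \<open>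
  Programs are structured while-programs over natural-number registers and arrays, addressed by
  name and by computed index. A program mentions only finitely many arrays, so (interleaving them
  in one memory) this is the usual unit-cost random access machine with indirect addressing, up to
  a constant factor that depends on the program alone. The arithmetic operations are addition
  and truncated subtraction only; there is no unit-cost multiplication or shift.
\<close>

datatype aexp =
    Const nat
  | Reg string
  | Load string aexp
  | Plus aexp aexp
  | Minus aexp aexp

datatype bexp =
    Less aexp aexp
  | Equal aexp aexp
  | Not bexp
  | And bexp bexp

datatype com =
    Skip
  | Assign string aexp
  | Store string aexp aexp
  | Seq com com
  | If bexp com com
  | While bexp com

record state =
  regs :: "string \<Rightarrow> nat"
  arrs :: "string \<Rightarrow> nat \<Rightarrow> nat"

primrec aval :: "aexp \<Rightarrow> state \<Rightarrow> nat" where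
  "aval (Const k) s = k"
| "aval (Reg x) s = regs s x"
| "aval (Load a e) s = arrs s a (aval e s)"
| "aval (Plus e e') s = aval e s + aval e' s"
| "aval (Minus e e') s = aval e s - aval e' s"

primrec acost :: "aexp \<Rightarrow> nat" where
  "acost (Const k) = 1"
| "acost (Reg x) = 1"
| "acost (Load a e) = acost e + 1"
| "acost (Plus e e') = acost e + acost e' + 1"
| "acost (Minus e e') = acost e + acost e' + 1"

primrec bval :: "bexp \<Rightarrow> state \<Rightarrow> bool" where
  "bval (Less e e') s \<longleftrightarrow> aval e s < aval e' s"
| "bval (Equal e e') s \<longleftrightarrow> aval e s = aval e' s"
| "bval (Not b) s \<longleftrightarrow> \<not> bval b s"
| "bval (And b b') s \<longleftrightarrow> bval b s \<and> bval b' s"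

primrec bcost :: "bexp \<Rightarrow> nat" where
  "bcost (Less e e') = acost e + acost e' + 1"
| "bcost (Equal e e') = acost e + acost e' + 1"
| "bcost (Not b) = bcost b + 1"
| "bcost (And b b') = bcost b + bcost b' + 1"

text \<open>\<open>exec c s t s'\<close>: started in \<open>s\<close>, the program \<open>c\<close> halts in \<open>s'\<close> after \<open>t\<close> steps.\<close>

inductive exec :: "com \<Rightarrow> state \<Rightarrow> nat \<Rightarrow> state \<Rightarrow> bool" where
  Skip: "exec Skip s 1 s"
| Assign: "exec (Assign x e) s (acost e + 1) (s\<lparr>regs := (regs s)(x := aval e s)\<rparr>)"
| Store: "exec (Store a i e) s (acost i + acost e + 1)
    (s\<lparr>arrs := (arrs s)(a := (arrs s a)(aval i s := aval e s))\<rparr>)"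
| Seq: "exec c1 s t1 s' \<Longrightarrow> exec c2 s' t2 s'' \<Longrightarrow> exec (Seq c1 c2) s (t1 + t2) s''"
| IfTrue: "bval b s \<Longrightarrow> exec c1 s t s' \<Longrightarrow> exec (If b c1 c2) s (bcost b + 1 + t) s'"
| IfFalse: "\<not> bval b s \<Longrightarrow> exec c2 s t s' \<Longrightarrow> exec (If b c1 c2) s (bcost b + 1 + t) s'"
| WhileFalse: "\<not> bval b s \<Longrightarrow> exec (While b c) s (bcost b + 1) s"
| WhileTrue: "bval b s \<Longrightarrow> exec c s t1 s' \<Longrightarrow> exec (While b c) s' t2 s'' \<Longrightarrow>
    exec (While b c) s (bcost b + 1 + t1 + t2) s''"

inductive_cases exec_SkipE: "exec Skip s t s'"
inductive_cases exec_AssignE: "exec (Assign x e) s t s'"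
inductive_cases exec_StoreE: "exec (Store a i e) s t s'"
inductive_cases exec_SeqE: "exec (Seq c1 c2) s t s'"
inductive_cases exec_IfE: "exec (If b c1 c2) s t s'"
inductive_cases exec_WhileE: "exec (While b c) s t s'"

lemma exec_deterministic:
  "exec c s t s' \<Longrightarrow> exec c s u r \<Longrightarrow> u = t \<and> r = s'"
proof (induction arbitrary: u r rule: exec.induct)
  case Skip
  then show ?case by (auto elim: exec_SkipE)
next
  case Assign
  then show ?case by (auto elim: exec_AssignE)
next
  case Store
  then show ?case by (auto elim: exec_StoreE)
next
  case (Seq c1 s t1 s' c2 t2 s'')
  from Seq.prems obtain u1 u2 r' where "u = u1 + u2" "exec c1 s u1 r'" "exec c2 r' u2 r"
    by (rule exec_SeqE)
  then show ?case using Seq.IH by auto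
next
  case (IfTrue b s c1 t s' c2)
  from IfTrue.prems obtain u' where "u = bcost b + 1 + u'" "exec c1 s u' r"
    by (rule exec_IfE) (use IfTrue.hyps(1) in auto)
  then show ?case using IfTrue.IH by auto
next
  case (IfFalse b s c2 t s' c1)
  from IfFalse.prems obtain u' where "u = bcost b + 1 + u'" "exec c2 s u' r"
    by (rule exec_IfE) (use IfFalse.hyps(1) in auto)
  then show ?case using IfFalse.IH by auto
next
  case (WhileFalse b s c)
  from WhileFalse.prems show ?case
    by (rule exec_WhileE) (use WhileFalse.hyps in auto)
next
  case (WhileTrue b s c t1 s' t2 s'')
  from WhileTrue.prems obtain u1 u2 r' where
    "u = bcost b + 1 + u1 + u2" "exec c s u1 r'" "exec (While b c) r' u2 r"
    by (rule exec_WhileE) (use WhileTrue.hyps(1) in auto)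
  then show ?case using WhileTrue.IH by auto
qed

definition initial :: "nat list \<Rightarrow> state" where
  "initial xs = \<lparr>regs = (\<lambda>_. 0),
     arrs = (\<lambda>a i. if a = ''in'' \<and> i < length xs then xs ! i else 0)\<rparr>"

definition answers_within :: "com \<Rightarrow> nat list \<Rightarrow> bool \<Rightarrow> nat \<Rightarrow> bool" where
  "answers_within P xs ans T \<longleftrightarrow>
     (\<exists>t s. exec P (initial xs) t s \<and> t \<le> T \<and> regs s ''out'' = (if ans then 1 else 0))"


section \<open>Encoding of instances\<close>

text \<open>
  Vertices and colors are numbered by \<open>\<nu>\<close> and \<open>\<kappa>\<close> from \<open>0\<close>. The input word
  consists of the numbers of vertices, colors, graph edges and pairs \<open>(v, c)\<close> with \<open>c\<close> in
  the list of \<open>v\<close>, followed by the graph edges, the multiplicities in the order of the colors,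
  and these pairs. Each graph edge (in one orientation) and each pair is listed once;
  the order is arbitrary.
\<close>

definition flatten :: "(nat \<times> nat) list \<Rightarrow> nat list" where
  "flatten ps = concat (map (\<lambda>(a, b). [a, b]) ps)"

definition encodes :: "nat list \<Rightarrow> ('v, 'c) lcgm \<Rightarrow> bool" where
  "encodes xs I \<longleftrightarrow> (\<exists>(\<nu> :: 'v \<Rightarrow> nat) (\<kappa> :: 'c \<Rightarrow> nat) es ms ps.
     bij_betw \<nu> (verts (graph I)) {..<num_verts I} \<and>
     bij_betw \<kappa> (colors I) {..<card (colors I)} \<and>
     distinct (map (\<lambda>(a, b). {a, b}) es) \<and>
     (\<lambda>(a, b). {a, b}) ` set es = (\<lambda>e. \<nu> ` e) ` edges (graph I) \<and>
     length ms = card (colors I) \<and> (\<forall>c\<in>colors I. ms ! \<kappa> c = count (motif I) c) \<and>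
     distinct ps \<and> set ps = {(\<nu> v, \<kappa> c) | v c. v \<in> verts (graph I) \<and> c \<in> clist I v} \<and>
     xs = [num_verts I, card (colors I), length es, length ps] @ flatten es @ ms @ flatten ps)"

end

(*
  Let T be a rooted version of the forest H in which a dummy color N of multiplicity 0 is the parent of
  all roots. A vertex set D can be deleted iff the rest is matched by a 0/1 flow on the edges of T, and
  this flow is determined bottom-up by D. Hence, without knowing D, every subtree of T has a known number
  of deletions up to one, and each color c with more children in need of c than c has copies must have a
  deletion below one of any M(c)+1 of these children. Guessing which ones takes at most one digit in
  {0..M_C} per deletion (a "tape" of l digits), and afterwards V splits into forbidden vertices and l
  classes such that D is valid iff it consists of one vertex of every class.

  On the side of the tree G, the complement of D is connected iff D is a disjoint union of branches of G
  (the components that arise from removing one edge). With weight 2^l + 2^(j-1) for the vertices of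
  class j, a multiset of branches of total weight (l+1) * 2^l - 1 is automatically disjoint and hits every
  class exactly once, so that an unbounded knapsack over 2n items and (l+1) * 2^l <= 2 * 3^l weights
  decides the existence of D for one tape.
*)
theory Submission
  imports Defs
begin

section \<open>Reasoning about programs\<close>

text \<open>The obstacle is to let a single additive test decide connectivity and the colors at
  once. On the color side the deletions depend on each other; but once it is fixed which needy
  children of each color lose a vertex below them, each of these children owns a region of
  \<open>H\<close> that must contain exactly one deletion. That exactly \<open>l\<close> such
  children have to be picked is a double count: every vertex either needs its parent color or is
  taken by exactly one child color. A guess is stored as the number of held siblings before each
  chosen child. A color holds at most M(c) children, hence the base M_C + 1, and inconsistent digits
  are harmless, since they leave a class without vertices. In the weights, the summands 2^l limit
  the number of covered vertices, counted with repetition, to \<open>l\<close>, while a sum of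
  powers 2^0, ..., 2^(l-1) that is -1 modulo 2^l has at least \<open>l\<close> terms. Both bounds
  are met only by one vertex per class.\<close>

definition run :: "com \<Rightarrow> state \<Rightarrow> nat \<Rightarrow> (state \<Rightarrow> bool) \<Rightarrow> bool" where
  "run c s T Q \<longleftrightarrow> (\<exists>t s'. exec c s t s' \<and> t \<le> T \<and> Q s')"

section \<open>Variables a program may write, and the frame property\<close>

primrec wregs :: "com \<Rightarrow> string set" where
  "wregs Skip = {}"
| "wregs (Assign x e) = {x}"
| "wregs (Store a i e) = {}"
| "wregs (Seq c d) = wregs c \<union> wregs d"
| "wregs (If b c d) = wregs c \<union> wregs d"
| "wregs (While b c) = wregs c"

primrec warrs :: "com \<Rightarrow> string set" where
  "warrs Skip = {}"
| "warrs (Assign x e) = {}"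
| "warrs (Store a i e) = {a}"
| "warrs (Seq c d) = warrs c \<union> warrs d"
| "warrs (If b c d) = warrs c \<union> warrs d"
| "warrs (While b c) = warrs c"

definition frame :: "com \<Rightarrow> state \<Rightarrow> state \<Rightarrow> bool" where
  "frame c s s' \<longleftrightarrow> (\<forall>x. x \<notin> wregs c \<longrightarrow> regs s' x = regs s x) \<and>
     (\<forall>a. a \<notin> warrs c \<longrightarrow> arrs s' a = arrs s a)"

lemma exec_frame: "exec c s t s' \<Longrightarrow> frame c s s'"
  by (induction rule: exec.induct) (auto simp: frame_def)

lemma frame_refl: "frame c s s"
  by (simp add: frame_def)

lemma frame_trans: "frame c s s' \<Longrightarrow> frame c s' s'' \<Longrightarrow> frame c s s''"
  by (simp add: frame_def)

lemma frame_reg: "frame c s s' \<Longrightarrow> x \<notin> wregs c \<Longrightarrow> regs s' x = regs s x"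
  by (simp add: frame_def)

text \<open>The frame of the executed program comes with the postcondition, so that postconditions
  only have to mention what the program changes. \<open>run_seq\<close> hands it on in the same
  way.\<close>

lemma run_mono:
  "run c s T Q \<Longrightarrow> T \<le> T' \<Longrightarrow> (\<And>s'. frame c s s' \<Longrightarrow> Q s' \<Longrightarrow> Q' s') \<Longrightarrow> run c s T' Q'"
  unfolding run_def by (meson exec_frame le_trans)

lemma run_seq:
  assumes "run c s T Q" and "\<And>s'. frame c s s' \<Longrightarrow> Q s' \<Longrightarrow> run d s' U R" and "T + U \<le> V"
  shows "run (Seq c d) s V R"
proof -
  from assms(1) obtain t s' where c: "exec c s t s'" "t \<le> T" "Q s'"
    unfolding run_def by blast
  from assms(2)[OF exec_frame[OF c(1)] c(3)] obtain u s'' where d: "exec d s' u s''" "u \<le> U" "R s''"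
    unfolding run_def by blast
  have "exec (Seq c d) s (t + u) s''"
    using c(1) d(1) by (rule exec.Seq)
  then show ?thesis
    using c(2) d(2,3) assms(3) unfolding run_def by (meson add_mono le_trans)
qed

lemma run_If:
  assumes "bval b s \<Longrightarrow> run c s T Q" and "\<not> bval b s \<Longrightarrow> run d s T Q" and "bcost b + 1 + T \<le> U"
  shows "run (If b c d) s U Q"
proof (cases "bval b s")
  case True
  then obtain t s' where "exec c s t s'" "t \<le> T" "Q s'"
    using assms(1) unfolding run_def by blast
  moreover from this have "exec (If b c d) s (bcost b + 1 + t) s'"
    using True exec.IfTrue by blast
  ultimately show ?thesis
    using assms(3) unfolding run_def by (meson add_left_mono le_trans)
next
  case False
  then obtain t s' where "exec d s t s'" "t \<le> T" "Q s'"
    using assms(2) unfolding run_def by blast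
  moreover from this have "exec (If b c d) s (bcost b + 1 + t) s'"
    using False exec.IfFalse by blast
  ultimately show ?thesis
    using assms(3) unfolding run_def by (meson add_left_mono le_trans)
qed

section \<open>Loop-free programs\<close>

primrec straight :: "com \<Rightarrow> bool" where
  "straight Skip \<longleftrightarrow> True"
| "straight (Assign x e) \<longleftrightarrow> True"
| "straight (Store a i e) \<longleftrightarrow> True"
| "straight (Seq c d) \<longleftrightarrow> straight c \<and> straight d"
| "straight (If b c d) \<longleftrightarrow> straight c \<and> straight d"
| "straight (While b c) \<longleftrightarrow> False"

text \<open>As a function, the semantics of a loop-free block can be evaluated by rewriting instead
  of inverting \<open>exec\<close>. The value of a loop is a placeholder that
  \<open>straight\<close> excludes.\<close>

primrec cval :: "com \<Rightarrow> state \<Rightarrow> state" where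
  "cval Skip s = s"
| "cval (Assign x e) s = s\<lparr>regs := (regs s)(x := aval e s)\<rparr>"
| "cval (Store a i e) s = s\<lparr>arrs := (arrs s)(a := (arrs s a)(aval i s := aval e s))\<rparr>"
| "cval (Seq c d) s = cval d (cval c s)"
| "cval (If b c d) s = (if bval b s then cval c s else cval d s)"
| "cval (While b c) s = s"

primrec ccost :: "com \<Rightarrow> nat" where
  "ccost Skip = 1"
| "ccost (Assign x e) = acost e + 1"
| "ccost (Store a i e) = acost i + acost e + 1"
| "ccost (Seq c d) = ccost c + ccost d"
| "ccost (If b c d) = bcost b + 1 + max (ccost c) (ccost d)"
| "ccost (While b c) = 0"

lemma exec_straight: "straight c \<Longrightarrow> \<exists>t \<le> ccost c. exec c s t (cval c s)"
proof (induction c arbitrary: s)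
  case (Seq c d)
  then obtain t u where "t \<le> ccost c" "exec c s t (cval c s)"
    "u \<le> ccost d" "exec d (cval c s) u (cval d (cval c s))"
    by (metis straight.simps(4))
  then show ?case
    by (auto intro!: exI[of _ "t + u"] exec.Seq)
next
  case (If b c d)
  then obtain t u where "t \<le> ccost c" "exec c s t (cval c s)" "u \<le> ccost d" "exec d s u (cval d s)"
    by (metis straight.simps(5))
  then have "bval b s \<Longrightarrow> exec (If b c d) s (bcost b + 1 + t) (cval c s)"
    "\<not> bval b s \<Longrightarrow> exec (If b c d) s (bcost b + 1 + u) (cval d s)"
    using exec.IfTrue exec.IfFalse by blast+
  moreover have "bcost b + 1 + t \<le> ccost (If b c d)" "bcost b + 1 + u \<le> ccost (If b c d)"
    using \<open>t \<le> ccost c\<close> \<open>u \<le> ccost d\<close> by auto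
  ultimately show ?case
    by (metis cval.simps(5))
next
  case Skip
  then show ?case
    by (intro exI[of _ "ccost (Skip)"]) (simp add: exec.Skip[simplified])
next
  case (Assign x e)
  then show ?case
    by (intro exI[of _ "ccost (Assign x e)"]) (simp add: exec.Assign[simplified])
next
  case (Store a i e)
  then show ?case
    by (intro exI[of _ "ccost (Store a i e)"]) (simp add: exec.Store[simplified])
qed simp

lemma run_straight: "straight c \<Longrightarrow> Q (cval c s) \<Longrightarrow> ccost c \<le> T \<Longrightarrow> run c s T Q"
  unfolding run_def using exec_straight le_trans by blast

text \<open>The variant \<open>m\<close> bounds the number of rounds, and one more test of the guard
  ends the loop. The body may assume the frame relative to the initial state, so that variables it
  never writes can be left out of the invariant.\<close>

lemma run_while:
  assumes step: "\<And>s'. frame c s s' \<Longrightarrow> I s' \<Longrightarrow> bval b s' \<Longrightarrow> run c s' B (\<lambda>s''. I s'' \<and> m s'' < m s')"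
    and I: "I s" and T: "bcost b + 1 + m s * (bcost b + 1 + B) \<le> T"
  shows "run (While b c) s T (\<lambda>s'. I s' \<and> \<not> bval b s')"
proof -
  have "frame c s s' \<Longrightarrow> I s' \<Longrightarrow>
    run (While b c) s' (bcost b + 1 + m s' * (bcost b + 1 + B)) (\<lambda>s'. I s' \<and> \<not> bval b s')" for s'
  proof (induction "m s'" arbitrary: s' rule: less_induct)
    case less
    show ?case
    proof (cases "bval b s'")
      case True
      from step[OF less.prems True] obtain t s'' where
        s'': "exec c s' t s''" "t \<le> B" "I s''" "m s'' < m s'"
        unfolding run_def by blast
      have fr: "frame c s s''"
        using less.prems(1) exec_frame[OF s''(1)] by (rule frame_trans)
      from less.hyps[OF s''(4) fr s''(3)] obtain u r where
        r: "exec (While b c) s'' u r" "u \<le> bcost b + 1 + m s'' * (bcost b + 1 + B)" "I r" "\<not> bval b r"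
        unfolding run_def by blast
      have e: "exec (While b c) s' (bcost b + 1 + t + u) r"
        using True s''(1) r(1) by (rule exec.WhileTrue)
      have "bcost b + 1 + t + u \<le> Suc (m s'') * (bcost b + 1 + B) + (bcost b + 1)"
        using s''(2) r(2) by simp
      also have "\<dots> \<le> m s' * (bcost b + 1 + B) + (bcost b + 1)"
        using s''(4) by (intro add_right_mono mult_right_mono) auto
      finally have "bcost b + 1 + t + u \<le> bcost b + 1 + m s' * (bcost b + 1 + B)"
        by simp
      then show ?thesis
        using e r(3,4) unfolding run_def by blast
    next
      case False
      then show ?thesis
        using less.prems exec.WhileFalse[OF False, of c] unfolding run_def
        by (intro exI[of _ "bcost b + 1"] exI[of _ s']) simp
    qed
  qed
  from this[OF frame_refl I] show ?thesis
    using T by (rule run_mono) auto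
qed

definition For :: "string \<Rightarrow> string \<Rightarrow> com \<Rightarrow> com" where
  "For x y c = Seq (Assign x (Const 0))
     (While (Less (Reg x) (Reg y)) (Seq c (Assign x (Plus (Reg x) (Const 1)))))"

abbreviation set_reg :: "state \<Rightarrow> string \<Rightarrow> nat \<Rightarrow> state" where
  "set_reg s x k \<equiv> s\<lparr>regs := (regs s)(x := k)\<rparr>"

lemma wregs_For [simp]: "wregs (For x y c) = insert x (wregs c)"
  and warrs_For [simp]: "warrs (For x y c) = warrs c"
  by (auto simp: For_def)

text \<open>The invariant \<open>I i\<close> speaks of the state in which the counter already has
  the value \<open>i\<close>. Neither the counter nor the bound is written by the body, so the
  number of rounds is the initial value of the bound.\<close>

lemma run_for:
  assumes xy: "x \<noteq> y" "x \<notin> wregs c" "y \<notin> wregs c"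
    and I0: "I 0 (set_reg s x 0)"
    and step: "\<And>i s'. \<lbrakk>frame (For x y c) s s'; i < regs s y; regs s' x = i; I i s'\<rbrakk> \<Longrightarrow>
      run c s' B (\<lambda>s''. I (Suc i) (set_reg s'' x (Suc i)))"
    and T: "6 + regs s y * (B + 8) \<le> T"
    and Q: "\<And>s'. \<lbrakk>frame (For x y c) s s'; regs s' x = regs s y; I (regs s y) s'\<rbrakk> \<Longrightarrow> Q s'"
  shows "run (For x y c) s T Q"
proof -
  let ?b = "Less (Reg x) (Reg y)" and ?d = "Seq c (Assign x (Plus (Reg x) (Const 1)))"
  let ?s = "set_reg s x 0"
  let ?J = "\<lambda>s'. frame (For x y c) s s' \<and> regs s' x \<le> regs s y \<and> I (regs s' x) s'"
  let ?m = "\<lambda>s'. regs s y - regs s' x"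
  \<comment> \<open>The initialization costs 2, each test of the guard 4 and each increment 4; this
    is the 6 = 2 + 4 and the 8 = 4 + 4 of the time bound.\<close>
  have w: "run (While ?b ?d) ?s (4 + regs s y * (B + 8)) (\<lambda>s'. ?J s' \<and> \<not> bval ?b s')"
  proof (rule run_while[where m = ?m and B = "B + 4"])
    show "?J ?s"
      using I0 by (auto simp: frame_def)
    show "bcost ?b + 1 + ?m ?s * (bcost ?b + 1 + (B + 4)) \<le> 4 + regs s y * (B + 8)"
      by simp
    have frame_trans_For: "frame (For x y c) s (set_reg r x k)"
      if "frame (For x y c) s s'" "frame c s' r" for s' r k
      using that by (auto simp: frame_def)
    fix s' assume J: "?J s'" and b: "bval ?b s'"
    have y: "regs s' y = regs s y"
      by (rule frame_reg[OF J[THEN conjunct1]]) (simp add: xy(1)[symmetric] xy(3))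
    have less: "regs s' x < regs s y"
      using b y by simp
    have "run c s' B (\<lambda>s''. I (Suc (regs s' x)) (set_reg s'' x (Suc (regs s' x))))"
      by (rule step[OF J[THEN conjunct1] less refl J[THEN conjunct2, THEN conjunct2]])
    then show "run ?d s' (B + 4) (\<lambda>s''. ?J s'' \<and> ?m s'' < ?m s')"
    proof (rule run_seq)
      fix r assume fr: "frame c s' r" and Ir: "I (Suc (regs s' x)) (set_reg r x (Suc (regs s' x)))"
      have "regs r x = regs s' x"
        using fr xy(2) by (rule frame_reg)
      then show "run (Assign x (Plus (Reg x) (Const 1))) r 4 (\<lambda>s''. ?J s'' \<and> ?m s'' < ?m s')"
        using less Ir frame_trans_For[OF J[THEN conjunct1] fr]
        by (intro run_straight) simp_all
    qed simp
  qed
  have Qr: "Q r" if J: "?J r" and b: "\<not> bval ?b r" for r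
  proof -
    have "regs r y = regs s y"
      by (rule frame_reg[OF J[THEN conjunct1]]) (simp add: xy(1)[symmetric] xy(3))
    then have x: "regs r x = regs s y"
      using J b by simp
    show ?thesis
      by (rule Q[OF J[THEN conjunct1] x]) (use J x in simp)
  qed
  show ?thesis
    unfolding For_def
  proof (rule run_seq[where Q = "\<lambda>s'. s' = ?s" and T = 2])
    show "run (Assign x (Const 0)) s 2 (\<lambda>s'. s' = ?s)"
      by (rule run_straight) simp_all
    fix s' assume s': "s' = ?s"
    show "run (While ?b ?d) s' (4 + regs s y * (B + 8)) Q"
      unfolding s' by (rule run_mono[OF w order.refl]) (rule Qr; simp)
  qed (use T in simp)
qed

section \<open>Forests and leaves\<close>

text \<open>Acyclicity in the form that leaf elimination consumes: as long as edges remain, some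
  vertex lies on exactly one of them. It passes to subsets and injective images without any talk of
  paths.\<close>

definition leafy :: "'a set set \<Rightarrow> bool" where
  "leafy E \<longleftrightarrow> (\<forall>F\<subseteq>E. F \<noteq> {} \<longrightarrow> (\<exists>x. card {e \<in> F. x \<in> e} = 1))"

lemma leafyE:
  assumes "leafy E" "F \<subseteq> E" "F \<noteq> {}"
  obtains x e where "e \<in> F" "{e \<in> F. x \<in> e} = {e}" "x \<in> e"
proof -
  obtain x where "card {e \<in> F. x \<in> e} = 1"
    using assms unfolding leafy_def by blast
  then obtain e where "{e \<in> F. x \<in> e} = {e}"
    by (auto simp: card_1_singleton_iff)
  then show ?thesis
    using that by blast
qed

lemma leafy_subset: "leafy E \<Longrightarrow> F \<subseteq> E \<Longrightarrow> leafy F"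
  unfolding leafy_def by blast

text \<open>Dropping a leaf together with its edge lowers both sides by one. The bound makes reading
  the edges of \<open>G\<close> and \<open>H\<close> linear in the number of nodes.\<close>

lemma leafy_card_le:
  assumes "finite V" "leafy E" "\<And>e. e \<in> E \<Longrightarrow> e \<subseteq> V"
  shows "card E \<le> card V"
  using assms
proof (induction "card V" arbitrary: V E)
  case 0
  then have V: "V = {}"
    by simp
  have "E = {}"
  proof (rule ccontr)
    assume "E \<noteq> {}"
    then obtain x e where "e \<in> E" "x \<in> e"
      using leafyE[OF 0(3) order.refl] by metis
    then show False
      using 0 V by auto
  qed
  then show ?case
    by simp
next
  case (Suc k)
  show ?case
  proof (cases "E = {}")
    case False
    then obtain x e where x: "e \<in> E" "{e \<in> E. x \<in> e} = {e}" "x \<in> e"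
      using leafyE[OF Suc.prems(2) order.refl] by metis
    have fin: "finite E"
      using Suc.prems by (auto intro: finite_subset[of E "Pow V"])
    have xV: "x \<in> V"
      using x Suc.prems by auto
    have "card (E - {e}) \<le> card (V - {x})"
    proof (rule Suc.hyps(1))
      show "k = card (V - {x})"
        using Suc.hyps(2) xV Suc.prems(1) by simp
      show "leafy (E - {e})"
        using Suc.prems(2) by (rule leafy_subset) auto
      fix d assume "d \<in> E - {e}"
      then show "d \<subseteq> V - {x}"
        using x Suc.prems(3) by blast
    qed (use Suc.prems in auto)
    then show ?thesis
      using x(1) fin xV Suc.prems(1) Suc.hyps(2) by (simp add: card_Diff_singleton)
  qed simp
qed

lemma leafy_image:
  assumes "leafy E" "inj_on h (\<Union>E)"
  shows "leafy ((`) h ` E)"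
  unfolding leafy_def
proof (intro allI impI)
  fix F' assume F': "F' \<subseteq> (`) h ` E" "F' \<noteq> {}"
  define F where "F = {e \<in> E. h ` e \<in> F'}"
  have F: "F \<subseteq> E" "F \<noteq> {}" "F' = (`) h ` F"
    using F' by (auto simp: F_def)
  obtain x e where x: "e \<in> F" "{e \<in> F. x \<in> e} = {e}" "x \<in> e"
    using leafyE[OF assms(1) F(1,2)] .
  have "h x \<in> h ` d \<longleftrightarrow> x \<in> d" if "d \<in> F" for d
    using assms(2) F(1) x(1,3) that by (auto simp: inj_on_def)
  then have "{e \<in> F'. h x \<in> e} = (`) h ` {e \<in> F. x \<in> e}"
    unfolding F(3) by blast
  then have "card {e \<in> F'. h x \<in> e} = 1"
    unfolding x(2) by simp
  then show "\<exists>x. card {e \<in> F'. x \<in> e} = 1" ..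
qed

text \<open>If every vertex met by \<open>F\<close> has two edges in \<open>F\<close>, the second edge at the first vertex of
  a longest path closes a cycle.\<close>

lemma forest_leafy:
  assumes "forest G"
  shows "leafy (edges G)"
  unfolding leafy_def
proof (intro allI impI, rule ccontr)
  fix F assume F: "F \<subseteq> edges G" "F \<noteq> {}" and no: "\<nexists>x. card {e \<in> F. x \<in> e} = 1"
  have G: "finite (verts G)" "\<And>e. e \<in> edges G \<Longrightarrow> e \<subseteq> verts G \<and> card e = 2"
    and acyclic: "\<And>p. \<not> cycle G p"
    using assms by (auto simp: forest_def ugraph_def)
  have finF: "finite F"
    using F(1) G by (auto intro: finite_subset[of F "Pow (verts G)"])
  define path where "path p \<longleftrightarrow> distinct p \<and> set p \<subseteq> verts G \<and>
    (\<forall>i. Suc i < length p \<longrightarrow> {p ! i, p ! Suc i} \<in> F) \<and> 2 \<le> length p" for p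
  obtain e where e: "e \<in> F"
    using F(2) by blast
  then obtain a b where ab: "e = {a, b}" "a \<noteq> b"
    using F(1) G(2) by (meson card_2_iff subsetD)
  have "path [a, b]"
    using e ab F(1) G(2)[of e] by (auto simp: path_def)
  moreover have "length p < Suc (card (verts G))" if "path p" for p
    using that G(1) by (metis path_def card_mono distinct_card le_imp_less_Suc)
  ultimately obtain p where p: "path p" and longest: "\<And>q. path q \<Longrightarrow> length q \<le> length p"
    using ex_has_greatest_nat[of path "[a, b]" length "Suc (card (verts G))"] by blast
  then obtain x y r where pr: "p = x # y # r"
    by (cases p; cases "tl p") (auto simp: path_def)
  have xy: "{x, y} \<in> F"
    using p unfolding path_def pr by (metis length_Cons nth_Cons_0 nth_Cons_Suc zero_less_Suc Suc_less_eq)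
  have "card {e \<in> F. x \<in> e} \<noteq> 1"
    using no by blast
  then have "{e \<in> F. x \<in> e} \<noteq> {{x, y}}"
    by (metis is_singletonI is_singleton_altdef)
  then obtain d where d: "d \<in> F" "x \<in> d" "d \<noteq> {x, y}"
    using xy by blast
  then have "card d = 2"
    using F(1) G(2) by blast
  then obtain z where z: "d = {x, z}" "z \<noteq> x"
    using d(2) by (auto simp: card_2_iff)
  have zy: "z \<noteq> y"
    using d(3) z by auto
  have zV: "z \<in> verts G"
    using d(1) F(1) G(2)[of d] z by auto
  show False
  proof (cases "z \<in> set p")
    case False
    have zx: "{z, p ! 0} \<in> F"
      using d(1) z(1) pr by (simp add: insert_commute)
    have "{(z # p) ! i, (z # p) ! Suc i} \<in> F" if "Suc i < length (z # p)" for i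
    proof (cases i)
      case 0
      then show ?thesis
        using zx by simp
    next
      case (Suc k)
      then show ?thesis
        using that p unfolding path_def by simp
    qed
    then have "path (z # p)"
      using p False zV unfolding path_def by simp
    then have "length (z # p) \<le> length p"
      by (rule longest)
    then show False
      by simp
  next
    case True
    then obtain j where j: "j < length p" "p ! j = z"
      by (meson in_set_conv_nth)
    \<comment> \<open>\<open>z\<close> is neither \<open>x\<close> nor its successor
      \<open>y\<close>, so the closed path has at least three vertices.\<close>
    have j2: "2 \<le> j"
    proof (rule ccontr)
      assume "\<not> 2 \<le> j"
      then have "j = 0 \<or> j = 1"
        by linarith
      then show False
        using j(2) z(2) zy unfolding pr by auto
    qed
    have "cycle G (take (Suc j) p)"
      unfolding cycle_def
    proof (intro conjI allI impI)
      show "3 \<le> length (take (Suc j) p)" "distinct (take (Suc j) p)"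
        using j j2 p by (auto simp: path_def)
      fix i assume "i < length (take (Suc j) p)"
      then have i: "i \<le> j"
        using j by simp
      have len: "length (take (Suc j) p) = Suc j"
        using j by simp
      show "{take (Suc j) p ! i, take (Suc j) p ! (Suc i mod length (take (Suc j) p))} \<in> edges G"
      proof (cases "i = j")
        case True
        have "take (Suc j) p ! j = z" "take (Suc j) p ! 0 = x"
          using j(2) by simp (simp add: pr)
        then show ?thesis
          using True d(1) z(1) F(1) unfolding len by (simp add: insert_commute subset_iff)
      next
        case False
        then show ?thesis
          using i j(1) p F(1) unfolding len path_def by (simp add: subset_iff)
      qed
    qed
    then show False
      using acyclic by blast
  qed
qed

section \<open>Rooted forests\<close>

text \<open>\<open>od\<close> lists the nodes \<open>0..N-1\<close> with every node before its parent; the parent of a root is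
  the dummy node \<open>N\<close>.\<close>

definition rooted :: "nat \<Rightarrow> nat set set \<Rightarrow> (nat \<Rightarrow> nat) \<Rightarrow> (nat \<Rightarrow> nat) \<Rightarrow> bool" where
  "rooted N E P od \<longleftrightarrow> bij_betw od {..<N} {..<N} \<and>
     (\<forall>i<N. P (od i) = N \<or> (\<exists>j. i < j \<and> j < N \<and> P (od i) = od j)) \<and>
     E = {{x, P x} | x. x < N \<and> P x < N}"

text \<open>The inverse of \<open>od\<close>, with the dummy placed last. In this way the rank grows
  strictly from every node to its parent, also at the roots, and is the measure of all inductions up
  or down the forest.\<close>

definition rank :: "nat \<Rightarrow> (nat \<Rightarrow> nat) \<Rightarrow> nat \<Rightarrow> nat" where
  "rank N od x = (if x < N then inv_into {..<N} od x else N)"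

lemma rooted_rank:
  assumes "rooted N E P od"
  shows rank_O: "\<And>i. i < N \<Longrightarrow> rank N od (od i) = i"
    and O_less: "\<And>i. i < N \<Longrightarrow> od i < N"
    and rank_less: "\<And>x. x < N \<Longrightarrow> rank N od x < N"
    and O_rank: "\<And>x. x < N \<Longrightarrow> od (rank N od x) = x"
    and rank_parent: "\<And>x. x < N \<Longrightarrow> rank N od x < rank N od (P x)"
    and parent_le: "\<And>x. x < N \<Longrightarrow> P x \<le> N"
proof -
  have bij: "bij_betw od {..<N} {..<N}"
    and par: "\<And>i. i < N \<Longrightarrow> P (od i) = N \<or> (\<exists>j. i < j \<and> j < N \<and> P (od i) = od j)"
    using assms by (auto simp: rooted_def)
  show less: "od i < N" if "i < N" for i
    using that bij by (auto simp: bij_betw_def)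
  show rO: "rank N od (od i) = i" if "i < N" for i
    using that bij less by (auto simp: rank_def bij_betw_def inv_into_f_f)
  show r: "rank N od x < N" if "x < N" for x
    using that bij inv_into_into[of x od "{..<N}"] by (auto simp: rank_def bij_betw_def)
  show Or: "od (rank N od x) = x" if "x < N" for x
    using that bij f_inv_into_f[of x od "{..<N}"] by (auto simp: rank_def bij_betw_def)
  fix x assume x: "x < N"
  consider "P x = N" | j where "rank N od x < j" "j < N" "P x = od j"
    using par[OF r[OF x]] unfolding Or[OF x] by blast
  then show "rank N od x < rank N od (P x)"
  proof cases
    case 1
    then show ?thesis
      using r[OF x] by (simp add: rank_def)
  next
    case 2
    then show ?thesis
      using rO by simp
  qed
  show "P x \<le> N"
    using par[OF r[OF x]] less unfolding Or[OF x] by (auto simp: less_imp_le)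
qed

subsection \<open>Descendants\<close>

text \<open>\<open>L\<close> selects the nodes that keep the link to their parent. One theory then
  covers whole subtrees, the part of a tree inside a vertex set, and regions cut off at selected
  vertices.\<close>

definition links :: "(nat \<Rightarrow> bool) \<Rightarrow> (nat \<Rightarrow> nat) \<Rightarrow> nat rel" where
  "links L P = {(y, P y) | y. L y}"

definition desc :: "(nat \<Rightarrow> bool) \<Rightarrow> (nat \<Rightarrow> nat) \<Rightarrow> nat \<Rightarrow> nat set" where
  "desc L P x = {w. (w, x) \<in> (links L P)\<^sup>*}"

lemma single_valued_links: "single_valued (links L P)"
  by (auto simp: links_def single_valued_def)

lemma desc_refl [simp]: "x \<in> desc L P x"
  by (simp add: desc_def)

lemma desc_step: "L y \<Longrightarrow> x \<in> desc L P y \<Longrightarrow> x \<in> desc L P (P y)"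
  unfolding desc_def links_def by (auto intro: rtrancl_into_rtrancl)

lemma desc_up: "w \<in> desc L P x \<Longrightarrow> w \<noteq> x \<Longrightarrow> L w \<and> P w \<in> desc L P x"
  unfolding desc_def by (auto elim!: converse_rtranclE[of w x] simp: links_def)

lemma desc_trans: "w \<in> desc L P x \<Longrightarrow> x \<in> desc L P y \<Longrightarrow> w \<in> desc L P y"
  unfolding desc_def by auto

text \<open>Each node has at most one outgoing link, so all chains from \<open>w\<close> run along
  one path and any two nodes on it are comparable.\<close>

lemma desc_linear:
  "w \<in> desc L P x \<Longrightarrow> w \<in> desc L P y \<Longrightarrow> x \<in> desc L P y \<or> y \<in> desc L P x"
  unfolding desc_def using single_valued_confluent[OF single_valued_links] by blast

lemma desc_rank:
  assumes "\<And>y. L y \<Longrightarrow> rk y < (rk (P y) :: nat)" "w \<in> desc L P x"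
  shows "rk w \<le> rk x" and "w \<noteq> x \<Longrightarrow> rk w < rk x"
proof -
  have "rk w \<le> rk x \<and> (w \<noteq> x \<longrightarrow> rk w < rk x)"
    using assms(2) unfolding desc_def mem_Collect_eq
  proof (induction rule: rtrancl_induct)
    case (step y z)
    then have "rk y < rk z"
      using assms(1) by (auto simp: links_def)
    then show ?case
      using step.IH by auto
  qed simp
  then show "rk w \<le> rk x" "w \<noteq> x \<Longrightarrow> rk w < rk x"
    by auto
qed

lemma desc_unfold: "desc L P x = insert x (\<Union>y\<in>{y. L y \<and> P y = x}. desc L P y)"
proof (intro equalityI subsetI)
  fix w assume "w \<in> desc L P x"
  then show "w \<in> insert x (\<Union>y\<in>{y. L y \<and> P y = x}. desc L P y)"
    unfolding desc_def by (auto elim!: rtranclE[of w x] simp: links_def)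
qed (auto intro: desc_step)

lemma finite_desc:
  assumes "finite {y. L y}"
  shows "finite (desc L P x)"
proof (rule finite_subset)
  show "desc L P x \<subseteq> insert x {y. L y}"
    using desc_up by fastforce
qed (use assms in simp)

lemma sum_desc:
  fixes g :: "nat \<Rightarrow> nat"
  assumes rk: "\<And>y. L y \<Longrightarrow> rk y < (rk (P y) :: nat)" and fin: "finite {y. L y}"
  shows "sum g (desc L P x) = g x + (\<Sum>y\<in>{y. L y \<and> P y = x}. sum g (desc L P y))"
proof -
  let ?C = "{y. L y \<and> P y = x}"
  have finC: "finite ?C"
    using fin by (rule finite_subset[rotated]) auto
  \<comment> \<open>A common node would put one child above the other; then \<open>x\<close> would
    lie below its own child, against the rank.\<close>
  have disj: "desc L P y \<inter> desc L P z = {}" if "y \<in> ?C" "z \<in> ?C" "y \<noteq> z" for y z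
  proof (rule ccontr)
    assume "desc L P y \<inter> desc L P z \<noteq> {}"
    then have "y \<in> desc L P z \<or> z \<in> desc L P y"
      using desc_linear by blast
    moreover have False if "y \<in> desc L P z" "y \<noteq> z" "y \<in> ?C" "z \<in> ?C" for y z
    proof -
      have "x \<in> desc L P z"
        using desc_up[OF that(1,2)] that(3) by auto
      then have "rk x \<le> rk z"
        using desc_rank(1)[of L rk P x z] rk by blast
      then show False
        using rk[of z] that(4) by auto
    qed
    ultimately show False
      using that by blast
  qed
  have notin: "x \<notin> (\<Union>y\<in>?C. desc L P y)"
  proof
    assume "x \<in> (\<Union>y\<in>?C. desc L P y)"
    then obtain y where y: "L y" "P y = x" "x \<in> desc L P y"
      by blast
    have "rk x \<le> rk y"
      using desc_rank(1)[of L rk P x y] rk y(3) by blast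
    then show False
      using rk[OF y(1)] y(2) by simp
  qed
  have "sum g (desc L P x) = g x + sum g (\<Union>y\<in>?C. desc L P y)"
    unfolding desc_unfold[of L P x]
    using notin finC fin by (intro sum.insert) (auto intro: finite_desc)
  also have "sum g (\<Union>y\<in>?C. desc L P y) = (\<Sum>y\<in>?C. sum g (desc L P y))"
    using finC disj by (intro sum.UNION_disjoint) (auto intro: finite_desc fin)
  finally show ?thesis .
qed

text \<open>Values accumulated from the children upward are subtree sums, because the recursion has
  only one solution. This is how the arrays of partial sums are identified.\<close>

lemma sum_desc_unique:
  fixes g S :: "nat \<Rightarrow> nat"
  assumes rk: "\<And>y. L y \<Longrightarrow> rk y < (rk (P y) :: nat)" and fin: "finite {y. L y}"
    and S: "\<And>x. x \<in> X \<Longrightarrow> S x = g x + (\<Sum>y\<in>{y. L y \<and> P y = x}. S y)"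
    and X: "\<And>y. L y \<Longrightarrow> y \<in> X" and x: "x \<in> X"
  shows "S x = sum g (desc L P x)"
  using x
proof (induction "rk x" arbitrary: x rule: less_induct)
  case less
  have "(\<Sum>y\<in>{y. L y \<and> P y = x}. S y) = (\<Sum>y\<in>{y. L y \<and> P y = x}. sum g (desc L P y))"
    using rk X by (intro sum.cong less.hyps) auto
  then show ?case
    using S[OF less.prems] sum_desc[where L = L and P = P and rk = rk, OF rk fin, of g x] by simp
qed

section \<open>Connected sets in a rooted tree\<close>

definition conn :: "nat set set \<Rightarrow> nat set \<Rightarrow> bool" where
  "conn E S \<longleftrightarrow> S \<noteq> {} \<and>
     (\<forall>u\<in>S. \<forall>v\<in>S. (u, v) \<in> {(u, v). {u, v} \<in> E \<and> u \<in> S \<and> v \<in> S}\<^sup>*)"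

abbreviation sub :: "nat \<Rightarrow> (nat \<Rightarrow> nat) \<Rightarrow> nat \<Rightarrow> nat set" where
  "sub N P \<equiv> desc (\<lambda>y. y < N) P"

lemma rooted_edge:
  assumes "rooted N E P od" "{u, v} \<in> E" "u \<noteq> v"
  shows "(u < N \<and> v < N) \<and> (P u = v \<or> P v = u)"
proof -
  obtain x where "{u, v} = {x, P x}" "x < N" "P x < N"
    using assms(1,2) by (auto simp: rooted_def)
  then show ?thesis
    using assms(3) by (auto simp: doubleton_eq_iff)
qed

lemma rooted_edge_neq:
  assumes "rooted N E P od" "{u, v} \<in> E"
  shows "u \<noteq> v"
proof
  assume "u = v"
  obtain x where "{u, v} = {x, P x}" "x < N"
    using assms by (auto simp: rooted_def)
  then have "P x = x"
    using \<open>u = v\<close> by auto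
  then show False
    using rank_parent[OF assms(1) \<open>x < N\<close>] by simp
qed

lemma sub_rank:
  assumes "rooted N E P od" "w \<in> sub N P x"
  shows "rank N od w \<le> rank N od x" and "w \<noteq> x \<Longrightarrow> rank N od w < rank N od x"
  using desc_rank[OF _ assms(2), of "rank N od"] rank_parent[OF assms(1)] by auto

lemma sub_less:
  assumes "rooted N E P od" "w \<in> sub N P x" "x < N"
  shows "w < N"
  using desc_up[OF assms(2)] assms(3) by auto

lemma sub_antisym:
  assumes "rooted N E P od" "w \<in> sub N P x" "x \<in> sub N P w"
  shows "w = x"
  using sub_rank[OF assms(1,2)] sub_rank[OF assms(1,3)] by fastforce

text \<open>Take the node \<open>t\<close> of maximal rank. A walk inside \<open>S\<close> that
  starts at \<open>t\<close> stays among the descendants of \<open>t\<close>: the only upward step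
  that could leave them starts at \<open>t\<close> itself and ends outside \<open>S\<close>.\<close>

lemma conn_top:
  assumes rt: "rooted N E P od" and S: "S \<subseteq> {..<N}" "conn E S"
  obtains t where "t \<in> S" "P t \<notin> S" "\<And>v. v \<in> S \<Longrightarrow> v \<noteq> t \<Longrightarrow> P v \<in> S"
    "\<And>v. v \<in> S \<Longrightarrow> v \<in> desc (\<lambda>y. y \<in> S \<and> P y \<in> S) P t"
proof -
  let ?A = "{(u, v). {u, v} \<in> E \<and> u \<in> S \<and> v \<in> S}"
  let ?L = "\<lambda>y. y \<in> S \<and> P y \<in> S"
  have "finite S" "S \<noteq> {}"
    using S finite_subset[OF S(1)] by (auto simp: conn_def)
  then have "Max (rank N od ` S) \<in> rank N od ` S"
    by (intro Max_in) auto
  then obtain t where "t \<in> S" "rank N od t = Max (rank N od ` S)"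
    by auto
  then have t: "t \<in> S" "\<And>v. v \<in> S \<Longrightarrow> rank N od v \<le> rank N od t"
    using \<open>finite S\<close> by simp_all
  have Pt: "P t \<notin> S"
    using t rank_parent[OF rt, of t] S(1) by (meson lessThan_iff not_less subsetD)
  have "(t, v) \<in> ?A\<^sup>* \<Longrightarrow> v \<in> desc ?L P t" for v
  proof (induction rule: rtrancl_induct)
    case (step u v)
    then have uv: "{u, v} \<in> E" "u \<in> S" "v \<in> S"
      by auto
    have "P u = v \<or> P v = u"
      using rooted_edge[OF rt uv(1)] rooted_edge_neq[OF rt uv(1)] by blast
    then show ?case
    proof
      assume "P v = u"
      then show ?thesis
        using step.IH desc_step[of ?L v v P] uv desc_trans[of v ?L P u t] by auto
    next
      assume Pu: "P u = v"
      then have "u \<noteq> t"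
        using Pt uv by auto
      then show ?thesis
        using desc_up[OF step.IH] Pu by auto
    qed
  qed simp
  then have all: "v \<in> desc ?L P t" if "v \<in> S" for v
    using that t(1) S(2) by (simp add: conn_def)
  have "P v \<in> S" if "v \<in> S" "v \<noteq> t" for v
    using desc_up[OF all[OF that(1)] that(2)] by simp
  then show ?thesis
    using that t(1) Pt all by blast
qed

text \<open>Climbing raises the rank and can only stop at \<open>t\<close>, so every node is joined
  to \<open>t\<close> inside \<open>S\<close>.\<close>

lemma conn_of_top:
  assumes rt: "rooted N E P od" and S: "S \<subseteq> {..<N}" and t: "t \<in> S"
    and up: "\<And>v. v \<in> S \<Longrightarrow> v \<noteq> t \<Longrightarrow> P v \<in> S"
  shows "conn E S"
proof -
  let ?A = "{(u, v). {u, v} \<in> E \<and> u \<in> S \<and> v \<in> S}"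
  have edge: "(v, P v) \<in> ?A" if "v \<in> S" "v \<noteq> t" for v
    using that up[OF that] S rt by (auto simp: rooted_def)
  have "v \<in> S \<Longrightarrow> (v, t) \<in> ?A\<^sup>*" for v
  proof (induction "N - rank N od v" arbitrary: v rule: less_induct)
    case less
    show ?case
    proof (cases "v = t")
      case False
      then have "P v \<in> S"
        using up less.prems by blast
      moreover have "N - rank N od (P v) < N - rank N od v"
        using rank_parent[OF rt, of v] rank_less[OF rt, of v] less.prems S by (auto intro!: diff_less_mono2)
      ultimately have "(P v, t) \<in> ?A\<^sup>*"
        using less.hyps by blast
      then show ?thesis
        using edge[OF less.prems False] by (meson converse_rtrancl_into_rtrancl)
    qed simp
  qed
  then have a: "(v, t) \<in> ?A\<^sup>*" if "v \<in> S" for v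
    using that by blast
  have "sym ?A"
    by (auto simp: sym_def insert_commute)
  then have "(t, v) \<in> ?A\<^sup>*" if "v \<in> S" for v
    using a[OF that] by (meson symD sym_rtrancl)
  then show ?thesis
    unfolding conn_def using a t by (meson empty_iff rtrancl_trans)
qed

text \<open>The additive monoid generated by \<open>W\<close>, that is, knapsack with repetition.
  Repetition lets a table be filled by increasing \<open>z\<close>; it is the weights that later
  exclude it.\<close>

inductive_set sums :: "nat set \<Rightarrow> nat set" for W where
  zero: "0 \<in> sums W"
| add: "z \<in> sums W \<Longrightarrow> w \<in> W \<Longrightarrow> z + w \<in> sums W"

lemma sums_sum: "finite B \<Longrightarrow> (\<And>b. b \<in> B \<Longrightarrow> h b \<in> W) \<Longrightarrow> sum h B \<in> sums W"
proof (induction B rule: finite_induct)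
  case (insert b B)
  then have "sum h B + h b \<in> sums W"
    by (intro sums.add) auto
  then show ?case
    using insert.hyps by (simp add: add.commute)
qed (simp add: sums.zero)

lemma sums_list: "z \<in> sums (h ` X) \<Longrightarrow> \<exists>As. set As \<subseteq> X \<and> (\<Sum>A\<leftarrow>As. h A) = z"
proof (induction rule: sums.induct)
  case zero
  show ?case
    by (intro exI[of _ "[]"]) simp
next
  case (add z w)
  then obtain As A where "set As \<subseteq> X" "(\<Sum>A\<leftarrow>As. h A) = z" "A \<in> X" "w = h A"
    by blast
  then show ?case
    by (intro exI[of _ "A # As"]) simp
qed

text \<open>The components that remain when an edge to the parent is removed. The root contributes the whole
  vertex set and the empty set.\<close>

definition branches :: "nat \<Rightarrow> (nat \<Rightarrow> nat) \<Rightarrow> nat set set" where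
  "branches N P = sub N P ` {..<N} \<union> (\<lambda>v. {..<N} - sub N P v) ` {..<N}"

text \<open>With \<open>t\<close> the top of the complement, \<open>D\<close> consists of all that
  is not below \<open>t\<close>, which is one branch, and of the subtrees of those nodes of
  \<open>D\<close> whose parent is kept. These pieces are disjoint, so their sums add up to that of
  \<open>D\<close>.\<close>

lemma conn_complement_sum:
  fixes g :: "nat \<Rightarrow> nat"
  assumes rt: "rooted N E P od" and D: "D \<subseteq> {..<N}" and conn: "conn E ({..<N} - D)"
  shows "sum g D \<in> sums (sum g ` branches N P)"
proof -
  let ?S = "{..<N} - D"
  let ?R = "sub N P"
  obtain t where t: "t \<in> ?S" "P t \<notin> ?S" "\<And>v. v \<in> ?S \<Longrightarrow> v \<noteq> t \<Longrightarrow> P v \<in> ?S"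
    and desc: "\<And>v. v \<in> ?S \<Longrightarrow> v \<in> desc (\<lambda>y. y \<in> ?S \<and> P y \<in> ?S) P t"
    using conn_top[OF rt _ conn] by blast
  have links: "desc (\<lambda>y. y \<in> ?S \<and> P y \<in> ?S) P t \<subseteq> ?R t"
    unfolding desc_def links_def by (intro Collect_mono impI, erule rtrancl_mono[THEN subsetD, rotated]) auto
  have SR: "?S \<subseteq> ?R t"
    using desc links by blast
  have tN: "t < N"
    using t by simp
  have RN: "?R v \<subseteq> {..<N}" if "v < N" for v
    using sub_less[OF rt] that by auto
  \<comment> \<open>The roots of the deleted subtrees below \<open>t\<close>: the deleted nodes that
    hang on a kept one.\<close>
  define B where "B = {w \<in> D. P w \<in> ?S}"
  have BN: "w < N" if "w \<in> B" for w
    using that D by (auto simp: B_def)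
  have finB: "finite B"
    using finite_subset[OF D] by (simp add: B_def)
  have up: "P v \<in> ?R x" if "v \<in> ?R x" "v \<noteq> x" for v x
    using desc_up[OF that] by simp
  \<comment> \<open>The way up from a kept node stays among kept nodes as far as \<open>t\<close>;
    it either passes \<open>w\<close> or reaches \<open>t\<close> while still below
    \<open>w\<close>.\<close>
  have climb: "v \<in> ?R w \<Longrightarrow> v \<in> ?S \<Longrightarrow> w \<in> ?S \<or> t \<in> ?R w" for v w
  proof (induction "N - rank N od v" arbitrary: v rule: less_induct)
    case less
    show ?case
    proof (cases "v = w \<or> v = t")
      case False
      then have "P v \<in> ?R w" "P v \<in> ?S"
        using up less.prems t(3) by blast+
      moreover have "N - rank N od (P v) < N - rank N od v"
        using rank_parent[OF rt, of v] rank_less[OF rt, of v] less.prems by (auto intro!: diff_less_mono2)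
      ultimately show ?thesis
        using less.hyps by blast
    qed (use less.prems in auto)
  qed
  \<comment> \<open>Otherwise \<open>climb\<close> puts \<open>t\<close> below \<open>w\<close>,
    although the kept node \<open>P w\<close> lies below \<open>t\<close>.\<close>
  have BS: "?R w \<inter> ?S = {}" if w: "w \<in> B" for w
  proof (rule ccontr)
    assume "?R w \<inter> ?S \<noteq> {}"
    then obtain v where "v \<in> ?R w" "v \<in> ?S"
      by blast
    then have tw: "t \<in> ?R w"
      using climb[of v w] w by (auto simp: B_def)
    have "P w \<in> ?R t"
      using w SR by (auto simp: B_def)
    then have "rank N od (P w) \<le> rank N od w"
      using sub_rank(1)[OF rt tw] sub_rank(1)[OF rt, of "P w" t] by linarith
    then show False
      using rank_parent[OF rt BN[OF w]] by simp
  qed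
  have BR: "?R w \<subseteq> ?R t" if w: "w \<in> B" for w
  proof -
    have "w \<in> ?R (P w)" "P w \<in> ?R t"
      using w SR BN[OF w] desc_step[of "\<lambda>y. y < N" w w P] by (auto simp: B_def)
    then show ?thesis
      using desc_trans by blast
  qed
  have disj: "?R w \<inter> ?R w' = {}" if w: "w \<in> B" "w' \<in> B" "w \<noteq> w'" for w w'
  proof (rule ccontr)
    assume "?R w \<inter> ?R w' \<noteq> {}"
    then have "w \<in> ?R w' \<or> w' \<in> ?R w"
      using desc_linear by blast
    then have "P w \<in> ?R w' \<or> P w' \<in> ?R w"
      using up w(3) by metis
    then show False
      using BS w by (auto simp: B_def)
  qed
  \<comment> \<open>On the way from \<open>v\<close> up to \<open>t\<close> there is a first kept
    node; its predecessor on the way belongs to \<open>B\<close>.\<close>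
  have cover: "v \<in> ?R t \<Longrightarrow> v \<in> D \<Longrightarrow> \<exists>w\<in>B. v \<in> ?R w" for v
  proof (induction "N - rank N od v" arbitrary: v rule: less_induct)
    case less
    have vN: "v < N" and vt: "v \<noteq> t"
      using less.prems D t by auto
    have Pv: "P v \<in> ?R t"
      using up less.prems vt by blast
    show ?case
    proof (cases "P v \<in> D")
      case True
      moreover have "N - rank N od (P v) < N - rank N od v"
        using rank_parent[OF rt vN] rank_less[OF rt vN] by (auto intro!: diff_less_mono2)
      ultimately obtain w where "w \<in> B" "P v \<in> ?R w"
        using less.hyps Pv by blast
      moreover have "v \<in> ?R (P v)"
        using desc_step[of "\<lambda>y. y < N" v v P] vN by simp
      ultimately show ?thesis
        using desc_trans by blast
    next
      case False
      then have "v \<in> B"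
        using less.prems Pv RN[OF tN] by (auto simp: B_def)
      then show ?thesis
        by (intro bexI[of _ v] desc_refl)
    qed
  qed
  have "D = ({..<N} - ?R t) \<union> (\<Union>w\<in>B. ?R w)"
  proof (intro equalityI subsetI)
    fix v assume "v \<in> D"
    then show "v \<in> ({..<N} - ?R t) \<union> (\<Union>w\<in>B. ?R w)"
      using cover[of v] D by blast
  next
    fix v assume "v \<in> ({..<N} - ?R t) \<union> (\<Union>w\<in>B. ?R w)"
    then show "v \<in> D"
      using SR BS RN BN by blast
  qed
  then have "sum g D = sum g ({..<N} - ?R t) + sum g (\<Union>w\<in>B. ?R w)"
    using BR finB finite_desc[of "\<lambda>y. y < N" P]
    by (simp only:) (intro sum.union_disjoint; auto)
  also have "sum g (\<Union>w\<in>B. ?R w) = (\<Sum>w\<in>B. sum g (?R w))"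
    using finB disj finite_desc[of "\<lambda>y. y < N" P] by (intro sum.UNION_disjoint) auto
  finally have eq: "sum g D = (\<Sum>w\<in>B. sum g (?R w)) + sum g ({..<N} - ?R t)"
    by simp
  show ?thesis
    unfolding eq using finB BN tN
    by (intro sums.add sums_sum) (auto simp: branches_def)
qed

text \<open>A nonempty branch of the upper kind contains the root, so disjointness leaves at most
  one. Its lower end is the top of what remains, and from every other remaining node the parent
  remains as well.\<close>

lemma conn_complement_branches:
  assumes rt: "rooted N E P od" and tree: "conn E {..<N}"
    and X: "X \<subseteq> branches N P" and disj: "\<And>A B. A \<in> X \<Longrightarrow> B \<in> X \<Longrightarrow> A \<noteq> B \<Longrightarrow> A \<inter> B = {}"
    and ne: "{..<N} - \<Union>X \<noteq> {}"
  shows "conn E ({..<N} - \<Union>X)"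
proof -
  let ?R = "sub N P"
  let ?S = "{..<N} - \<Union>X"
  obtain r where r: "r < N" "\<And>v. v < N \<Longrightarrow> v \<noteq> r \<Longrightarrow> P v < N"
    "\<And>v. v < N \<Longrightarrow> v \<in> desc (\<lambda>y. y \<in> {..<N} \<and> P y \<in> {..<N}) P r"
    by (rule conn_top[OF rt order.refl tree]) simp
  have "desc (\<lambda>y. y \<in> {..<N} \<and> P y \<in> {..<N}) P r \<subseteq> ?R r"
    unfolding desc_def links_def by (intro Collect_mono impI, erule rtrancl_mono[THEN subsetD, rotated]) auto
  then have Rr: "?R r = {..<N}"
    using r sub_less[OF rt] by blast
  have upX: "r \<in> {..<N} - ?R t \<or> {..<N} - ?R t = {}" if "t < N" for t
  proof (cases "t = r")
    case False
    have "r \<notin> ?R t"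
    proof
      assume "r \<in> ?R t"
      moreover have "t \<in> ?R r"
        using Rr that by simp
      ultimately show False
        using sub_antisym[OF rt] False by blast
    qed
    then show ?thesis
      using r(1) by blast
  qed (use Rr in auto)
  \<comment> \<open>\<open>t\<close> is the node whose upper branch is removed, or the root if no
    nonempty upper branch is; in the second case the branch of \<open>t\<close> is empty.\<close>
  obtain t where t: "t < N" and up: "\<And>u. u < N \<Longrightarrow> {..<N} - ?R u \<in> X \<Longrightarrow> {..<N} - ?R u \<subseteq> {..<N} - ?R t"
    and tX: "{..<N} - ?R t \<subseteq> \<Union>X"
  proof (cases "\<exists>t<N. {..<N} - ?R t \<in> X \<and> {..<N} - ?R t \<noteq> {}")
    case True
    then obtain t where t: "t < N" "{..<N} - ?R t \<in> X" "{..<N} - ?R t \<noteq> {}"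
      by blast
    have rt: "r \<in> {..<N} - ?R t"
      using upX t by blast
    show ?thesis
    proof (rule that[OF t(1)])
      fix u assume u: "u < N" "{..<N} - ?R u \<in> X"
      show "{..<N} - ?R u \<subseteq> {..<N} - ?R t"
        using upX[OF u(1)] disj[OF u(2) t(2)] rt by blast
    qed (use t in blast)
  next
    case False
    then show ?thesis
      using that[OF r(1)] Rr by blast
  qed
  have SR: "?S \<subseteq> ?R t"
    using tX by blast
  \<comment> \<open>A removed subtree that contains \<open>P v\<close> contains \<open>v\<close>,
    and a removed upper branch avoids everything below \<open>t\<close>.\<close>
  have step: "P v \<in> ?S" if v: "v \<in> ?S" "v \<noteq> t" for v
  proof -
    have Pv: "P v \<in> ?R t"
      using desc_up[of v _ P t] SR v by blast
    have "P v \<notin> A" if A: "A \<in> X" for A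
    proof
      assume PA: "P v \<in> A"
      from A X consider w where "w < N" "A = ?R w" | u where "u < N" "A = {..<N} - ?R u"
        by (auto simp: branches_def)
      then show False
      proof cases
        case 1
        then have "v \<in> A"
          using PA desc_step[of "\<lambda>y. y < N" v v P] v desc_trans[of v _ P "P v" w] by auto
        then show ?thesis
          using v A by blast
      next
        case 2
        then show ?thesis
          using up[of u] A PA Pv by blast
      qed
    qed
    then show ?thesis
      using sub_less[OF rt Pv t] by blast
  qed
  have "v \<in> ?S \<Longrightarrow> t \<in> ?S" for v
  proof (induction "N - rank N od v" arbitrary: v rule: less_induct)
    case less
    show ?case
    proof (cases "v = t")
      case False
      then have "P v \<in> ?S"
        using step less.prems by blast
      moreover have "N - rank N od (P v) < N - rank N od v"
        using rank_parent[OF rt, of v] rank_less[OF rt, of v] less.prems by (auto intro!: diff_less_mono2)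
      ultimately show ?thesis
        using less.hyps by blast
    qed (use less.prems in simp)
  qed
  then have "t \<in> ?S"
    using ne by blast
  then show ?thesis
    using step by (intro conn_of_top[OF rt]) auto
qed

section \<open>Weights that force a rainbow set\<close>

text \<open>Carrying pairs of equal powers of two never increases the number of summands.\<close>

lemma sum_pow2_ge:
  fixes N :: "nat \<Rightarrow> nat"
  assumes "(\<Sum>j<l. N j * 2 ^ j) + 1 = q * 2 ^ l"
  shows "l \<le> (\<Sum>j<l. N j)" and "(\<Sum>j<l. N j) = l \<Longrightarrow> \<forall>j<l. N j = 1"
proof -
  have "l \<le> (\<Sum>j<l. N j) \<and> ((\<Sum>j<l. N j) = l \<longrightarrow> (\<forall>j<l. N j = 1))"
    using assms
  proof (induction l arbitrary: N)
    case (Suc l)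
    have eq: "N 0 + 2 * (\<Sum>j<l. N (Suc j) * 2 ^ j) + 1 = 2 * (q * 2 ^ l)"
      using Suc.prems by (subst (asm) sum.lessThan_Suc_shift) (simp add: sum_distrib_left mult.assoc mult.left_commute)
    then have "odd (N 0)"
      by presburger
    then obtain r where r: "N 0 = 2 * r + 1"
      by (auto elim: oddE)
    have sumN: "(\<Sum>j<Suc l. N j) = 2 * r + 1 + (\<Sum>j<l. N (Suc j))"
      by (subst sum.lessThan_Suc_shift) (simp add: r)
    show ?case
    proof (cases l)
      case 0
      then show ?thesis
        using r by simp
    next
      case (Suc k)
      \<comment> \<open>Of the 2r + 1 ones, r pairs become r twos; the last one accounts for the
        lowest bit, and the rest is divided by two.\<close>
      define N' where "N' j = N (Suc j) + (if j = 0 then r else 0)" for j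
      have "(\<Sum>j<l. N' j * 2 ^ j) = (\<Sum>j<l. N (Suc j) * 2 ^ j) + (\<Sum>j<l. (if j = 0 then r else 0) * 2 ^ j)"
        by (simp add: N'_def sum.distrib distrib_right)
      also have "(\<Sum>j<l. (if j = 0 then r else 0) * 2 ^ j) = r"
        unfolding Suc by (subst sum.lessThan_Suc_shift) simp
      finally have "(\<Sum>j<l. N' j * 2 ^ j) + 1 = q * 2 ^ l"
        using eq r by simp
      note IH = Suc.IH[OF this]
      have sumN': "(\<Sum>j<l. N' j) = (\<Sum>j<l. N (Suc j)) + r"
        unfolding N'_def sum.distrib Suc by (simp add: sum.lessThan_Suc_shift)
      show ?thesis
      proof (intro conjI impI allI)
        show "Suc l \<le> (\<Sum>j<Suc l. N j)"
          using IH sumN sumN' by linarith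
        fix j assume sum: "(\<Sum>j<Suc l. N j) = Suc l" and j: "j < Suc l"
        have "r = 0" "(\<Sum>j<l. N' j) = l"
          using IH sumN sumN' sum by linarith+
        then show "N j = 1"
          using IH j r by (cases j) (auto simp: N'_def)
      qed
    qed
  qed simp
  then show "l \<le> (\<Sum>j<l. N j)" "(\<Sum>j<l. N j) = l \<Longrightarrow> \<forall>j<l. N j = 1"
    by auto
qed

text \<open>Label \<open>0\<close> marks forbidden vertices; its weight exceeds the target \<open>(l + 1) * 2 ^ l - 1\<close>.\<close>

definition weight :: "nat \<Rightarrow> nat \<Rightarrow> nat" where
  "weight l j = (if j = 0 then (l + 1) * 2 ^ l else 2 ^ l + 2 ^ (j - 1))"

lemma sum_pow2: "(\<Sum>j<l. 2 ^ j) + 1 = (2 ^ l :: nat)"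
  by (induction l) auto

lemma sum_weight_rainbow:
  assumes "bij_betw lab D {1..l}"
  shows "(\<Sum>v\<in>D. weight l (lab v)) + 1 = (l + 1) * 2 ^ l"
proof -
  have "(\<Sum>v\<in>D. weight l (lab v)) = (\<Sum>j\<in>{1..l}. weight l j)"
    using assms by (rule sum.reindex_bij_betw)
  also have "\<dots> = (\<Sum>j<l. weight l (Suc j))"
    by (rule sum.reindex_bij_witness[of _ Suc "\<lambda>j. j - 1"]) auto
  also have "\<dots> = l * 2 ^ l + (\<Sum>j<l. 2 ^ j)"
    by (simp add: weight_def sum.distrib)
  finally show ?thesis
    using sum_pow2[of l] by simp
qed

text \<open>\<open>m v\<close> counts how often \<open>v\<close> is covered. The summands 2^l allow
  at most \<open>l\<close> coverings in all; what they leave over forces the small powers to sum to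
  -1 modulo 2^l, and by \<open>sum_pow2_ge\<close> this takes at least \<open>l\<close> of them,
  each exactly once in the case of equality.\<close>

lemma rainbow_of_sum_weight:
  fixes m lab :: "nat \<Rightarrow> nat"
  assumes V: "finite V" and lab: "\<And>v. v \<in> V \<Longrightarrow> lab v \<le> l"
    and sum: "(\<Sum>v\<in>V. m v * weight l (lab v)) + 1 = (l + 1) * 2 ^ l"
  shows "v \<in> V \<Longrightarrow> m v \<le> 1" and "bij_betw lab {v \<in> V. m v > 0} {1..l}"
proof -
  define c where "c j = (\<Sum>v\<in>{v \<in> V. lab v = j}. m v)" for j
  have "(\<Sum>v\<in>V. m v * weight l (lab v)) = (\<Sum>j\<le>l. \<Sum>v\<in>{v \<in> V. lab v = j}. m v * weight l (lab v))"
    using V lab by (intro sum.group[symmetric]) auto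
  also have "\<dots> = (\<Sum>j\<le>l. c j * weight l j)"
    by (simp add: c_def sum_distrib_right)
  also have "{..l} = insert 0 (Suc ` {..<l})"
    by (simp add: lessThan_Suc_atMost[symmetric] lessThan_Suc_eq_insert_0)
  also have "(\<Sum>j\<in>insert 0 (Suc ` {..<l}). c j * weight l j) = c 0 * weight l 0 + (\<Sum>j<l. c (Suc j) * weight l (Suc j))"
    by (simp add: sum.reindex)
  finally have tot: "c 0 * ((l + 1) * 2 ^ l) + (\<Sum>j<l. c (Suc j)) * 2 ^ l + (\<Sum>j<l. c (Suc j) * 2 ^ j) + 1 = (l + 1) * 2 ^ l"
    using sum by (simp add: weight_def sum.distrib distrib_left sum_distrib_right)
  have c0: "c 0 = 0"
  proof (rule ccontr)
    assume "c 0 \<noteq> 0"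
    then have "(l + 1) * 2 ^ l \<le> c 0 * ((l + 1) * 2 ^ l)"
      by simp
    then show False
      using tot by linarith
  qed
  let ?t = "\<Sum>j<l. c (Suc j)"
  have "?t * 2 ^ l < (l + 1) * 2 ^ l"
    using tot by linarith
  then have "\<not> l + 1 \<le> ?t"
    using mult_le_mono1[of "l + 1" ?t "2 ^ l"] by linarith
  then have t: "?t \<le> l"
    by simp
  \<comment> \<open>\<open>d\<close> is the number of coverings missing to \<open>l\<close>. Moving
    the summands 2^l to the other side shows that the small powers sum to (d + 1) * 2^l - 1.\<close>
  then obtain d where d: "l = ?t + d"
    using le_Suc_ex by blast
  have "?t * 2 ^ l + ((\<Sum>j<l. c (Suc j) * 2 ^ j) + 1) = (l + 1) * 2 ^ l"
    using tot c0 by simp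
  also have "\<dots> = ?t * 2 ^ l + (d + 1) * 2 ^ l"
    using d by (metis add.assoc distrib_right)
  finally have eq: "(\<Sum>j<l. c (Suc j) * 2 ^ j) + 1 = (d + 1) * 2 ^ l"
    by simp
  have "?t = l"
    using sum_pow2_ge(1)[OF eq] t by simp
  then have c1: "c (Suc j) = 1" if "j < l" for j
    using sum_pow2_ge(2)[OF eq] that by simp
  have cl: "c j = (if j = 0 then 0 else 1)" if "j \<le> l" for j
    using c0 c1 that by (cases j) auto
  have le: "m v \<le> c (lab v)" if "v \<in> V" for v
    unfolding c_def using V that by (intro member_le_sum) auto
  show "m v \<le> 1" if "v \<in> V" for v
    using le[OF that] cl[OF lab[OF that]] by (simp split: if_splits)
  show "bij_betw lab {v \<in> V. m v > 0} {1..l}"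
  proof (rule bij_betw_imageI)
    show "inj_on lab {v \<in> V. m v > 0}"
    proof (rule inj_onI, rule ccontr)
      fix v w assume v: "v \<in> {v \<in> V. m v > 0}" "w \<in> {v \<in> V. m v > 0}" and lw: "lab v = lab w" and "v \<noteq> w"
      have "(\<Sum>x\<in>{v, w}. m x) \<le> c (lab v)"
        unfolding c_def using V v lw by (intro sum_mono2) auto
      then show False
        using v \<open>v \<noteq> w\<close> cl[OF lab, of v] by (auto split: if_splits)
    qed
    show "lab ` {v \<in> V. m v > 0} = {1..l}"
    proof (intro equalityI subsetI)
      fix j assume "j \<in> lab ` {v \<in> V. m v > 0}"
      then obtain v where "v \<in> V" "m v > 0" "j = lab v"
        by blast
      then show "j \<in> {1..l}"
        using le[of v] cl[OF lab, of v] lab[of v] by (auto split: if_splits)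
    next
      fix j assume "j \<in> {1..l}"
      then have "c j \<noteq> 0"
        using cl[of j] by auto
      then obtain v where "v \<in> V" "lab v = j" "m v \<noteq> 0"
        unfolding c_def using V by (auto simp: sum_eq_0_iff)
      then show "j \<in> lab ` {v \<in> V. m v > 0}"
        by auto
    qed
  qed
qed

section \<open>Matchings in a forest as flows\<close>

text \<open>Nodes below \<open>n\<close> are vertices, the nodes \<open>n..N-1\<close> are colors with multiplicities \<open>M\<close>. The dummy
  parent \<open>N\<close> of the roots acts as a color of multiplicity \<open>0\<close>.\<close>

locale vcforest =
  fixes n N :: nat and E :: "nat set set" and P od M :: "nat \<Rightarrow> nat"
  assumes rt: "rooted N E P od" and nN: "n \<le> N"
    and bip: "\<And>e. e \<in> E \<Longrightarrow> \<exists>v c. v < n \<and> n \<le> c \<and> c < N \<and> e = {v, c}"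
    and MN: "M N = 0"
begin

definition cc :: "nat \<Rightarrow> nat set" where
  "cc y = {c. n \<le> c \<and> c < N \<and> P c = y}"

definition vc :: "nat \<Rightarrow> nat set" where
  "vc y = {v. v < n \<and> P v = y}"

lemma finite_cc [simp]: "finite (cc y)" and finite_vc [simp]: "finite (vc y)"
  by (auto simp: cc_def vc_def)

lemma parent_edge: "x < N \<Longrightarrow> P x < N \<Longrightarrow> {x, P x} \<in> E"
  using rt unfolding rooted_def by blast

lemma edge_parent: "e \<in> E \<Longrightarrow> \<exists>x<N. P x < N \<and> e = {x, P x}"
  using rt unfolding rooted_def by blast

lemma vertex_parent:
  assumes "v < n" shows "n \<le> P v" "P v \<le> N"
proof -
  show le: "P v \<le> N"
    using parent_le[OF rt, of v] assms nN by simp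
  show "n \<le> P v"
  proof (cases "P v < N")
    case True
    then obtain w c where "w < n" "n \<le> c" "{v, P v} = {w, c}"
      using bip[OF parent_edge[of v]] assms nN by auto
    then show ?thesis
      using assms by (auto simp: doubleton_eq_iff)
  qed (use nN le in simp)
qed

lemma color_parent:
  assumes "n \<le> c" "c < N" shows "P c < n \<or> P c = N"
proof (cases "P c < N")
  case True
  then obtain w d where "w < n" "n \<le> d" "{c, P c} = {w, d}"
    using bip[OF parent_edge[of c]] assms nN by auto
  then show ?thesis
    using assms by (auto simp: doubleton_eq_iff)
qed (use parent_le[OF rt assms(2)] in simp)

lemma parent_parent: "x < N \<Longrightarrow> P x < N \<Longrightarrow> P (P x) \<noteq> x"
  using rank_parent[OF rt, of x] rank_parent[OF rt, of "P x"] by auto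

definition valid :: "nat set \<Rightarrow> bool" where
  "valid D \<longleftrightarrow> (\<exists>f. (\<forall>v\<in>{..<n} - D. {v, f v} \<in> E) \<and>
     (\<forall>c\<in>{n..<N}. card {v \<in> {..<n} - D. f v = c} = M c))"

text \<open>\<open>u x = 1\<close> iff the edge from \<open>x\<close> to its parent is used by the color assignment.\<close>

definition flow :: "nat set \<Rightarrow> (nat \<Rightarrow> nat) \<Rightarrow> bool" where
  "flow D u \<longleftrightarrow> (\<forall>v<n. u v + (\<Sum>c\<in>cc v. u c) = (if v \<in> D then 0 else 1)) \<and>
     (\<forall>c\<in>{n..<N}. u c + (\<Sum>v\<in>vc c. u v) = M c) \<and> (\<forall>x<N. P x = N \<longrightarrow> u x = 0)"

lemma flow_vertex: "flow D u \<Longrightarrow> v < n \<Longrightarrow> u v + (\<Sum>c\<in>cc v. u c) = (if v \<in> D then 0 else 1)"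
  and flow_color: "flow D u \<Longrightarrow> n \<le> c \<Longrightarrow> c < N \<Longrightarrow> u c + (\<Sum>v\<in>vc c. u v) = M c"
  and flow_root: "flow D u \<Longrightarrow> x < N \<Longrightarrow> P x = N \<Longrightarrow> u x = 0"
  by (simp_all add: flow_def)

text \<open>A flow is a function to the naturals without capacities. Every edge of the forest has a
  vertex as one end, and the equation at that vertex bounds it by 1.\<close>

lemma flow_le_1:
  assumes "flow D u" "x < N" shows "u x \<le> 1"
proof (cases "x < n")
  case True
  then show ?thesis
    using flow_vertex[OF assms(1) True] by (simp split: if_splits)
next
  case False
  then consider "P x < n" | "P x = N"
    using color_parent[of x] assms(2) by linarith
  then show ?thesis
  proof cases
    case 1
    have "u x \<le> (\<Sum>c\<in>cc (P x). u c)"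
      using False assms(2) by (intro member_le_sum) (auto simp: cc_def)
    then show ?thesis
      using flow_vertex[OF assms(1) 1] by (simp split: if_splits)
  qed (use flow_root[OF assms] in simp)
qed

lemma edge_cases:
  assumes "v < n" "{v, c} \<in> E"
  shows "n \<le> c" "c < N" "P v = c \<or> P c = v"
proof -
  obtain w d where "w < n" "n \<le> d" "d < N" "{v, c} = {w, d}"
    using bip[OF assms(2)] by blast
  then show "n \<le> c" "c < N"
    using assms(1) by (auto simp: doubleton_eq_iff)
  obtain x where "x < N" "{v, c} = {x, P x}"
    using edge_parent[OF assms(2)] by blast
  then show "P v = c \<or> P c = v"
    by (auto simp: doubleton_eq_iff)
qed

lemma valid_imp_flow:
  assumes "valid D" shows "\<exists>u. flow D u"
proof -
  obtain f where "\<forall>v\<in>{..<n} - D. {v, f v} \<in> E"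
    "\<forall>c\<in>{n..<N}. card {v \<in> {..<n} - D. f v = c} = M c"
    using assms unfolding valid_def by blast
  then have f: "\<And>v. v < n \<Longrightarrow> v \<notin> D \<Longrightarrow> {v, f v} \<in> E"
    and M: "\<And>c. n \<le> c \<Longrightarrow> c < N \<Longrightarrow> card {v \<in> {..<n} - D. f v = c} = M c"
    by (simp_all only: Diff_iff lessThan_iff atLeastLessThan_iff Ball_def) blast+
  \<comment> \<open>The edge between \<open>x\<close> and its parent is used iff its vertex end is
    kept and assigned to its color end. Which end is the vertex depends on whether
    \<open>x < n\<close>.\<close>
  define u where "u x = (if x < n then (if x \<notin> D \<and> f x = P x then 1 else 0)
    else (if P x < n \<and> P x \<notin> D \<and> f (P x) = x then 1 else 0 :: nat))" for x
  have "flow D u"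
    unfolding flow_def
  proof (intro conjI allI impI ballI)
    fix v assume v: "v < n"
    have uc: "u c = (if v \<notin> D \<and> f v = c then 1 else 0)" if "c \<in> cc v" for c
      using that v by (auto simp: u_def cc_def)
    show "u v + (\<Sum>c\<in>cc v. u c) = (if v \<in> D then 0 else 1)"
    proof (cases "v \<in> D")
      case True
      then show ?thesis
        using uc v by (simp add: u_def)
    next
      case False
      note e = edge_cases[OF v f[OF v False]]
      have sum: "(\<Sum>c\<in>cc v. u c) = (if f v \<in> cc v then 1 else 0)"
      proof -
        have "(\<Sum>c\<in>cc v. u c) = (\<Sum>c\<in>cc v. if f v = c then 1 else 0)"
          using uc False by (intro sum.cong) auto
        then show ?thesis
          by simp
      qed
      \<comment> \<open>The edge to \<open>f v\<close> leads either up or down, but not both, since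
        a node is not its own grandparent.\<close>
      have "f v \<in> cc v \<longleftrightarrow> f v \<noteq> P v"
      proof -
        have "P v = f v \<Longrightarrow> P (f v) \<noteq> v"
          using parent_parent[of v] e(2) v nN by simp
        then show ?thesis
          unfolding cc_def mem_Collect_eq using e by metis
      qed
      then show ?thesis
        using sum False v by (simp add: u_def)
    qed
  next
    fix c assume "c \<in> {n..<N}"
    then have c: "n \<le> c" "c < N"
      by auto
    have "(\<Sum>v\<in>vc c. u v) = card {v \<in> vc c. v \<notin> D \<and> f v = c}"
    proof -
      have "(\<Sum>v\<in>vc c. u v) = (\<Sum>v\<in>vc c. if v \<notin> D \<and> f v = c then 1 else 0)"
        by (intro sum.cong) (auto simp: vc_def u_def)
      then show ?thesis
        by (simp add: sum.If_cases Int_def)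
    qed
    moreover have "u c = card {v. v = P c \<and> v < n \<and> v \<notin> D \<and> f v = c}"
    proof (cases "P c < n \<and> P c \<notin> D \<and> f (P c) = c")
      case True
      then have "{v. v = P c \<and> v < n \<and> v \<notin> D \<and> f v = c} = {P c}"
        by auto
      then show ?thesis
        using True c by (simp add: u_def)
    next
      case False
      then have "{v. v = P c \<and> v < n \<and> v \<notin> D \<and> f v = c} = {}"
        by auto
      then show ?thesis
        using False c by (auto simp: u_def)
    qed
    moreover have "card {v. v = P c \<and> v < n \<and> v \<notin> D \<and> f v = c} + card {v \<in> vc c. v \<notin> D \<and> f v = c} =
      card ({v. v = P c \<and> v < n \<and> v \<notin> D \<and> f v = c} \<union> {v \<in> vc c. v \<notin> D \<and> f v = c})"
      using parent_parent[OF c(2)] nN by (intro card_Un_disjoint[symmetric]) (auto simp: vc_def)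
    moreover have "{v. v = P c \<and> v < n \<and> v \<notin> D \<and> f v = c} \<union> {v \<in> vc c. v \<notin> D \<and> f v = c} =
      {v \<in> {..<n} - D. f v = c}"
    proof (intro equalityI subsetI)
      fix v assume "v \<in> {v \<in> {..<n} - D. f v = c}"
      then have v: "v < n" "v \<notin> D" "f v = c"
        by auto
      then show "v \<in> {v. v = P c \<and> v < n \<and> v \<notin> D \<and> f v = c} \<union> {v \<in> vc c. v \<notin> D \<and> f v = c}"
        using edge_cases(3)[OF v(1) f[OF v(1,2)]] by (auto simp: vc_def)
    qed (auto simp: vc_def)
    ultimately show "u c + (\<Sum>v\<in>vc c. u v) = M c"
      using M[OF c] by simp
  next
    fix x assume x: "x < N" "P x = N"
    then show "u x = 0"
      using nN edge_cases(2)[of x "f x"] f[of x] by (auto simp: u_def)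
  qed
  then show ?thesis
    by blast
qed

lemma flow_imp_valid:
  assumes fl: "flow D u" shows "valid D"
proof -
  \<comment> \<open>The other end of the one used edge at \<open>v\<close>. The choice is
    determined, as the equation at \<open>v\<close> rules out a second used edge.\<close>
  define f where "f v = (if u v = 1 then P v else (SOME c. c \<in> cc v \<and> u c = 1))" for v
  have f1: "u v = 1 \<and> f v = P v \<and> P v < N \<or> u v = 0 \<and> f v \<in> cc v \<and> u (f v) = 1"
    if v: "v < n" "v \<notin> D" for v
  proof (cases "u v = 1")
    case True
    then show ?thesis
      using flow_root[OF fl, of v] v(1) nN vertex_parent(2)[OF v(1)] by (auto simp: f_def le_less)
  next
    case False
    then have uv: "u v = 0"
      using flow_le_1[OF fl, of v] v(1) nN by simp
    then have "(\<Sum>c\<in>cc v. u c) = 1"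
      using flow_vertex[OF fl v(1)] v(2) by simp
    then obtain c where "c \<in> cc v" "u c \<noteq> 0"
      by (metis sum.neutral zero_neq_one)
    then have "\<exists>c. c \<in> cc v \<and> u c = 1"
      using flow_le_1[OF fl, of c] by (auto simp: cc_def intro!: exI[of _ c])
    then have "f v \<in> cc v \<and> u (f v) = 1"
      using someI_ex[of "\<lambda>c. c \<in> cc v \<and> u c = 1"] uv by (simp add: f_def)
    then show ?thesis
      using uv by simp
  qed
  show ?thesis
    unfolding valid_def
  proof (intro exI conjI ballI)
    fix v assume "v \<in> {..<n} - D"
    then have v: "v < n" "v \<notin> D"
      by auto
    show "{v, f v} \<in> E"
      using f1[OF v] parent_edge[of v] parent_edge[of "f v"] v nN by (auto simp: cc_def insert_commute)
  next
    fix c assume "c \<in> {n..<N}"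
    then have c: "n \<le> c" "c < N"
      by auto
    let ?A = "{v. v = P c \<and> u c = 1}" and ?B = "{v \<in> vc c. u v = 1}"
    have eq: "{v \<in> {..<n} - D. f v = c} = ?A \<union> ?B"
    proof (intro equalityI subsetI)
      fix v assume "v \<in> {v \<in> {..<n} - D. f v = c}"
      then show "v \<in> ?A \<union> ?B"
        using f1[of v] by (auto simp: cc_def vc_def)
    next
      fix v assume "v \<in> ?A \<union> ?B"
      then show "v \<in> {v \<in> {..<n} - D. f v = c}"
      proof
        assume "v \<in> ?A"
        then have v: "v = P c" "u c = 1"
          by auto
        then have vn: "v < n"
          using flow_root[OF fl c(2)] color_parent[OF c] by auto
        have cv: "c \<in> cc v"
          using c v by (simp add: cc_def)
        have "u c \<le> (\<Sum>c\<in>cc v. u c)"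
          using cv by (intro member_le_sum) auto
        then have vD: "v \<notin> D" and uv: "u v = 0" and sum: "(\<Sum>c\<in>cc v. u c) = 1"
          using flow_vertex[OF fl vn] v(2) by (auto split: if_splits)
        have "f v = c"
        proof (rule ccontr)
          assume "f v \<noteq> c"
          then have "(\<Sum>d\<in>{f v, c}. u d) = 2"
            using f1[OF vn vD] uv v(2) by simp
          moreover have "(\<Sum>d\<in>{f v, c}. u d) \<le> (\<Sum>c\<in>cc v. u c)"
            using cv f1[OF vn vD] uv by (intro sum_mono2) auto
          ultimately show False
            using sum by simp
        qed
        then show ?thesis
          using vn vD by simp
      next
        assume "v \<in> ?B"
        then have v: "v < n" "P v = c" "u v = 1"
          by (auto simp: vc_def)
        then show ?thesis
          using flow_vertex[OF fl v(1)] by (auto simp: f_def split: if_splits)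
      qed
    qed
    have "card (?A \<union> ?B) = card ?A + card ?B"
      using parent_parent[OF c(2)] flow_root[OF fl c(2)] color_parent[OF c] nN
      by (intro card_Un_disjoint) (auto simp: vc_def)
    moreover have "card ?A = u c"
      using flow_le_1[OF fl c(2)] by (cases "u c = 1") auto
    moreover have "card ?B = (\<Sum>v\<in>vc c. u v)"
    proof -
      have "(\<Sum>v\<in>vc c. u v) = (\<Sum>v\<in>vc c. if u v = 1 then 1 else 0)"
      proof (rule sum.cong)
        fix v assume "v \<in> vc c"
        then show "u v = (if u v = 1 then 1 else 0)"
          using flow_le_1[OF fl, of v] nN by (auto simp: vc_def)
      qed simp
      then show ?thesis
        by (simp add: sum.If_cases Int_def)
    qed
    ultimately show "card {v \<in> {..<n} - D. f v = c} = M c"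
      unfolding eq using flow_color[OF fl c] by simp
  qed
qed

end

section \<open>Needs, classes and labels\<close>

context vcforest
begin

text \<open>\<open>a c\<close> counts the children of \<open>c\<close> that need \<open>c\<close> unless a vertex is deleted below them, and
  \<open>q v\<close> counts the child colors of \<open>v\<close> that cannot do without \<open>v\<close>.\<close>

definition status :: "(nat \<Rightarrow> nat) \<Rightarrow> (nat \<Rightarrow> nat) \<Rightarrow> bool" where
  "status q a \<longleftrightarrow> (\<forall>y. y < n \<or> y = N \<longrightarrow> q y = card {c \<in> cc y. a c < M c}) \<and>
     (\<forall>c. n \<le> c \<and> c \<le> N \<longrightarrow> a c = card {v \<in> vc c. q v = 0})"

text \<open>Necessary for any flow: a vertex can serve at most one child color in need, the dummy
  none, and beyond the children counted by \<open>a\<close> a color can gain at most one vertex, its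
  parent.\<close>

definition feasible :: "(nat \<Rightarrow> nat) \<Rightarrow> (nat \<Rightarrow> nat) \<Rightarrow> bool" where
  "feasible q a \<longleftrightarrow> (\<forall>v<n. q v \<le> 1) \<and> q N = 0 \<and> (\<forall>c. n \<le> c \<and> c < N \<longrightarrow> M c \<le> a c + 1)"

text \<open>The classes of color \<open>c\<close> have the numbers \<open>first a c + 1, \<dots>, first a (c + 1)\<close>.\<close>

definition first :: "(nat \<Rightarrow> nat) \<Rightarrow> nat \<Rightarrow> nat" where
  "first a c = (\<Sum>d\<in>{n..<c}. a d - M d)"

definition before :: "(nat \<Rightarrow> nat) \<Rightarrow> (nat \<Rightarrow> bool) \<Rightarrow> nat \<Rightarrow> nat" where
  "before q Z v = card {w \<in> vc (P v). w < v \<and> q w = 0 \<and> Z w}"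

text \<open>Decodes the tape. The digit at index \<open>first a c + b\<close> says how many held
  children of \<open>c\<close> precede the chosen child number \<open>b\<close>; a child is chosen
  when the current count of held siblings matches. Only smaller siblings are consulted, so one pass
  over the vertices computes \<open>cls\<close>. Class numbers are indices plus one, as 0 means that
  no class is opened.\<close>

definition assigned :: "(nat \<Rightarrow> nat) \<Rightarrow> (nat \<Rightarrow> nat) \<Rightarrow> (nat \<Rightarrow> nat) \<Rightarrow> (nat \<Rightarrow> nat) \<Rightarrow> bool" where
  "assigned q a \<tau> cls \<longleftrightarrow> (\<forall>v<n. q v = 0 \<longrightarrow> cls v =
     (if before q (\<lambda>w. cls w \<noteq> 0) v < a (P v) - M (P v) \<and>
         \<tau> (first a (P v) + before q (\<lambda>w. cls w \<noteq> 0) v) = before q (\<lambda>w. cls w = 0) v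
      then first a (P v) + before q (\<lambda>w. cls w \<noteq> 0) v + 1 else 0))"

lemma before_less:
  assumes "P v = P w" "v < w" "v < n" "q v = 0" "Z v"
  shows "before q Z v < before q Z w"
proof -
  let ?A = "\<lambda>v. {x \<in> vc (P w). x < v \<and> q x = 0 \<and> Z x}"
  have "v \<in> ?A w" "v \<notin> ?A v" "?A v \<subseteq> ?A w"
    using assms by (auto simp: vc_def)
  then have "?A v \<subset> ?A w"
    by blast
  then show ?thesis
    unfolding before_def assms(1) by (intro psubset_card_mono) auto
qed

lemma assignedD:
  "assigned q a \<tau> cls \<Longrightarrow> v < n \<Longrightarrow> q v = 0 \<Longrightarrow> cls v =
     (if before q (\<lambda>w. cls w \<noteq> 0) v < a (P v) - M (P v) \<and>
         \<tau> (first a (P v) + before q (\<lambda>w. cls w \<noteq> 0) v) = before q (\<lambda>w. cls w = 0) v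
      then first a (P v) + before q (\<lambda>w. cls w \<noteq> 0) v + 1 else 0)"
  by (simp add: assigned_def)

text \<open>A deletion below a node turns into a demand on its parent, so labels are inherited from
  above. A chosen vertex absorbs this demand and starts its own class. A vertex with
  \<open>q x \<noteq> 0\<close> is already taken by a child color and cannot meet a demand, nor can
  the missing parent of a root; hence the label 0 there.\<close>

definition labelled :: "(nat \<Rightarrow> nat) \<Rightarrow> (nat \<Rightarrow> nat) \<Rightarrow> (nat \<Rightarrow> nat) \<Rightarrow> bool" where
  "labelled q cls lab \<longleftrightarrow> lab N = 0 \<and> (\<forall>x<N. lab x =
     (if x < n \<and> q x \<noteq> 0 then 0 else if x < n \<and> cls x \<noteq> 0 then cls x else lab (P x)))"

lemma status_q: "status q a \<Longrightarrow> y < n \<or> y = N \<Longrightarrow> q y = card {c \<in> cc y. a c < M c}"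
  and status_a: "status q a \<Longrightarrow> n \<le> c \<Longrightarrow> c \<le> N \<Longrightarrow> a c = card {v \<in> vc c. q v = 0}"
  by (auto simp: status_def)

lemma first_Suc: "n \<le> c \<Longrightarrow> first a (Suc c) = first a c + (a c - M c)"
  by (simp add: first_def)

lemma first_mono: "c \<le> d \<Longrightarrow> first a c \<le> first a d"
  unfolding first_def by (intro sum_mono2) auto

lemma sum_parents:
  fixes g :: "nat \<Rightarrow> nat"
  shows "(\<Sum>c\<in>{n..N}. \<Sum>v\<in>vc c. g v) = (\<Sum>v<n. g v)"
proof -
  have "(\<Sum>c\<in>{n..N}. \<Sum>v\<in>{v \<in> {..<n}. P v = c}. g v) = (\<Sum>v<n. g v)"
    using vertex_parent by (intro sum.group) auto
  then show ?thesis
    by (simp add: vc_def)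
qed

text \<open>Feasibility splits the vertices into those counted in some \<open>a c\<close> and those
  taken by exactly one color with \<open>a c < M c\<close>, which gives \<open>n\<close> in total.
  Color by color, \<open>a c\<close> plus this possible one equals \<open>M c + (a c - M c)\<close>.
  Summation leaves \<open>n - |M|\<close> for the number of classes.\<close>

lemma first_total:
  assumes st: "status q a" and fe: "feasible q a" and M: "(\<Sum>c\<in>{n..<N}. M c) + l = n"
  shows "first a (Suc N) = l"
proof -
  let ?d = "\<lambda>c. if a c < M c then 1 else 0 :: nat"
  have d: "a c + ?d c = M c + (a c - M c)" if "n \<le> c" "c \<le> N" for c
  proof (cases "c = N")
    case False
    then have "M c \<le> a c + 1"
      using fe that by (simp add: feasible_def)
    then show ?thesis
      by auto
  qed (simp add: MN)
  have "(\<Sum>c\<in>{n..N}. a c) = (\<Sum>c\<in>{n..N}. \<Sum>v\<in>vc c. if q v = 0 then 1 else 0)"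
    using status_a[OF st] by (intro sum.cong) (simp_all add: sum.If_cases Int_def)
  then have a: "(\<Sum>c\<in>{n..N}. a c) = (\<Sum>v<n. if q v = 0 then 1 else 0)"
    by (simp only: sum_parents)
  have "(\<Sum>y\<in>insert N {..<n}. \<Sum>c\<in>{c \<in> {n..<N}. P c = y}. ?d c) = (\<Sum>c\<in>{n..<N}. ?d c)"
    using color_parent by (intro sum.group) force+
  moreover have "(\<Sum>c\<in>{c \<in> {n..<N}. P c = y}. ?d c) = q y" if "y \<in> insert N {..<n}" for y
  proof -
    have "{c \<in> {n..<N}. P c = y} = cc y"
      by (auto simp: cc_def)
    moreover have "q y = card {c \<in> cc y. a c < M c}"
      using that by (intro status_q[OF st]) auto
    ultimately show ?thesis
      by (simp only: sum.If_cases finite_cc) (simp add: Int_def)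
  qed
  ultimately have "(\<Sum>c\<in>{n..<N}. ?d c) = (\<Sum>y\<in>insert N {..<n}. q y)"
    by simp
  also have "\<dots> = (\<Sum>v<n. q v)"
    using fe nN by (simp add: feasible_def)
  finally have q: "(\<Sum>c\<in>{n..<N}. ?d c) = (\<Sum>v<n. q v)" .
  have "(\<Sum>v<n. if q v = 0 then 1 else 0) + (\<Sum>v<n. q v) = (\<Sum>v<n. 1 :: nat)"
    unfolding sum.distrib[symmetric]
  proof (rule sum.cong)
    fix v assume "v \<in> {..<n}"
    then have "q v \<le> 1"
      using fe by (simp add: feasible_def)
    then show "(if q v = 0 then 1 else 0) + q v = 1"
      by auto
  qed simp
  then have tot: "(\<Sum>c\<in>{n..N}. a c) + (\<Sum>c\<in>{n..<N}. ?d c) = n"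
    using a q by simp
  have iN: "{n..N} = insert N {n..<N}" "{n..<Suc N} = {n..N}"
    using nN by auto
  have "(\<Sum>c\<in>{n..N}. a c + ?d c) = (\<Sum>c\<in>{n..N}. M c + (a c - M c))"
    using d by (intro sum.cong) auto
  then have "(\<Sum>c\<in>{n..N}. a c) + (\<Sum>c\<in>{n..N}. ?d c) = (\<Sum>c\<in>{n..N}. M c) + first a (Suc N)"
    by (simp add: sum.distrib first_def iN(2))
  moreover have "(\<Sum>c\<in>{n..N}. ?d c) = (\<Sum>c\<in>{n..<N}. ?d c)" "(\<Sum>c\<in>{n..N}. M c) = (\<Sum>c\<in>{n..<N}. M c)"
    by (simp_all add: iN(1) MN)
  ultimately show ?thesis
    using tot M by linarith
qed

subsection \<open>Regions\<close>

text \<open>The links along which a deletion passes its demand upward: they stop at chosen vertices,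
  which absorb it, and at vertices that are taken by a child color.\<close>

definition lk :: "(nat \<Rightarrow> nat) \<Rightarrow> (nat \<Rightarrow> nat) \<Rightarrow> nat \<Rightarrow> bool" where
  "lk q cls y \<longleftrightarrow> (y < n \<and> q y = 0 \<and> cls y = 0) \<or> (n \<le> y \<and> y < N)"

lemma lk_less: "lk q cls y \<Longrightarrow> y < N"
  using nN by (auto simp: lk_def)

lemma lk_rank: "lk q cls y \<Longrightarrow> rank N od y < rank N od (P y)"
  using lk_less rank_parent[OF rt] by blast

lemma finite_lk: "finite {y. lk q cls y}"
  by (rule finite_subset[of _ "{..<N}"]) (auto dest: lk_less)

abbreviation region :: "(nat \<Rightarrow> nat) \<Rightarrow> (nat \<Rightarrow> nat) \<Rightarrow> nat \<Rightarrow> nat set" where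
  "region q cls \<equiv> desc (lk q cls) P"

definition hits :: "(nat \<Rightarrow> nat) \<Rightarrow> (nat \<Rightarrow> nat) \<Rightarrow> nat set \<Rightarrow> nat \<Rightarrow> nat" where
  "hits q cls D x = card (D \<inter> region q cls x)"

lemma hits_unfold:
  "hits q cls D x = (if x \<in> D then 1 else 0) + (\<Sum>y\<in>{y. lk q cls y \<and> P y = x}. hits q cls D y)"
proof -
  have eq: "hits q cls D = (\<lambda>y. \<Sum>w\<in>region q cls y. if w \<in> D then 1 else 0)"
    using finite_desc[OF finite_lk[of q cls], of P]
    by (intro ext) (simp add: hits_def sum.If_cases Int_commute)
  show ?thesis
    unfolding eq
    by (rule sum_desc[where L = "lk q cls" and P = P and rk = "rank N od", OF lk_rank finite_lk])
qed

lemma hits_vertex: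
  assumes "v < n"
  shows "hits q cls D v = (if v \<in> D then 1 else 0) + (\<Sum>c\<in>cc v. hits q cls D c)"
proof -
  have "{y. lk q cls y \<and> P y = v} = cc v"
    using assms vertex_parent(1) by (force simp: lk_def cc_def)
  then show ?thesis
    using hits_unfold[of q cls D v] by simp
qed

lemma hits_color:
  assumes "n \<le> c" "c < N" "D \<subseteq> {..<n}"
  shows "hits q cls D c = (\<Sum>v\<in>{v \<in> vc c. q v = 0 \<and> cls v = 0}. hits q cls D v)"
proof -
  have "{y. lk q cls y \<and> P y = c} = {v \<in> vc c. q v = 0 \<and> cls v = 0}"
    using assms color_parent by (force simp: lk_def vc_def)
  then show ?thesis
    using hits_unfold[of q cls D c] assms by auto
qed

lemma hits_pos: "w \<in> D \<Longrightarrow> w \<in> region q cls x \<Longrightarrow> 0 < hits q cls D x"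
  unfolding hits_def using finite_desc[OF finite_lk[of q cls], of P x] by (auto simp: card_gt_0_iff)

lemma hits_0: "hits q cls D x = 0 \<longleftrightarrow> D \<inter> region q cls x = {}"
  unfolding hits_def using finite_desc[OF finite_lk[of q cls], of P x] by simp

lemma lab_region:
  assumes lab: "labelled q cls lab" and w: "w \<in> region q cls x"
  shows "lab w = lab x"
  using w unfolding desc_def mem_Collect_eq
proof (induction rule: rtrancl_induct)
  case (step y z)
  then have "lk q cls y" "z = P y"
    by (auto simp: links_def)
  then have "lab y = lab z"
    using lab lk_less[of q cls y] by (auto simp: labelled_def lk_def)
  then show ?case
    using step.IH by simp
qed simp

definition chosen :: "(nat \<Rightarrow> nat) \<Rightarrow> (nat \<Rightarrow> nat) \<Rightarrow> nat \<Rightarrow> bool" where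
  "chosen q cls v \<longleftrightarrow> v < n \<and> q v = 0 \<and> cls v \<noteq> 0"

text \<open>Climbing along the links ends at a chosen vertex, at a vertex taken by a child color, or
  at a root; the label is constant on the way.\<close>

lemma region_cases:
  assumes lab: "labelled q cls lab" and x: "x < N"
  shows "(\<exists>v. chosen q cls v \<and> x \<in> region q cls v \<and> lab x = cls v) \<or>
    (lab x = 0 \<and> (\<exists>t<N. x \<in> region q cls t \<and> (t < n \<and> q t \<noteq> 0 \<or> lk q cls t \<and> P t = N)))"
  using x
proof (induction "N - rank N od x" arbitrary: x rule: less_induct)
  case less
  have labx: "lab x = (if x < n \<and> q x \<noteq> 0 then 0 else if x < n \<and> cls x \<noteq> 0 then cls x else lab (P x))"
    using lab less.prems by (simp add: labelled_def)
  show ?case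
  proof (cases "lk q cls x")
    case True
    then have eq: "lab x = lab (P x)"
      using labx by (auto simp: lk_def)
    show ?thesis
    proof (cases "P x < N")
      case PN: True
      have "N - rank N od (P x) < N - rank N od x"
        using rank_parent[OF rt less.prems] rank_less[OF rt less.prems] by (auto intro!: diff_less_mono2)
      note IH = less.hyps[OF this PN]
      have "x \<in> region q cls v" if "P x \<in> region q cls v" for v
        using desc_step[of "lk q cls" x x P] True that desc_trans[of x _ P "P x" v] by simp
      then show ?thesis
        using IH eq by metis
    next
      case False
      then have "P x = N"
        using parent_le[OF rt less.prems] by simp
      then show ?thesis
        using eq True lab less.prems desc_refl[of x "lk q cls" P] by (auto simp: labelled_def)
    qed
  next
    case False
    then have "x < n" "q x \<noteq> 0 \<or> cls x \<noteq> 0"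
      using less.prems by (auto simp: lk_def)
    then show ?thesis
      using labx less.prems desc_refl[of x "lk q cls" P] by (cases "q x = 0") (auto simp: chosen_def)
  qed
qed

lemma chosen_range:
  assumes as: "assigned q a \<tau> cls" and v: "chosen q cls v"
  shows "first a (P v) < cls v" "cls v \<le> first a (Suc (P v))"
proof -
  have "v < n" "q v = 0" "cls v \<noteq> 0"
    using v by (auto simp: chosen_def)
  then show "first a (P v) < cls v" "cls v \<le> first a (Suc (P v))"
    using assignedD[OF as, of v] vertex_parent(1)[of v] by (auto simp: first_Suc split: if_splits)
qed

lemma interval_unique:
  assumes "first a c < j" "j \<le> first a (Suc c)" "first a d < j" "j \<le> first a (Suc d)"
  shows "c = d"
proof (rule ccontr)
  assume "c \<noteq> d"
  then have "Suc c \<le> d \<or> Suc d \<le> c"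
    by linarith
  then show False
    using first_mono[of "Suc c" d a] first_mono[of "Suc d" c a] assms by linarith
qed

text \<open>The intervals of class numbers separate different parents, and among siblings the count
  of earlier chosen ones grows strictly.\<close>

lemma chosen_inj:
  assumes as: "assigned q a \<tau> cls" and v: "chosen q cls v" and w: "chosen q cls w" and eq: "cls v = cls w"
  shows "v = w"
proof -
  have P: "P v = P w"
    using interval_unique chosen_range[OF as v] chosen_range[OF as w] eq by metis
  have False if v: "chosen q cls v" and w: "chosen q cls w" and eq: "cls v = cls w"
    and P: "P v = P w" and less: "v < w" for v w
  proof -
    let ?B = "before q (\<lambda>w. cls w \<noteq> 0)"
    have "v < n" "q v = 0" "cls v \<noteq> 0" "w < n" "q w = 0" "cls w \<noteq> 0"
      using v w by (auto simp: chosen_def)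
    then have "cls v = first a (P w) + ?B v + 1" "cls w = first a (P w) + ?B w + 1"
      using assignedD[OF as, of v] assignedD[OF as, of w] P by (auto split: if_splits)
    moreover have "?B v < ?B w"
      using before_less[of v w q "\<lambda>w. cls w \<noteq> 0"] less P \<open>v < n\<close> \<open>q v = 0\<close> \<open>cls v \<noteq> 0\<close> by simp
    ultimately show False
      using eq by simp
  qed
  then show ?thesis
    using v w eq P by (metis linorder_neqE_nat)
qed

lemma card_chosen_le:
  assumes as: "assigned q a \<tau> cls" and c: "n \<le> c"
  shows "card {v \<in> vc c. q v = 0 \<and> cls v \<noteq> 0} \<le> a c - M c"
proof -
  have "card {v \<in> vc c. q v = 0 \<and> cls v \<noteq> 0} \<le> card {first a c<..first a (Suc c)}"
  proof (rule card_inj_on_le)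
    show "inj_on cls {v \<in> vc c. q v = 0 \<and> cls v \<noteq> 0}"
      using chosen_inj[OF as] by (auto simp: inj_on_def chosen_def vc_def)
    show "cls ` {v \<in> vc c. q v = 0 \<and> cls v \<noteq> 0} \<subseteq> {first a c<..first a (Suc c)}"
      using chosen_range[OF as] by (auto simp: chosen_def vc_def)
  qed simp
  then show ?thesis
    using c by (simp add: first_Suc)
qed

lemma held_chosen:
  assumes "status q a" "n \<le> c" "c \<le> N"
  shows "a c = card {v \<in> vc c. q v = 0 \<and> cls v = 0} + card {v \<in> vc c. q v = 0 \<and> cls v \<noteq> 0}"
proof -
  have "{v \<in> vc c. q v = 0} = {v \<in> vc c. q v = 0 \<and> cls v = 0} \<union> {v \<in> vc c. q v = 0 \<and> cls v \<noteq> 0}"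
    by auto
  then show ?thesis
    unfolding status_a[OF assms] by (simp only:) (intro card_Un_disjoint; auto)
qed

lemma interval_exists:
  assumes "0 < j" "j \<le> first a (Suc N)"
  obtains c where "n \<le> c" "c \<le> N" "first a c < j" "j \<le> first a (Suc c)"
proof -
  define c where "c = (LEAST c. j \<le> first a (Suc c))"
  have c: "j \<le> first a (Suc c)" "c \<le> N"
    unfolding c_def using assms(2) by (auto intro: LeastI Least_le)
  have low: "first a c = 0" if "c \<le> n" for c
    using that by (simp add: first_def)
  have nc: "n \<le> c"
    using low[of "Suc c"] c(1) assms(1) by (cases "n \<le> c") auto
  have "first a c < j"
  proof (cases "c = n")
    case True
    then show ?thesis
      using low assms(1) by simp
  next
    case False
    then obtain d where d: "c = Suc d"
      using nc by (cases c) auto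
    then have "\<not> j \<le> first a (Suc d)"
      using not_less_Least[of d "\<lambda>c. j \<le> first a (Suc c)"] by (simp add: c_def)
    then show ?thesis
      using d by simp
  qed
  then show ?thesis
    using that nc c by blast
qed

subsection \<open>Soundness\<close>

text \<open>The labels force exactly one deletion into the region of every chosen vertex, at most
  one into any region, and none into a region of label 0. The flow can then be read off: a deletion
  in the region of a node flips the edge from that node to its parent.\<close>

lemma rainbow_imp_flow:
  assumes st: "status q a" and fe: "feasible q a" and as: "assigned q a \<tau> cls"
    and lab: "labelled q cls lab" and D: "D \<subseteq> {..<n}" and bij: "bij_betw lab D {1..first a (Suc N)}"
  shows "\<exists>u. flow D u"
proof -
  let ?e = "hits q cls D"
  have e1: "?e x \<le> 1" for x
  proof -
    have "w = w'" if "w \<in> D \<inter> region q cls x" "w' \<in> D \<inter> region q cls x" for w w'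
      using that lab_region[OF lab] bij by (metis IntE bij_betw_imp_inj_on inj_onD)
    then show ?thesis
      unfolding hits_def
      by (metis One_nat_def card_le_Suc0_iff_eq finite_Int finite_desc finite_lk)
  qed
  have e0: "?e x = 0" if "lab x = 0" for x
  proof -
    have "D \<inter> region q cls x = {}"
      using lab_region[OF lab, of _ x] that bij by (force simp: bij_betw_def)
    then show ?thesis
      by (simp add: hits_def)
  qed
  \<comment> \<open>A deleted vertex of positive label lies below a chosen vertex of that class.
    Thus a rainbow set certifies that the tape has opened all classes, and no other check of the
    tape is made.\<close>
  have ids: "\<exists>v w. chosen q cls v \<and> cls v = j \<and> w \<in> D \<and> w \<in> region q cls v"
    if j: "j \<in> {1..first a (Suc N)}" for j
  proof -
    have "j \<in> lab ` D"
      using bij j by (simp add: bij_betw_def)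
    then obtain w where "w \<in> D" "lab w = j"
      by blast
    then show ?thesis
      using region_cases[OF lab, of w] D nN j by fastforce
  qed
  have e_chosen: "?e v = 1" if v: "chosen q cls v" for v
  proof -
    have "P v \<le> N"
      using v vertex_parent(2) by (simp add: chosen_def)
    then have "cls v \<in> {1..first a (Suc N)}"
      using chosen_range[OF as v] first_mono[of "Suc (P v)" "Suc N" a] by simp
    then obtain v' w where "chosen q cls v'" "cls v' = cls v" "w \<in> D" "w \<in> region q cls v'"
      using ids by blast
    then have "w \<in> D" "w \<in> region q cls v"
      using chosen_inj[OF as _ v] by auto
    then show ?thesis
      using hits_pos[of w D q cls v] e1[of v] by simp
  qed
  have card_chosen: "card {v \<in> vc c. q v = 0 \<and> cls v \<noteq> 0} = a c - M c" if c: "n \<le> c" "c \<le> N" for c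
  proof (rule antisym)
    have "{first a c<..first a (Suc c)} \<subseteq> cls ` {v \<in> vc c. q v = 0 \<and> cls v \<noteq> 0}"
    proof
      fix j assume j: "j \<in> {first a c<..first a (Suc c)}"
      then have "j \<in> {1..first a (Suc N)}"
        using c first_mono[of "Suc c" "Suc N" a] by auto
      then obtain v where v: "chosen q cls v" "cls v = j"
        using ids by blast
      then have "P v = c"
        using interval_unique[of a "P v" j c] chosen_range[OF as v(1)] j by auto
      then show "j \<in> cls ` {v \<in> vc c. q v = 0 \<and> cls v \<noteq> 0}"
        using v by (auto simp: chosen_def vc_def)
    qed
    then have "card {first a c<..first a (Suc c)} \<le> card {v \<in> vc c. q v = 0 \<and> cls v \<noteq> 0}"
      by (rule surj_card_le[rotated]) simp
    then show "a c - M c \<le> card {v \<in> vc c. q v = 0 \<and> cls v \<noteq> 0}"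
      using c by (simp add: first_Suc)
  qed (rule card_chosen_le[OF as c(1)])
  \<comment> \<open>A held vertex uses its parent unless a deletion lies in its region. A color
    draws on its parent if it is short of children from the start, or if a deletion has taken one
    away.\<close>
  define u where "u x = (if x < n then (if q x = 0 \<and> cls x = 0 then 1 - ?e x else 0)
    else (if a x < M x then 1 else ?e x))" for x
  have lab0: "lab v = 0" if "v < n" "q v \<noteq> 0" for v
    using lab that nN by (simp add: labelled_def)
  have "flow D u"
    unfolding flow_def
  proof (intro conjI allI impI ballI)
    fix v assume v: "v < n"
    have uc: "u c = (if a c < M c then 1 else ?e c)" if "c \<in> cc v" for c
      using that by (simp add: u_def cc_def)
    show "u v + (\<Sum>c\<in>cc v. u c) = (if v \<in> D then 0 else 1)"
    proof (cases "q v = 0")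
      case True
      then have "card {c \<in> cc v. a c < M c} = 0"
        using status_q[OF st, of v] v by simp
      then have "\<not> a c < M c" if "c \<in> cc v" for c
        using that by auto
      then have "(\<Sum>c\<in>cc v. u c) = (\<Sum>c\<in>cc v. ?e c)"
        using uc by (intro sum.cong) auto
      then have e: "?e v = (if v \<in> D then 1 else 0) + (\<Sum>c\<in>cc v. u c)"
        using hits_vertex[OF v, of q cls D] by simp
      show ?thesis
      proof (cases "cls v = 0")
        case True
        then show ?thesis
          using e e1[of v] v \<open>q v = 0\<close> by (auto simp: u_def)
      next
        case False
        then have "?e v = 1"
          using e_chosen v \<open>q v = 0\<close> by (simp add: chosen_def)
        then show ?thesis
          using e False v by (auto simp: u_def split: if_splits)
      qed
    next
      case False
      moreover have "q v \<le> 1"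
        using fe v by (simp add: feasible_def)
      ultimately have q1: "q v = 1"
        by linarith
      have "?e v = 0"
        using e0 lab0 v False by simp
      then have e: "v \<notin> D" "(\<Sum>c\<in>cc v. ?e c) = 0"
        using hits_vertex[OF v, of q cls D] by (auto split: if_splits)
      have "(\<Sum>c\<in>cc v. u c) = (\<Sum>c\<in>cc v. if a c < M c then 1 else 0)"
        using uc e(2) by (intro sum.cong) (auto split: if_splits)
      also have "\<dots> = q v"
        using status_q[OF st, of v] v by (simp add: sum.If_cases Int_def)
      finally show ?thesis
        using q1 e(1) v by (simp add: u_def)
    qed
  next
    fix c assume "c \<in> {n..<N}"
    then have c: "n \<le> c" "c < N"
      by auto
    let ?H = "{v \<in> vc c. q v = 0 \<and> cls v = 0}"
    have "(\<Sum>v\<in>vc c. u v) = (\<Sum>v\<in>?H. 1 - ?e v)"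
      by (rule sum.mono_neutral_cong_right) (auto simp: vc_def u_def)
    moreover have "(\<Sum>v\<in>?H. 1 - ?e v) + (\<Sum>v\<in>?H. ?e v) = (\<Sum>v\<in>?H. 1)"
      unfolding sum.distrib[symmetric] using e1 by (intro sum.cong) (auto simp: le_Suc_eq)
    ultimately have sum: "(\<Sum>v\<in>vc c. u v) + ?e c = card ?H"
      using hits_color[OF c D, of q cls] by simp
    have card: "a c = card ?H + (a c - M c)"
      using held_chosen[OF st, of c cls] card_chosen[of c] c by simp
    show "u c + (\<Sum>v\<in>vc c. u v) = M c"
    proof (cases "a c < M c")
      case True
      have "M c = a c + 1"
        using fe c True by (simp add: feasible_def le_antisym Suc_leI)
      \<comment> \<open>A color in need makes its parent a forbidden vertex, and its region inherits
        the label 0.\<close>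
      moreover have "?e c = 0"
      proof -
        have cP: "c \<in> cc (P c)"
          using c by (simp add: cc_def)
        then have "q (P c) \<noteq> 0"
          using status_q[OF st, of "P c"] color_parent[OF c] True by (auto simp: card_eq_0_iff)
        then have "P c < n"
          using color_parent[OF c] fe by (auto simp: feasible_def)
        then have "lab (P c) = 0"
          using lab0 \<open>q (P c) \<noteq> 0\<close> by blast
        then show ?thesis
          using e0 lab c by (simp add: labelled_def)
      qed
      ultimately show ?thesis
        using sum card True c by (simp add: u_def)
    next
      case False
      then show ?thesis
        using sum card c by (simp add: u_def)
    qed
  next
    fix x assume x: "x < N" "P x = N"
    show "u x = 0"
    proof (cases "x < n")
      case True
      \<comment> \<open>The dummy has multiplicity 0, so all its vertex children with
        \<open>q v = 0\<close> are chosen and none is held.\<close>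
      have "{v \<in> vc N. q v = 0 \<and> cls v = 0} = {}"
        using held_chosen[OF st nN order.refl, of cls] card_chosen[OF nN order.refl] MN by (simp add: card_eq_0_iff)
      then show ?thesis
        using True x by (auto simp: u_def vc_def)
    next
      case False
      have xN: "x \<in> cc N"
        using x False by (simp add: cc_def)
      have "q N = 0"
        using fe by (simp add: feasible_def)
      then have "{c \<in> cc N. a c < M c} = {}"
        using status_q[OF st, of N] by (simp add: card_eq_0_iff)
      then have "\<not> a x < M x"
        using xN by blast
      moreover have "lab x = 0"
        using lab x False by (simp add: labelled_def)
      ultimately show ?thesis
        using False e0 by (simp add: u_def)
    qed
  qed
  then show ?thesis
    by blast
qed

end

context vcforest
begin

subsection \<open>Completeness\<close>

text \<open>Where there is a need, every flow is forced, by induction from below. At a vertex, each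
  needy child color claims its single unit, which leaves zero for all other edges. At a color,
  children with \<open>q v \<noteq> 0\<close> give nothing, so the others and the parent must all
  contribute.\<close>

lemma flow_status:
  assumes fl: "flow D u" and st: "status q a" and x: "x < N"
  shows "(x < n \<and> q x \<noteq> 0 \<longrightarrow> u x = 0 \<and> q x = 1 \<and> x \<notin> D \<and> (\<forall>c\<in>cc x. \<not> a c < M c \<longrightarrow> u c = 0)) \<and>
    (n \<le> x \<and> a x < M x \<longrightarrow> u x = 1 \<and> M x = a x + 1 \<and> (\<forall>v\<in>vc x. q v = 0 \<longrightarrow> u v = 1))"
  using x
proof (induction "rank N od x" arbitrary: x rule: less_induct)
  case less
  have IHc: "u c = 1" if "c \<in> cc x" "a c < M c" for c
    using less.hyps[of c] rank_parent[OF rt, of c] that by (auto simp: cc_def)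
  have IHv: "u v = 0" if "v \<in> vc x" "q v \<noteq> 0" for v
    using less.hyps[of v] rank_parent[OF rt, of v] that nN by (auto simp: vc_def)
  show ?case
  proof (intro conjI impI; (elim conjE)?)
    assume x: "x < n" "q x \<noteq> 0"
    let ?F = "{c \<in> cc x. a c < M c}" and ?G = "{c \<in> cc x. \<not> a c < M c}"
    have "(\<Sum>c\<in>cc x. u c) = (\<Sum>c\<in>?F \<union> ?G. u c)"
      by (rule sum.cong) auto
    also have "\<dots> = (\<Sum>c\<in>?F. u c) + (\<Sum>c\<in>?G. u c)"
      by (rule sum.union_disjoint) auto
    also have "(\<Sum>c\<in>?F. u c) = (\<Sum>c\<in>?F. 1)"
      using IHc by (intro sum.cong) auto
    also have "\<dots> = q x"
      using status_q[OF st, of x] x by simp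
    finally have "u x + (q x + (\<Sum>c\<in>?G. u c)) = (if x \<in> D then 0 else 1)"
      using flow_vertex[OF fl x(1)] by simp
    moreover obtain S where S: "S = (\<Sum>c\<in>?G. u c)"
      by blast
    ultimately have eq: "u x + (q x + S) = (if x \<in> D then 0 else 1)"
      by simp
    then show "x \<notin> D"
      using x(2) by auto
    then have "u x + (q x + S) = 1" "0 < q x"
      using eq x(2) by auto
    then have "u x = 0 \<and> q x = 1 \<and> S = 0"
      by linarith
    then show "u x = 0" "q x = 1" "\<forall>c\<in>cc x. \<not> a c < M c \<longrightarrow> u c = 0"
      using S by auto
  next
    assume x: "n \<le> x" "a x < M x"
    let ?Z = "{v \<in> vc x. q v = 0}"
    have u1: "u v \<le> 1" if "v \<in> ?Z" for v
      using flow_le_1[OF fl, of v] that nN by (simp add: vc_def)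
    have Z: "(\<Sum>v\<in>vc x. u v) = (\<Sum>v\<in>?Z. u v)"
      using IHv by (intro sum.mono_neutral_right) auto
    have "(\<Sum>v\<in>?Z. u v) + (\<Sum>v\<in>?Z. 1 - u v) = (\<Sum>v\<in>?Z. 1)"
      unfolding sum.distrib[symmetric] using u1 by (intro sum.cong) auto
    also have "\<dots> = a x"
      using status_a[OF st x(1)] less.prems by simp
    finally have "u x = 1" "M x = a x + 1" "(\<Sum>v\<in>?Z. 1 - u v) = 0"
      using flow_color[OF fl x(1) less.prems] flow_le_1[OF fl less.prems] x(2) Z by linarith+
    moreover from this(3) have "\<forall>v\<in>?Z. 1 - u v = 0"
      by (subst (asm) sum_eq_0_iff) auto
    ultimately show "u x = 1" "M x = a x + 1" "\<forall>v\<in>vc x. q v = 0 \<longrightarrow> u v = 1"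
      using u1 by (auto intro!: le_antisym)
  qed
qed

lemma flow_feasible:
  assumes fl: "flow D u" and st: "status q a"
  shows "feasible q a"
  unfolding feasible_def
proof (intro conjI allI impI)
  fix v assume "v < n"
  then show "q v \<le> 1"
    using flow_status[OF fl st, of v] nN by (cases "q v = 0") auto
next
  fix c assume "n \<le> c \<and> c < N"
  then show "M c \<le> a c + 1"
    using flow_status[OF fl st, of c] by (cases "a c < M c") auto
next
  have "{c \<in> cc N. a c < M c} = {}"
    using flow_status[OF fl st] flow_root[OF fl] by (fastforce simp: cc_def)
  then show "q N = 0"
    using status_q[OF st, of N] by simp
qed

text \<open>At most \<open>M c\<close> of the \<open>a c\<close> children can be matched to
  \<open>c\<close>. The remaining ones have \<open>u v = 0\<close> and are the candidates for being
  chosen.\<close>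

lemma unhit_children:
  assumes fl: "flow D u" and st: "status q a" and c: "n \<le> c" "c \<le> N"
  shows "a c - M c \<le> card {v \<in> vc c. q v = 0 \<and> u v = 0}"
proof -
  have "card {v \<in> vc c. q v = 0 \<and> u v \<noteq> 0} \<le> M c"
  proof (cases "c = N")
    case True
    then have "{v \<in> vc c. q v = 0 \<and> u v \<noteq> 0} = {}"
      using flow_root[OF fl] nN by (auto simp: vc_def)
    then show ?thesis
      by (simp only: card.empty le0)
  next
    case False
    have "card {v \<in> vc c. q v = 0 \<and> u v \<noteq> 0} = (\<Sum>v\<in>{v \<in> vc c. q v = 0 \<and> u v \<noteq> 0}. 1)"
      by simp
    also have "\<dots> \<le> (\<Sum>v\<in>{v \<in> vc c. q v = 0 \<and> u v \<noteq> 0}. u v)"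
      by (intro sum_mono) auto
    also have "\<dots> \<le> (\<Sum>v\<in>vc c. u v)"
      by (intro sum_mono2) auto
    also have "\<dots> \<le> M c"
      using flow_color[OF fl c(1)] False c(2) by simp
    finally show ?thesis .
  qed
  moreover have "a c = card ({v \<in> vc c. q v = 0 \<and> u v = 0} \<union> {v \<in> vc c. q v = 0 \<and> u v \<noteq> 0})"
    unfolding status_a[OF st c] by (rule arg_cong[where f = card]) auto
  moreover have "\<dots> \<le> card {v \<in> vc c. q v = 0 \<and> u v = 0} + card {v \<in> vc c. q v = 0 \<and> u v \<noteq> 0}"
    by (rule card_Un_le)
  ultimately show ?thesis
    by linarith
qed

text \<open>For each chosen child the tape stores how many earlier siblings are held.\<close>

lemma tape_exists:
  assumes st: "status q a"
    and B: "\<And>c. n \<le> c \<Longrightarrow> c \<le> N \<Longrightarrow> B c \<subseteq> {v \<in> vc c. q v = 0} \<and> card (B c) = a c - M c"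
    and mx: "\<And>c. n \<le> c \<Longrightarrow> c < N \<Longrightarrow> M c \<le> mx"
  shows "\<exists>\<tau>. (\<forall>j. \<tau> j \<le> mx) \<and>
    (\<forall>cls. assigned q a \<tau> cls \<longrightarrow> (\<forall>v<n. q v = 0 \<longrightarrow> (cls v \<noteq> 0 \<longleftrightarrow> v \<in> B (P v))))"
proof -
  define inB where "inB v \<longleftrightarrow> v \<in> B (P v)" for v
  let ?b = "before q inB" and ?h = "before q (\<lambda>v. \<not> inB v)"
  define good where "good v \<longleftrightarrow> v < n \<and> q v = 0 \<and> inB v" for v
  define tid where "tid v = first a (P v) + ?b v" for v
  have B': "B c = {v \<in> vc c. q v = 0 \<and> inB v}" if "n \<le> c" "c \<le> N" for c
    using B[OF that] by (auto simp: inB_def vc_def)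
  have finB: "finite (B c)" if "n \<le> c" "c \<le> N" for c
    using B'[OF that] by simp
  have bB: "?b v < card (B (P v))" if v: "good v" for v
  proof -
    have c: "n \<le> P v" "P v \<le> N"
      using v vertex_parent by (auto simp: good_def)
    have "v \<in> B (P v)"
      using v by (simp add: good_def inB_def)
    then have "{w \<in> vc (P v). w < v \<and> q w = 0 \<and> inB w} \<subset> B (P v)"
      unfolding B'[OF c] by blast
    then show ?thesis
      unfolding before_def using finB[OF c] by (intro psubset_card_mono)
  qed
  have same: "v = w" if "good v" "good w" "P v = P w" "?b v = ?b w" for v w
  proof (rule ccontr)
    assume "v \<noteq> w"
    then have "v < w \<or> w < v"
      by auto
    then show False
      using before_less[of v w q inB] before_less[of w v q inB] that by (auto simp: good_def)
  qed
  have inj: "v = w" if "good v" "good w" "tid v = tid w" for v w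
  proof -
    have "first a (P v) < tid v + 1 \<and> tid v + 1 \<le> first a (Suc (P v))" if "good v" for v
      using bB[OF that] B[of "P v"] vertex_parent[of v] that
      by (auto simp: tid_def first_Suc good_def)
    then have "P v = P w"
      using interval_unique that by metis
    then show ?thesis
      using same that by (simp add: tid_def)
  qed
  \<comment> \<open>An index that belongs to no chosen child gets the digit 0, to respect the bound
    \<open>mx\<close>.\<close>
  define \<tau> where "\<tau> j = (if \<exists>v. good v \<and> tid v = j then ?h (SOME v. good v \<and> tid v = j) else 0)" for j
  have tau: "\<tau> (tid v) = ?h v" if "good v" for v
  proof -
    have "good (SOME w. good w \<and> tid w = tid v) \<and> tid (SOME w. good w \<and> tid w = tid v) = tid v"
      by (rule someI[where P = "\<lambda>w. good w \<and> tid w = tid v" and x = v]) (simp add: that)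
    then have "(SOME w. good w \<and> tid w = tid v) = v"
      using inj that by blast
    then show ?thesis
      using that by (auto simp: \<tau>_def)
  qed
  \<comment> \<open>The origin of the base \<open>mx + 1\<close>: after removal of the
    \<open>a c - M c\<close> chosen children at most \<open>M c\<close> held ones remain.\<close>
  have h_le: "?h v \<le> mx" if v: "good v" for v
  proof -
    have c: "n \<le> P v" "P v \<le> N"
      using v vertex_parent by (auto simp: good_def)
    have "?h v \<le> card ({w \<in> vc (P v). q w = 0} - B (P v))"
      unfolding before_def B'[OF c] by (intro card_mono) auto
    also have "\<dots> = a (P v) - (a (P v) - M (P v))"
      using B[OF c] finB[OF c] status_a[OF st c] by (simp add: card_Diff_subset)
    also have "\<dots> \<le> M (P v)"
      by simp
    also have "\<dots> \<le> mx"
      using mx[of "P v"] c MN by (cases "P v = N") auto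
    finally show ?thesis .
  qed
  have tau_le: "\<tau> j \<le> mx" for j
  proof (cases "\<exists>v. good v \<and> tid v = j")
    case True
    then obtain v where v: "good v" "tid v = j"
      by blast
    then show ?thesis
      using tau[OF v(1)] h_le[OF v(1)] by simp
  next
    case False
    then have "\<tau> j = 0"
      unfolding \<tau>_def by (rule if_not_P)
    then show ?thesis
      by simp
  qed
  \<comment> \<open>Induction on the number of the vertex: as long as decoding has reproduced
    \<open>B\<close> on the smaller siblings, its counters are those of \<open>B\<close>.\<close>
  have "cls v \<noteq> 0 \<longleftrightarrow> inB v" if as: "assigned q a \<tau> cls" and v: "v < n" "q v = 0" for cls v
    using v
  proof (induction v rule: less_induct)
    case (less v)
    have c: "n \<le> P v" "P v \<le> N"
      using vertex_parent less.prems by auto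
    have b: "before q (\<lambda>w. cls w \<noteq> 0) v = ?b v" "before q (\<lambda>w. cls w = 0) v = ?h v"
    proof -
      have iff: "cls w \<noteq> 0 \<longleftrightarrow> inB w" if "w \<in> vc (P v)" "w < v" "q w = 0" for w
        using less.IH that by (simp add: vc_def)
      then have "{w \<in> vc (P v). w < v \<and> q w = 0 \<and> cls w \<noteq> 0} = {w \<in> vc (P v). w < v \<and> q w = 0 \<and> inB w}"
        "{w \<in> vc (P v). w < v \<and> q w = 0 \<and> cls w = 0} = {w \<in> vc (P v). w < v \<and> q w = 0 \<and> \<not> inB w}"
        by blast+
      then show "before q (\<lambda>w. cls w \<noteq> 0) v = ?b v" "before q (\<lambda>w. cls w = 0) v = ?h v"
        by (simp_all only: before_def)
    qed
    have cls: "cls v = (if ?b v < card (B (P v)) \<and> \<tau> (tid v) = ?h v then tid v + 1 else 0)"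
      using assignedD[OF as less.prems] B[OF c] unfolding b by (simp add: tid_def)
    show ?case
    proof (cases "inB v")
      case True
      then have "good v"
        using less.prems by (simp add: good_def)
      then show ?thesis
        using cls bB tau True by simp
    next
      case False
      \<comment> \<open>The counts \<open>?b\<close> enumerate the chosen siblings without gaps, so
        a false match of \<open>v\<close> concerns the digit of some chosen \<open>w\<close>. If
        \<open>w\<close> came before \<open>v\<close>, it would already be counted in
        \<open>?b v\<close>; if after, \<open>v\<close> would be counted as held before
        \<open>w\<close>.\<close>
      have "\<not> (?b v < card (B (P v)) \<and> \<tau> (tid v) = ?h v)"
      proof
        assume asm: "?b v < card (B (P v)) \<and> \<tau> (tid v) = ?h v"
        have good: "good w \<and> P w = P v" if "w \<in> B (P v)" for w
          using that unfolding B'[OF c] by (auto simp: good_def vc_def)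
        have "?b ` B (P v) = {..<card (B (P v))}"
        proof (rule card_subset_eq)
          show "?b ` B (P v) \<subseteq> {..<card (B (P v))}"
            using bB good by fastforce
          have "inj_on ?b (B (P v))"
            using same good by (intro inj_onI) simp
          then show "card (?b ` B (P v)) = card {..<card (B (P v))}"
            by (simp add: card_image)
        qed simp
        then obtain w where w: "w \<in> B (P v)" "?b w = ?b v"
          using asm by (metis imageE lessThan_iff)
        have Pw: "good w" "P w = P v"
          using good[OF w(1)] by blast+
        then have "tid w = tid v"
          using w by (simp add: tid_def)
        then have h: "?h w = ?h v"
          using asm tau[OF Pw(1)] by simp
        have "w \<noteq> v"
          using False Pw(1) by (auto simp: good_def)
        then consider "w < v" | "v < w"
          by linarith
        then show False
        proof cases
          case 1
          then show ?thesis
            using before_less[of w v q inB] Pw w(2) by (simp add: good_def)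
        next
          case 2
          then show ?thesis
            using before_less[of v w q "\<lambda>v. \<not> inB v"] Pw less.prems False h by simp
        qed
      qed
      then show ?thesis
        using cls False by auto
    qed
  qed
  then show ?thesis
    using tau_le unfolding inB_def by blast
qed

text \<open>The deletions in a region are counted by the flow: both sides satisfy the same recursion
  from the leaves. The hypotheses on chosen children ensure that exactly \<open>M c\<close> children
  of an unneedy color are held, so that every held child lost is replaced by one unit from the
  parent.\<close>

lemma hits_flow:
  assumes fl: "flow D u" and st: "status q a" and D: "D \<subseteq> {..<n}"
    and B: "\<And>c. n \<le> c \<Longrightarrow> c < N \<Longrightarrow> card {v \<in> vc c. q v = 0 \<and> cls v \<noteq> 0} = a c - M c"
    and u0: "\<And>v. chosen q cls v \<Longrightarrow> u v = 0" and x: "x < N"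
  shows "hits q cls D x = (if x < n then if q x = 0 then 1 - u x else 0 else if a x < M x then 0 else u x)"
  using x
proof (induction "rank N od x" arbitrary: x rule: less_induct)
  case less
  have IHc: "hits q cls D c = (if a c < M c then 0 else u c)" if "c \<in> cc x" for c
    using less.hyps[of c] rank_parent[OF rt, of c] that by (auto simp: cc_def)
  have IHv: "hits q cls D v = 1 - u v" if "v \<in> vc x" "q v = 0" for v
    using less.hyps[of v] rank_parent[OF rt, of v] that nN by (auto simp: vc_def)
  show ?case
  proof (cases "x < n")
    case True
    note e = hits_vertex[OF True, of q cls D]
    show ?thesis
    proof (cases "q x = 0")
      case q0: True
      then have "{c \<in> cc x. a c < M c} = {}"
        using status_q[OF st, of x] True by (simp add: card_eq_0_iff)
      then have "(\<Sum>c\<in>cc x. hits q cls D c) = (\<Sum>c\<in>cc x. u c)"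
        using IHc by (intro sum.cong) auto
      then show ?thesis
        using e flow_vertex[OF fl True] True q0 by (auto split: if_splits)
    next
      case False
      then have "x \<notin> D" "\<And>c. c \<in> cc x \<Longrightarrow> \<not> a c < M c \<Longrightarrow> u c = 0"
        using flow_status[OF fl st less.prems] True by blast+
      then show ?thesis
        using e IHc True False by simp
    qed
  next
    case False
    then have x: "n \<le> x"
      by simp
    let ?H = "{v \<in> vc x. q v = 0 \<and> cls v = 0}" and ?C = "{v \<in> vc x. q v = 0 \<and> cls v \<noteq> 0}"
    have e: "hits q cls D x = (\<Sum>v\<in>?H. 1 - u v)"
      using hits_color[OF x less.prems D, of q cls] IHv by simp
    show ?thesis
    proof (cases "a x < M x")
      case True
      then have "\<forall>v\<in>vc x. q v = 0 \<longrightarrow> u v = 1"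
        using flow_status[OF fl st less.prems] x by blast
      then show ?thesis
        using e True False by simp
    next
      case aM: False
      have "u v = 0" if "v \<in> vc x" "v \<notin> ?H" for v
      proof (cases "q v = 0")
        case True
        then show ?thesis
          using u0[of v] that by (simp add: chosen_def vc_def)
      next
        case False
        have "v < n"
          using that by (simp add: vc_def)
        then show ?thesis
          using flow_status[OF fl st, of v] False nN by simp
      qed
      then have s: "(\<Sum>v\<in>vc x. u v) = (\<Sum>v\<in>?H. u v)"
        by (intro sum.mono_neutral_right) auto
      have u1: "u v \<le> 1" if "v \<in> ?H" for v
        using flow_le_1[OF fl, of v] that nN by (simp add: vc_def)
      have "(\<Sum>v\<in>?H. 1 - u v) + (\<Sum>v\<in>?H. u v) = (\<Sum>v\<in>?H. 1)"
        unfolding sum.distrib[symmetric] using u1 by (intro sum.cong) auto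
      \<comment> \<open>With exactly \<open>M x\<close> held children, the number of those with
        \<open>u v = 0\<close> equals the unit drawn from the parent.\<close>
      moreover have "card ?H = M x"
        using held_chosen[OF st x, of cls] B[OF x less.prems] less.prems aM by simp
      ultimately show ?thesis
        using e s flow_color[OF fl x less.prems] aM False by simp
    qed
  qed
qed

text \<open>The tape comes from the flow of \<open>D\<close>; classes and labels are quantified
  after it, because they are recomputed from the tape and \<open>cls\<close> is unspecified where
  \<open>q v \<noteq> 0\<close>.\<close>

lemma flow_imp_rainbow:
  assumes fl: "flow D u" and st: "status q a" and D: "D \<subseteq> {..<n}"
    and mx: "\<And>c. n \<le> c \<Longrightarrow> c < N \<Longrightarrow> M c \<le> mx"
  shows "\<exists>\<tau>. (\<forall>j. \<tau> j \<le> mx) \<and> (\<forall>cls lab. assigned q a \<tau> cls \<longrightarrow> labelled q cls lab \<longrightarrow>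
    bij_betw lab D {1..first a (Suc N)})"
proof -
  have fe: "feasible q a"
    using fl st by (rule flow_feasible)
  \<comment> \<open>The chosen children are taken among those with \<open>u v = 0\<close>, so that
    each has a deletion in its region.\<close>
  have "\<exists>B \<subseteq> {v \<in> vc c. q v = 0 \<and> u v = 0}. card B = a c - M c" if "n \<le> c" "c \<le> N" for c
    using obtain_subset_with_card_n[OF unhit_children[OF fl st that]] by blast
  then have "\<forall>c. \<exists>B. n \<le> c \<longrightarrow> c \<le> N \<longrightarrow> B \<subseteq> {v \<in> vc c. q v = 0 \<and> u v = 0} \<and> card B = a c - M c"
    by blast
  from choice[OF this] obtain B where B: "\<And>c. n \<le> c \<Longrightarrow> c \<le> N \<Longrightarrow>
      B c \<subseteq> {v \<in> vc c. q v = 0 \<and> u v = 0} \<and> card (B c) = a c - M c"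
    by blast
  have B0: "B c \<subseteq> {v \<in> vc c. q v = 0} \<and> card (B c) = a c - M c" if "n \<le> c" "c \<le> N" for c
    using B[OF that] by auto
  have "\<exists>\<tau>. (\<forall>j. \<tau> j \<le> mx) \<and>
    (\<forall>cls. assigned q a \<tau> cls \<longrightarrow> (\<forall>v<n. q v = 0 \<longrightarrow> (cls v \<noteq> 0 \<longleftrightarrow> v \<in> B (P v))))"
    by (rule tape_exists[OF st]) (rule B0 mx; assumption)+
  then obtain \<tau> where \<tau>: "(\<forall>j. \<tau> j \<le> mx) \<and>
    (\<forall>cls. assigned q a \<tau> cls \<longrightarrow> (\<forall>v<n. q v = 0 \<longrightarrow> (cls v \<noteq> 0 \<longleftrightarrow> v \<in> B (P v))))"
    by (elim exE)
  note tau = \<tau>[THEN conjunct1]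
  have clsB: "(cls v \<noteq> 0) = (v \<in> B (P v))" if "assigned q a \<tau> cls" "v < n" "q v = 0" for cls v
    using \<tau>[THEN conjunct2] that by simp
  have "bij_betw lab D {1..first a (Suc N)}" if as: "assigned q a \<tau> cls" and lab: "labelled q cls lab" for cls lab
  proof -
    let ?e = "hits q cls D"
    have Bc: "{v \<in> vc c. q v = 0 \<and> cls v \<noteq> 0} = B c" if c: "n \<le> c" "c \<le> N" for c
      using clsB[OF as] B[OF c] by (auto simp: vc_def)
    have u0: "u v = 0" if "chosen q cls v" for v
      using clsB[OF as, of v] that B[of "P v"] vertex_parent[of v] by (auto simp: chosen_def)
    have e: "?e x = (if x < n then if q x = 0 then 1 - u x else 0 else if a x < M x then 0 else u x)"
      if "x < N" for x
      using Bc B by (intro hits_flow[OF fl st D _ u0 that]) auto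
    have e1: "?e v = 1" if v: "chosen q cls v" for v
      using e[of v] u0[OF v] v nN by (simp add: chosen_def)
    \<comment> \<open>All other tops of regions contain no deletion, by \<open>hits_flow\<close> and
      the vanishing of the flow at the roots.\<close>
    have terminal: "\<exists>v. chosen q cls v \<and> w \<in> region q cls v \<and> lab w = cls v" if w: "w \<in> D" for w
    proof (rule ccontr)
      assume "\<not> ?thesis"
      moreover have "w < N"
        using w D nN by auto
      ultimately obtain t where t: "t < N" "w \<in> region q cls t" "t < n \<and> q t \<noteq> 0 \<or> lk q cls t \<and> P t = N"
        using region_cases[OF lab] by blast
      have pos: "0 < ?e t"
        using hits_pos[OF w t(2)] .
      from t(3) show False
      proof
        assume "t < n \<and> q t \<noteq> 0"
        then show ?thesis
          using e[OF t(1)] pos by simp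
      next
        assume lt: "lk q cls t \<and> P t = N"
        show ?thesis
        proof (cases "t < n")
          case True
          have "card {v \<in> vc N. q v = 0 \<and> cls v = 0} = 0"
            using held_chosen[OF st nN order.refl, of cls] Bc[OF nN order.refl] B[OF nN order.refl] MN by simp
          then show ?thesis
            using lt True by (auto simp: lk_def vc_def)
        next
          case False
          then show ?thesis
            using e[OF t(1)] pos flow_root[OF fl t(1)] lt by (simp split: if_splits)
        qed
      qed
    qed
    show ?thesis
    proof (rule bij_betw_imageI)
      show "inj_on lab D"
      proof (rule inj_onI)
        fix w w' assume w: "w \<in> D" "w' \<in> D" "lab w = lab w'"
        obtain v v' where v: "chosen q cls v" "w \<in> region q cls v" "lab w = cls v"
          and v': "chosen q cls v'" "w' \<in> region q cls v'" "lab w' = cls v'"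
          using terminal[OF w(1)] terminal[OF w(2)] by blast
        have "cls v = cls v'"
          using v(3) v'(3) w(3) by simp
        then have "v = v'"
          by (rule chosen_inj[OF as v(1) v'(1)])
        then have "w \<in> D \<inter> region q cls v" "w' \<in> D \<inter> region q cls v"
          using w v v' by auto
        then show "w = w'"
          using e1[OF v(1)] unfolding hits_def by (metis card_1_singletonE singletonD)
      qed
      show "lab ` D = {1..first a (Suc N)}"
      proof (intro equalityI subsetI)
        fix j assume "j \<in> lab ` D"
        then obtain v where v: "chosen q cls v" "j = cls v"
          using terminal by blast
        then show "j \<in> {1..first a (Suc N)}"
          using chosen_range[OF as v(1)] first_mono[of "Suc (P v)" "Suc N" a] vertex_parent[of v]
          by (auto simp: chosen_def)
      next
        fix j assume "j \<in> {1..first a (Suc N)}"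
        then obtain c where c: "n \<le> c" "c \<le> N" "first a c < j" "j \<le> first a (Suc c)"
          using interval_exists[of j a] by auto
        let ?C = "{v \<in> vc c. q v = 0 \<and> cls v \<noteq> 0}"
        have "cls ` ?C = {first a c<..first a (Suc c)}"
        proof (rule card_subset_eq)
          show "cls ` ?C \<subseteq> {first a c<..first a (Suc c)}"
            using chosen_range[OF as] by (auto simp: chosen_def vc_def)
          have "inj_on cls ?C"
            using chosen_inj[OF as] by (auto simp: inj_on_def chosen_def vc_def)
          then show "card (cls ` ?C) = card {first a c<..first a (Suc c)}"
            using Bc[OF c(1,2)] B[OF c(1,2)] c(1) by (simp add: card_image first_Suc)
        qed simp
        then have "j \<in> cls ` ?C"
          using c(3,4) by simp
        then obtain v where "v \<in> ?C" "cls v = j"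
          by blast
        then have v: "chosen q cls v" "cls v = j"
          by (simp_all add: chosen_def vc_def)
        have "D \<inter> region q cls v \<noteq> {}"
          using e1[OF v(1)] hits_0[of q cls D v] by simp
        then obtain w where w: "w \<in> D" "w \<in> region q cls v"
          by blast
        have "lab w = lab v"
          using lab_region[OF lab w(2)] .
        also have "\<dots> = j"
          using lab v nN by (simp add: labelled_def chosen_def)
        finally show "j \<in> lab ` D"
          using w(1) by blast
      qed
    qed
  qed
  then show ?thesis
    using tau by blast
qed

end

section \<open>Characterization of yes-instances\<close>

lemma sum_list_branches:
  fixes g :: "nat \<Rightarrow> nat"
  assumes "\<And>A. A \<in> set As \<Longrightarrow> A \<subseteq> {..<n}"
  shows "(\<Sum>A\<leftarrow>As. sum g A) = (\<Sum>v<n. length (filter (\<lambda>A. v \<in> A) As) * g v)"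
  using assms
proof (induction As)
  case (Cons A As)
  then have A: "A \<subseteq> {..<n}"
    by simp
  have "sum g A = (\<Sum>v\<in>{..<n}. if v \<in> A then g v else 0)"
    using A by (simp add: sum.inter_restrict[symmetric] Int_absorb1)
  moreover have "(\<Sum>A\<leftarrow>As. sum g A) = (\<Sum>v<n. length (filter (\<lambda>A. v \<in> A) As) * g v)"
    using Cons by simp
  ultimately show ?case
    by (simp add: sum.distrib[symmetric]) (intro sum.cong; simp)
qed simp

lemma (in vcforest) lab_le:
  assumes as: "assigned q a \<tau> cls" and lab: "labelled q cls lab" and x: "x < N"
  shows "lab x \<le> first a (Suc N)"
proof (cases "lab x = 0")
  case False
  then have "\<exists>v. chosen q cls v \<and> lab x = cls v"
    using region_cases[OF lab x] by auto
  then obtain v where v: "chosen q cls v" "lab x = cls v"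
    by (elim exE conjE)
  then have "P v \<le> N"
    using vertex_parent(2) by (simp add: chosen_def)
  then show ?thesis
    using chosen_range(2)[OF as v(1)] first_mono[of "Suc (P v)" "Suc N" a] v(2) by simp
qed simp

text \<open>Given \<open>size\<close>, the inequality \<open>l < n\<close> says that the motif is
  not empty. It keeps the complement of a set of \<open>l\<close> vertices nonempty, as
  \<open>conn\<close> demands.\<close>

locale motif_problem = vcforest +
  fixes EG :: "nat set set" and GP Go :: "nat \<Rightarrow> nat" and l :: nat
  assumes Grt: "rooted n EG GP Go" and Gtree: "conn EG {..<n}"
    and size: "(\<Sum>c\<in>{n..<N}. M c) + l = n" and l_less: "l < n"
begin

definition solution :: bool where
  "solution \<longleftrightarrow> (\<exists>D \<subseteq> {..<n}. conn EG ({..<n} - D) \<and> valid D)"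

definition hit :: "(nat \<Rightarrow> nat) \<Rightarrow> bool" where
  "hit lab \<longleftrightarrow> (\<exists>z \<in> sums (sum (\<lambda>v. weight l (lab v)) ` branches n GP). z + 1 = (l + 1) * 2 ^ l)"

text \<open>The weights turn any list of branches that meets the target into a rainbow union of
  disjoint branches. One half of the problem is then settled by
  \<open>conn_complement_branches\<close>, the other by \<open>rainbow_imp_flow\<close>.\<close>

lemma hit_imp_solution:
  assumes st: "status q a" and fe: "feasible q a" and as: "assigned q a \<tau> cls"
    and lab: "labelled q cls lab" and hit: "hit lab"
  shows solution
proof -
  let ?W = "\<lambda>v. weight l (lab v)"
  have tot: "first a (Suc N) = l"
    using first_total[OF st fe size] .
  obtain z where z: "z \<in> sums (sum ?W ` branches n GP)" "z + 1 = (l + 1) * 2 ^ l"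
    using hit by (auto simp: hit_def)
  obtain As where As: "set As \<subseteq> branches n GP" "(\<Sum>A\<leftarrow>As. sum ?W A) = z"
    using sums_list[OF z(1)] by blast
  have AV: "A \<subseteq> {..<n}" if "A \<in> set As" for A
    using that As(1) sub_less[OF Grt] by (auto simp: branches_def)
  \<comment> \<open>Multiplicity of cover by list entries. A bound of 1 makes distinct entries
    disjoint; repeated empty branches disappear in \<open>set As\<close>.\<close>
  define m where "m v = length (filter (\<lambda>A. v \<in> A) As)" for v
  have "(\<Sum>v<n. m v * ?W v) + 1 = (l + 1) * 2 ^ l"
    using sum_list_branches[OF AV, of As ?W] As(2) z(2) by (simp add: m_def)
  moreover have "lab v \<le> l" if "v \<in> {..<n}" for v
    using lab_le[OF as lab, of v] that nN tot by simp
  ultimately have m1: "\<And>v. v \<in> {..<n} \<Longrightarrow> m v \<le> 1" and bij: "bij_betw lab {v \<in> {..<n}. m v > 0} {1..l}"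
    using rainbow_of_sum_weight[of "{..<n}" lab l m] by blast+
  define D where "D = {v \<in> {..<n}. m v > 0}"
  have mpos: "m v > 0 \<longleftrightarrow> v \<in> \<Union>(set As)" for v
    by (auto simp: m_def filter_empty_conv)
  have D: "D = \<Union>(set As)"
    using AV by (auto simp: D_def mpos)
  have "card D = l"
    using bij_betw_same_card[OF bij] by (simp add: D_def)
  have DV: "D \<subseteq> {..<n}"
    by (auto simp: D_def)
  have "conn EG ({..<n} - \<Union>(set As))"
  proof (rule conn_complement_branches[OF Grt Gtree As(1)])
    have "D \<noteq> {..<n}"
      using \<open>card D = l\<close> l_less by auto
    then show "{..<n} - \<Union>(set As) \<noteq> {}"
      using DV D by blast
    fix A B assume AB: "A \<in> set As" "B \<in> set As" "A \<noteq> B"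
    show "A \<inter> B = {}"
    proof (rule ccontr)
      assume "A \<inter> B \<noteq> {}"
      then obtain v where v: "v \<in> A" "v \<in> B"
        by blast
      have "{A, B} \<subseteq> set (filter (\<lambda>A. v \<in> A) As)"
        using AB v by auto
      then have "card {A, B} \<le> card (set (filter (\<lambda>A. v \<in> A) As))"
        by (intro card_mono) auto
      also have "\<dots> \<le> m v"
        unfolding m_def by (rule card_length)
      also have "\<dots> \<le> 1"
        using m1 AV[OF AB(1)] v by blast
      finally show False
        using AB(3) by simp
    qed
  qed
  moreover have "bij_betw lab D {1..first a (Suc N)}"
    using bij by (simp add: D_def tot)
  then have "valid D"
    using rainbow_imp_flow[OF st fe as lab DV] flow_imp_valid by blast
  ultimately show ?thesis
    using DV unfolding solution_def D by blast
qed

lemma solution_imp_feasible: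
  assumes "solution" "status q a" shows "feasible q a"
  using assms valid_imp_flow flow_feasible unfolding solution_def by blast

text \<open>A solution yields a tape under which it is rainbow, so its weight is the target, and its
  decomposition into branches shows that the target is a sum of items.\<close>

lemma solution_imp_hit:
  assumes sol: "solution" and st: "status q a" and mx: "\<And>c. n \<le> c \<Longrightarrow> c < N \<Longrightarrow> M c \<le> mx"
  shows "\<exists>\<tau>. (\<forall>j. \<tau> j \<le> mx) \<and> (\<forall>cls lab. assigned q a \<tau> cls \<longrightarrow> labelled q cls lab \<longrightarrow> hit lab)"
proof -
  obtain D u where D: "D \<subseteq> {..<n}" "conn EG ({..<n} - D)" and fl: "flow D u"
    using sol valid_imp_flow unfolding solution_def by blast
  have tot: "first a (Suc N) = l"
    using first_total[OF st flow_feasible[OF fl st] size] .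
  have "\<exists>\<tau>. (\<forall>j. \<tau> j \<le> mx) \<and> (\<forall>cls lab. assigned q a \<tau> cls \<longrightarrow> labelled q cls lab \<longrightarrow>
    bij_betw lab D {1..first a (Suc N)})"
    by (rule flow_imp_rainbow[OF fl st D(1)]) (rule mx)
  then obtain \<tau> where tau: "\<forall>j. \<tau> j \<le> mx"
    and bij: "\<And>cls lab. assigned q a \<tau> cls \<Longrightarrow> labelled q cls lab \<Longrightarrow> bij_betw lab D {1..l}"
    unfolding tot by (elim exE conjE) blast
  have "hit lab" if "assigned q a \<tau> cls" "labelled q cls lab" for cls lab
    unfolding hit_def using conn_complement_sum[OF Grt D] sum_weight_rainbow[OF bij[OF that]] by blast
  then show ?thesis
    using tau by blast
qed

end

section \<open>Numbered instances\<close>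

text \<open>Walks are mapped forward edge by edge and lifted back through the unique preimages of
  their vertices.\<close>

lemma conn_image:
  assumes inj: "inj_on h (verts G)" and S: "S \<subseteq> verts G" and E: "\<And>e. e \<in> edges G \<Longrightarrow> e \<subseteq> verts G"
  shows "conn ((`) h ` edges G) (h ` S) \<longleftrightarrow> connected (induced G S)"
proof -
  let ?A = "adj (induced G S)"
  let ?B = "{(u, v). {u, v} \<in> (`) h ` edges G \<and> u \<in> h ` S \<and> v \<in> h ` S}"
  have A: "?A = {(u, v). {u, v} \<in> edges G \<and> u \<in> S \<and> v \<in> S}"
    by (auto simp: adj_def induced_def)
  have edge: "{h u, h v} \<in> (`) h ` edges G \<longleftrightarrow> {u, v} \<in> edges G" if "u \<in> S" "v \<in> S" for u v
  proof
    assume "{h u, h v} \<in> (`) h ` edges G"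
    then obtain e where e: "e \<in> edges G" "h ` e = h ` {u, v}"
      by auto
    have "e = {u, v}"
      using inj_on_image_eq_iff[OF inj E[OF e(1)], of "{u, v}"] e(2) that S by auto
    then show "{u, v} \<in> edges G"
      using e(1) by simp
  next
    assume "{u, v} \<in> edges G"
    then show "{h u, h v} \<in> (`) h ` edges G"
      by (metis image_empty image_eqI image_insert)
  qed
  have B: "(h u, h v) \<in> ?B \<longleftrightarrow> (u, v) \<in> ?A" if "u \<in> S" "v \<in> S" for u v
    using edge[OF that] that by (simp add: A)
  have fwd: "(h u, h v) \<in> ?B\<^sup>*" if "(u, v) \<in> ?A\<^sup>*" for u v
    using that
  proof (induction rule: rtrancl_induct)
    case (step v w)
    then have "(h v, h w) \<in> ?B"
      using B[of v w] by (simp add: A)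
    then show ?case
      using step.IH by (rule rtrancl_into_rtrancl[rotated])
  qed simp
  have bwd: "\<exists>v\<in>S. y = h v \<and> (u, v) \<in> ?A\<^sup>*" if "(h u, y) \<in> ?B\<^sup>*" "u \<in> S" for u y
    using that(1)
  proof (induction rule: rtrancl_induct)
    case base
    then show ?case
      using that(2) by blast
  next
    case (step y z)
    then obtain v w where vw: "v \<in> S" "y = h v" "(u, v) \<in> ?A\<^sup>*" "w \<in> S" "z = h w"
      by blast
    then have "(v, w) \<in> ?A"
      using step.hyps(2) B[of v w] by simp
    with vw(3) have "(u, w) \<in> ?A\<^sup>*"
      by (rule rtrancl_into_rtrancl)
    then show ?case
      using vw(4,5) by blast
  qed
  show ?thesis
  proof
    assume c: "conn ((`) h ` edges G) (h ` S)"
    show "connected (induced G S)"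
      unfolding connected_def
    proof (intro conjI ballI)
      show "verts (induced G S) \<noteq> {}"
        using c by (auto simp: conn_def induced_def)
      fix u v assume "u \<in> verts (induced G S)" "v \<in> verts (induced G S)"
      then have uv: "u \<in> S" "v \<in> S"
        by (auto simp: induced_def)
      then have "(h u, h v) \<in> ?B\<^sup>*"
        using c by (simp add: conn_def)
      then obtain w where w: "w \<in> S" "h v = h w" "(u, w) \<in> ?A\<^sup>*"
        using bwd uv(1) by blast
      have "v = w"
        by (rule inj_onD[OF inj w(2)]) (use uv S w in blast)+
      then show "(u, v) \<in> ?A\<^sup>*"
        using w(3) by simp
    qed
  next
    assume c: "connected (induced G S)"
    have ne: "S \<noteq> {}" and A': "\<And>u v. u \<in> S \<Longrightarrow> v \<in> S \<Longrightarrow> (u, v) \<in> ?A\<^sup>*"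
      using c by (simp_all add: connected_def induced_def)
    show "conn ((`) h ` edges G) (h ` S)"
      unfolding conn_def
    proof (intro conjI ballI)
      fix x y assume "x \<in> h ` S" "y \<in> h ` S"
      then obtain u v where "u \<in> S" "v \<in> S" "x = h u" "y = h v"
        by blast
      then show "(x, y) \<in> ?B\<^sup>*"
        using fwd[OF A'] by simp
    qed (use ne in simp)
  qed
qed

lemma count_image_mset_set:
  "finite S \<Longrightarrow> count (image_mset f (mset_set S)) c = card {v \<in> S. f v = c}"
proof (induction S rule: finite_induct)
  case (insert x S)
  have "{v \<in> insert x S. f v = c} = (if f x = c then insert x {v \<in> S. f v = c} else {v \<in> S. f v = c})"
    by auto
  then show ?case
    using insert by simp
qed simp

text \<open>The value 0 outside the range of colors covers the dummy node \<open>n + k\<close> as a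
  color without copies.\<close>

definition mult_of :: "nat \<Rightarrow> nat \<Rightarrow> nat list \<Rightarrow> nat \<Rightarrow> nat" where
  "mult_of n k ms c = (if n \<le> c \<and> c < n + k then ms ! (c - n) else 0)"

text \<open>Shifting colors by \<open>n\<close> makes vertices and colors disjoint ranges of nodes.
  The equation of multisets becomes one count per color; other colors cannot occur, as lists contain
  only colors of the motif.\<close>

lemma has_motif_numbered:
  fixes I :: "('v, 'c) lcgm"
  assumes I: "lcgm_instance I"
    and \<nu>: "bij_betw \<nu> (verts (graph I)) {..<n}" and \<kappa>: "bij_betw \<kappa> (colors I) {..<k}"
    and ms: "\<forall>c\<in>colors I. ms ! \<kappa> c = count (motif I) c"
    and EG: "EG = (\<lambda>e. \<nu> ` e) ` edges (graph I)"
    and EH: "EH = {{\<nu> v, n + \<kappa> c} | v c. v \<in> verts (graph I) \<and> c \<in> clist I v}"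
  shows "has_motif I \<longleftrightarrow> (\<exists>S \<subseteq> {..<n}. conn EG S \<and> (\<exists>f. (\<forall>v\<in>S. {v, f v} \<in> EH) \<and>
    (\<forall>c\<in>{n..<n + k}. card {v \<in> S. f v = c} = mult_of n k ms c)))"
proof -
  let ?V = "verts (graph I)" and ?C = "colors I"
  have finV: "finite ?V" and E: "\<And>e. e \<in> edges (graph I) \<Longrightarrow> e \<subseteq> ?V"
    and cl: "\<And>v. v \<in> ?V \<Longrightarrow> clist I v \<subseteq> ?C"
    using I by (auto simp: lcgm_instance_def ugraph_def)
  have inj\<nu>: "inj_on \<nu> ?V" and im\<nu>: "\<nu> ` ?V = {..<n}" and inj\<kappa>: "inj_on \<kappa> ?C" and im\<kappa>: "\<kappa> ` ?C = {..<k}"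
    using \<nu> \<kappa> by (auto simp: bij_betw_def)
  note conn = conn_image[OF inj\<nu> _ E, folded EG]
  have \<kappa>k: "\<kappa> c < k" if "c \<in> ?C" for c
    using im\<kappa> that by blast
  have \<nu>n: "\<nu> v < n" if "v \<in> ?V" for v
    using im\<nu> that by blast
  show ?thesis
  proof
    assume "has_motif I"
    then obtain S f where S: "S \<subseteq> ?V" "connected (induced (graph I) S)" "\<forall>v\<in>S. f v \<in> clist I v"
      and mot: "image_mset f (mset_set S) = motif I"
      unfolding has_motif_def by blast
    define g where "g = inv_into ?V \<nu>"
    have g: "g (\<nu> v) = v" if "v \<in> ?V" for v
      using inj\<nu> that by (simp add: g_def inv_into_f_f)
    define f' where "f' w = n + \<kappa> (f (g w))" for w
    have "\<nu> ` S \<subseteq> {..<n}"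
      using S(1) im\<nu> by blast
    moreover have "conn EG (\<nu> ` S)"
      using conn S(1,2) by simp
    moreover have "\<forall>w\<in>\<nu> ` S. {w, f' w} \<in> EH"
      using S g unfolding EH f'_def by (auto simp: subset_iff)
    moreover have "card {w \<in> \<nu> ` S. f' w = c} = mult_of n k ms c" if c: "c \<in> {n..<n + k}" for c
    proof -
      obtain d where d: "d \<in> ?C" "c = n + \<kappa> d"
      proof -
        have "c - n \<in> \<kappa> ` ?C"
          using c im\<kappa> by auto
        then obtain d where d: "d \<in> ?C" "c - n = \<kappa> d"
          by blast
        have "c = n + \<kappa> d"
          using d(2) c by (simp flip: d(2))
        then show ?thesis
          by (rule that[OF d(1)])
      qed
      have fC: "f v \<in> ?C" if "v \<in> S" for v
        using S cl that by blast
      have "\<kappa> (f v) = \<kappa> d \<longleftrightarrow> f v = d" if "v \<in> S" for v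
        using inj_on_eq_iff[OF inj\<kappa> fC[OF that] d(1)] .
      then have "{w \<in> \<nu> ` S. f' w = c} = \<nu> ` {v \<in> S. f v = d}"
        using S(1) g d(2) by (auto simp: f'_def subset_iff)
      moreover have "inj_on \<nu> {v \<in> S. f v = d}"
        by (rule inj_on_subset[OF inj\<nu>]) (use S(1) in auto)
      ultimately have "card {w \<in> \<nu> ` S. f' w = c} = card {v \<in> S. f v = d}"
        by (simp add: card_image)
      also have "\<dots> = count (motif I) d"
        using count_image_mset_set[of S f d] finite_subset[OF S(1) finV] mot by simp
      also have "\<dots> = mult_of n k ms c"
        using ms d \<kappa>k by (simp add: mult_of_def)
      finally show ?thesis .
    qed
    ultimately show "\<exists>S \<subseteq> {..<n}. conn EG S \<and> (\<exists>f. (\<forall>v\<in>S. {v, f v} \<in> EH) \<and>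
      (\<forall>c\<in>{n..<n + k}. card {v \<in> S. f v = c} = mult_of n k ms c))"
      by - (intro exI[of _ "\<nu> ` S"] exI[of _ f'] conjI ballI; simp only:)
  next
    assume "\<exists>S \<subseteq> {..<n}. conn EG S \<and> (\<exists>f. (\<forall>v\<in>S. {v, f v} \<in> EH) \<and>
      (\<forall>c\<in>{n..<n + k}. card {v \<in> S. f v = c} = mult_of n k ms c))"
    then obtain S' f' where S': "S' \<subseteq> {..<n}" "conn EG S'" and f'0: "\<forall>v\<in>S'. {v, f' v} \<in> EH"
      and card0: "\<forall>c\<in>{n..<n + k}. card {v \<in> S'. f' v = c} = mult_of n k ms c"
      by (elim exE conjE)
    have f': "{w, f' w} \<in> EH" if "w \<in> S'" for w
      using f'0 that by (rule bspec)
    have card: "card {w \<in> S'. f' w = c} = mult_of n k ms c" if "n \<le> c" "c < n + k" for c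
      using card0 that by simp
    define S where "S = {v \<in> ?V. \<nu> v \<in> S'}"
    have im: "\<nu> ` S = S'"
      using S'(1) im\<nu> by (auto simp: S_def)
    have SV: "S \<subseteq> ?V"
      by (auto simp: S_def)
    have "\<exists>c. c \<in> clist I v \<and> f' (\<nu> v) = n + \<kappa> c" if v: "v \<in> S" for v
    proof -
      obtain w c where w: "{\<nu> v, f' (\<nu> v)} = {\<nu> w, n + \<kappa> c}" "w \<in> ?V" "c \<in> clist I w"
        using f'[of "\<nu> v"] v unfolding EH S_def by blast
      have "\<nu> v = \<nu> w" "f' (\<nu> v) = n + \<kappa> c"
        using w(1) \<nu>n[of v] v SV by (auto simp: doubleton_eq_iff)
      then show ?thesis
        using w(2,3) inj_onD[OF inj\<nu> \<open>\<nu> v = \<nu> w\<close>] v SV by blast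
    qed
    then obtain f where f: "\<And>v. v \<in> S \<Longrightarrow> f v \<in> clist I v \<and> f' (\<nu> v) = n + \<kappa> (f v)"
      by metis
    have fC: "f v \<in> ?C" if "v \<in> S" for v
      using f[OF that] cl SV that by blast
    have "image_mset f (mset_set S) = motif I"
    proof (rule multiset_eqI)
      fix c
      have cnt: "count (image_mset f (mset_set S)) c = card {v \<in> S. f v = c}"
        by (rule count_image_mset_set) (rule finite_subset[OF SV finV])
      show "count (image_mset f (mset_set S)) c = count (motif I) c"
      proof (cases "c \<in> ?C")
        case True
        have "f' (\<nu> v) = n + \<kappa> c \<longleftrightarrow> f v = c" if "v \<in> S" for v
          using f[OF that] fC[OF that] True inj\<kappa> by (auto simp: inj_on_eq_iff)
        then have "{w \<in> S'. f' w = n + \<kappa> c} = \<nu> ` {v \<in> S. f v = c}"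
          unfolding im[symmetric] by auto
        moreover have "inj_on \<nu> {v \<in> S. f v = c}"
          by (rule inj_on_subset[OF inj\<nu>]) (use SV in auto)
        ultimately have "card {v \<in> S. f v = c} = card {w \<in> S'. f' w = n + \<kappa> c}"
          by (simp add: card_image)
        then show ?thesis
          using cnt card[of "n + \<kappa> c"] \<kappa>k[OF True] ms True by (simp add: mult_of_def)
      next
        case False
        then have "{v \<in> S. f v = c} = {}"
          using fC by auto
        then have "card {v \<in> S. f v = c} = 0"
          by (simp only: card.empty)
        then show ?thesis
          using cnt False by (simp add: colors_def not_in_iff)
      qed
    qed
    moreover have "connected (induced (graph I) S)"
      using conn[OF SV] S'(2) im by simp
    ultimately show "has_motif I"
      unfolding has_motif_def using SV f
      by (intro exI[of _ S] exI[of _ f] conjI ballI) simp_all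
  qed
qed

section \<open>Leaf elimination\<close>

text \<open>\<open>F\<close> is the set of the remaining edges after the removal of \<open>t\<close> leaves.\<close>

definition elim_inv :: "nat set set \<Rightarrow> nat \<Rightarrow> nat set set \<Rightarrow> (nat \<Rightarrow> nat) \<Rightarrow> (nat \<Rightarrow> nat) \<Rightarrow>
    (nat \<Rightarrow> nat) \<Rightarrow> (nat \<Rightarrow> nat) \<Rightarrow> nat \<Rightarrow> bool" where
  "elim_inv E N F d sm par od t \<longleftrightarrow> F \<subseteq> E \<and>
     d = (\<lambda>v. card {e \<in> F. v \<in> e}) \<and> sm = (\<lambda>v. \<Sum>e\<in>{e \<in> F. v \<in> e}. \<Sum>e - v) \<and>
     inj_on od {..<t} \<and> od ` {..<t} \<subseteq> {..<N} \<and> (\<forall>v<N. par v = N \<longleftrightarrow> v \<notin> od ` {..<t}) \<and>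
     (\<forall>j<t. par (od j) < N \<and> par (od j) \<notin> od ` {..j}) \<and>
     E = F \<union> {{od j, par (od j)} | j. j < t} \<and> (\<forall>e\<in>F. e \<inter> od ` {..<t} = {})"

text \<open>At degree 1 the sum of the neighbors is the neighbor. Subtracting \<open>x\<close> from
  the sum at the neighbor and 1 from its degree deletes the edge from the data.\<close>

lemma elim_step:
  assumes inv: "elim_inv E N F d sm par od t" and x: "d x = 1"
    and E: "\<And>e. e \<in> E \<Longrightarrow> \<exists>a b. e = {a, b} \<and> a \<noteq> b \<and> a < N \<and> b < N"
  shows "\<exists>F'. elim_inv E N F' (d(x := 0, sm x := d (sm x) - 1)) (sm(x := 0, sm x := sm (sm x) - x))
      (par(x := sm x)) (od(t := x)) (Suc t)"
    and "sm x < N" "sm x \<noteq> x" "t < N"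
proof -
  define y where "y = sm x"
  have FE: "F \<subseteq> E" and d: "d = (\<lambda>v. card {e \<in> F. v \<in> e})"
    and sm: "sm = (\<lambda>v. \<Sum>e\<in>{e \<in> F. v \<in> e}. \<Sum>e - v)"
    and inj: "inj_on od {..<t}" and im: "od ` {..<t} \<subseteq> {..<N}"
    and par0: "\<forall>v<N. par v = N \<longleftrightarrow> v \<notin> od ` {..<t}"
    and later0: "\<forall>j<t. par (od j) < N \<and> par (od j) \<notin> od ` {..j}"
    and EF: "E = F \<union> {{od j, par (od j)} | j. j < t}" and disj0: "\<forall>e\<in>F. e \<inter> od ` {..<t} = {}"
    by (insert inv[unfolded elim_inv_def], (elim conjE, assumption)+)
  have par: "par v = N \<longleftrightarrow> v \<notin> od ` {..<t}" if "v < N" for v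
    using par0 that by simp
  have later: "par (od j) < N \<and> par (od j) \<notin> od ` {..j}" if "j < t" for j
    using later0 that by simp
  have disj: "e \<inter> od ` {..<t} = {}" if "e \<in> F" for e
    using disj0 that by simp
  have "finite E"
    by (rule finite_subset[of _ "Pow {..<N}"]) (use E in auto)
  then have finF: "finite F"
    using FE by (rule finite_subset[rotated])
  obtain e0 where e0: "{e \<in> F. x \<in> e} = {e0}"
    using x unfolding d by (auto simp: card_1_singleton_iff)
  then have "e0 \<in> {e \<in> F. x \<in> e}"
    by simp
  then have e0F: "e0 \<in> F" "x \<in> e0"
    by simp_all
  then obtain z where z: "e0 = {x, z}" "z \<noteq> x" "x < N" "z < N"
  proof -
    obtain a b where "e0 = {a, b}" "a \<noteq> b" "a < N" "b < N"
      using E[of e0] FE e0F(1) by blast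
    then show ?thesis
      using that[of b] that[of a] e0F(2) by (auto simp: insert_commute)
  qed
  have "y = \<Sum>e0 - x"
    unfolding y_def sm e0 by simp
  then have "y = z"
    using z by simp
  then have e0y: "e0 = {x, y}" "y \<noteq> x" "x < N" "y < N"
    using z by auto
  have xn: "x \<notin> od ` {..<t}" and yn: "y \<notin> od ` {..<t}"
    using disj[OF e0F(1)] e0y by auto
  show "sm x < N" "sm x \<noteq> x"
    using e0y by (auto simp: y_def)
  have "card (od ` {..<t}) < card {..<N}"
    using im xn e0y(3) by (intro psubset_card_mono) auto
  then show tN: "t < N"
    using inj by (simp add: card_image)
  let ?F = "F - {e0}"
  have Fx: "{e \<in> ?F. x \<in> e} = {}"
    using e0 by blast
  have Fy: "{e \<in> ?F. y \<in> e} = {e \<in> F. y \<in> e} - {e0}" "e0 \<in> {e \<in> F. y \<in> e}"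
    using e0F e0y by auto
  have Fv: "{e \<in> ?F. v \<in> e} = {e \<in> F. v \<in> e}" if "v \<noteq> x" "v \<noteq> y" for v
    using that e0y by auto
  have finy: "finite {e \<in> F. y \<in> e}"
    using finF by simp
  have d': "d(x := 0, y := d y - 1) = (\<lambda>v. card {e \<in> ?F. v \<in> e})"
  proof
    fix v
    consider "v = x" | "v = y" | "v \<noteq> x" "v \<noteq> y"
      by blast
    then show "(d(x := 0, y := d y - 1)) v = card {e \<in> ?F. v \<in> e}"
    proof cases
      case 1
      then show ?thesis
        using Fx e0y(2) by (simp only: fun_upd_apply) simp
    next
      case 2
      then show ?thesis
        unfolding Fy(1) 2 using Fy(2) finy by (simp add: d card_Diff_singleton del: mem_Collect_eq)
    next
      case 3
      then show ?thesis
        unfolding Fv[OF 3] by (simp add: d)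
    qed
  qed
  have sm': "sm(x := 0, y := sm y - x) = (\<lambda>v. \<Sum>e\<in>{e \<in> ?F. v \<in> e}. \<Sum>e - v)"
  proof
    fix v
    consider "v = x" | "v = y" | "v \<noteq> x" "v \<noteq> y"
      by blast
    then show "(sm(x := 0, y := sm y - x)) v = (\<Sum>e\<in>{e \<in> ?F. v \<in> e}. \<Sum>e - v)"
    proof cases
      case 1
      then show ?thesis
        unfolding 1 Fx using e0y(2) by simp
    next
      case 2
      have "\<Sum>e0 - y = x"
        using e0y by simp
      then have "(\<Sum>e\<in>{e \<in> F. y \<in> e}. \<Sum>e - y) = x + (\<Sum>e\<in>{e \<in> F. y \<in> e} - {e0}. \<Sum>e - y)"
        using sum.remove[OF finy Fy(2), of "\<lambda>e. \<Sum>e - y"] by simp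
      then show ?thesis
        unfolding 2 Fy(1) by (simp add: sm)
    next
      case 3
      then show ?thesis
        unfolding Fv[OF 3] by (simp add: sm)
    qed
  qed
  let ?od = "od(t := x)" and ?par = "par(x := y)"
  have im': "?od ` {..<Suc t} = insert x (od ` {..<t})"
    by (simp add: lessThan_Suc) (auto simp: fun_upd_def)
  have odj: "?od j = od j" "?par (od j) = par (od j)" if "j < t" for j
    using that xn by auto
  have "elim_inv E N ?F (d(x := 0, y := d y - 1)) (sm(x := 0, y := sm y - x)) ?par ?od (Suc t)"
    unfolding elim_inv_def
  proof (intro conjI allI impI ballI)
    show "?F \<subseteq> E"
      using FE by blast
    show "d(x := 0, y := d y - 1) = (\<lambda>v. card {e \<in> ?F. v \<in> e})"
      by (rule d')
    show "sm(x := 0, y := sm y - x) = (\<lambda>v. \<Sum>e\<in>{e \<in> ?F. v \<in> e}. \<Sum>e - v)"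
      by (rule sm')
    show "inj_on ?od {..<Suc t}"
      using inj xn by (auto simp: inj_on_def less_Suc_eq)
    show "?od ` {..<Suc t} \<subseteq> {..<N}"
      unfolding im' using im e0y by simp
    show "(?par v = N) = (v \<notin> ?od ` {..<Suc t})" if "v < N" for v
      unfolding im' using par[OF that] e0y by auto
    fix j assume j: "j < Suc t"
    have "?od ` {..j} = (if j = t then insert x (od ` {..<t}) else od ` {..j})"
      using j by (auto simp: image_iff fun_upd_def split: if_splits)
    then show "?par (?od j) < N" "?par (?od j) \<notin> ?od ` {..j}"
      using j later[of j] odj[of j] e0y yn by (auto split: if_splits)
  next
    have shift: "X' = insert a X \<Longrightarrow> F = insert a F' \<Longrightarrow> E = F \<union> X \<Longrightarrow> E = F' \<union> X'" for a X X' F'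
      by simp
    have "{{?od j, ?par (?od j)} | j. j < Suc t} = insert {x, y} {{od j, par (od j)} | j. j < t}"
    proof (intro equalityI subsetI)
      fix e assume "e \<in> {{?od j, ?par (?od j)} | j. j < Suc t}"
      then obtain j where j: "j < Suc t" "e = {?od j, ?par (?od j)}"
        by blast
      show "e \<in> insert {x, y} {{od j, par (od j)} | j. j < t}"
      proof (cases "j = t")
        case False
        then have "j < t"
          using j by simp
        then show ?thesis
          using j(2) odj[of j] by auto
      qed (use j in simp)
    next
      fix e assume "e \<in> insert {x, y} {{od j, par (od j)} | j. j < t}"
      then consider "e = {x, y}" | j where "j < t" "e = {od j, par (od j)}"
        by blast
      then show "e \<in> {{?od j, ?par (?od j)} | j. j < Suc t}"
      proof cases
        case 1
        then show ?thesis
          by (intro CollectI exI[of _ t]) simp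
      next
        case 2
        then show ?thesis
          using odj[of j] by (intro CollectI exI[of _ j]) simp
      qed
    qed
    moreover have "F = insert {x, y} ?F"
      using e0F(1) e0y(1) by auto
    ultimately show "E = ?F \<union> {{?od j, ?par (?od j)} | j. j < Suc t}"
      using EF by (rule shift)
    fix e assume e: "e \<in> ?F"
    have "e \<notin> {e \<in> ?F. x \<in> e}"
      unfolding Fx by simp
    then have "x \<notin> e"
      using e by simp
    then show "e \<inter> ?od ` {..<Suc t} = {}"
      unfolding im' using disj[of e] e by blast
  qed
  then show "\<exists>F'. elim_inv E N F' (d(x := 0, sm x := d (sm x) - 1)) (sm(x := 0, sm x := sm (sm x) - x))
      (par(x := sm x)) (od(t := x)) (Suc t)"
    unfolding y_def[symmetric] by blast
qed

text \<open>When all edges are gone, the nodes without a parent are the roots. Appending them to the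
  removed leaves keeps every node before its parent, and a count shows that all nodes are
  listed.\<close>

lemma elim_rooted:
  assumes inv: "elim_inv E N {} d sm par od t0"
    and od': "inj_on od' {..<t}" "od' ` {..<t} = od ` {..<t0} \<union> {v. v < N \<and> par v = N}"
    and eq: "\<And>j. j < t0 \<Longrightarrow> od' j = od j" and le: "t0 \<le> t"
  shows "rooted N E par od'"
proof -
  have im: "od ` {..<t0} \<subseteq> {..<N}"
    and par0: "\<forall>v<N. par v = N \<longleftrightarrow> v \<notin> od ` {..<t0}"
    and later0: "\<forall>j<t0. par (od j) < N \<and> par (od j) \<notin> od ` {..j}"
    and EF0: "E = {} \<union> {{od j, par (od j)} | j. j < t0}"
    by (insert inv[unfolded elim_inv_def], (elim conjE, assumption)+)
  have par: "par v = N \<longleftrightarrow> v \<notin> od ` {..<t0}" if "v < N" for v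
    using par0 that by simp
  have later: "par (od j) < N \<and> par (od j) \<notin> od ` {..j}" if "j < t0" for j
    using later0 that by simp
  have EF: "E = {{od j, par (od j)} | j. j < t0}"
    using EF0 by simp
  have all: "od' ` {..<t} = {..<N}"
    using od'(2) im par by auto
  then have tN: "t = N"
    using card_image[OF od'(1)] by simp
  have pos: "j < t0" if j: "j < N" "par (od' j) \<noteq> N" for j
  proof -
    have "od' j \<in> od' ` {..<t}"
      using j(1) tN by simp
    then have "od' j < N"
      unfolding all by simp
    then have "od' j \<in> od ` {..<t0}"
      using par[of "od' j"] j(2) by blast
    then obtain i where i: "i < t0" "od i = od' j"
      by force
    then have "od' i = od' j"
      using eq by simp
    then have "i = j"
      using inj_onD[OF od'(1), of i j] i(1) j(1) tN le by simp
    then show ?thesis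
      using i(1) by simp
  qed
  show ?thesis
    unfolding rooted_def
  proof (intro conjI allI impI)
    show "bij_betw od' {..<N} {..<N}"
      using od'(1) all tN by (simp add: bij_betw_def)
    fix i assume i: "i < N"
    show "par (od' i) = N \<or> (\<exists>j. i < j \<and> j < N \<and> par (od' i) = od' j)"
    proof (cases "par (od' i) = N")
      case False
      then have i0: "i < t0"
        using pos i by blast
      have l: "par (od i) < N" "par (od i) \<notin> od ` {..i}"
        using later[OF i0] by simp_all
      have "par (od i) \<in> od' ` {..<t}"
        unfolding all using l(1) by simp
      then obtain j where j: "j < N" "od' j = par (od i)"
        unfolding tN by auto
      have "\<not> j \<le> i"
        using l(2) j(2) eq[of j] i0 by auto
      then show ?thesis
        using j eq[OF i0] by (intro disjI2 exI[of _ j]) simp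
    qed simp
  next
    have 1: "od j < N" "par (od j) < N" if "j < t0" for j
      using later[OF that] im that by auto
    have 2: "\<exists>j<t0. x = od j" if "x < N" "par x < N" for x
    proof -
      have "x \<in> od ` {..<t0}"
        using par[OF that(1)] that(2) by blast
      then show ?thesis
        by auto
    qed
    show "E = {{x, par x} | x. x < N \<and> par x < N}"
    proof (intro equalityI subsetI)
      fix e assume "e \<in> E"
      then obtain j where "j < t0" "e = {od j, par (od j)}"
        unfolding EF by blast
      then show "e \<in> {{x, par x} | x. x < N \<and> par x < N}"
        using 1[of j] by (intro CollectI exI[of _ "od j"]) simp
    next
      fix e assume "e \<in> {{x, par x} | x. x < N \<and> par x < N}"
      then obtain x where x: "x < N" "par x < N" "e = {x, par x}"
        by blast
      then obtain j where "j < t0" "x = od j"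
        using 2 by blast
      then show "e \<in> E"
        unfolding EF x(3) by blast
    qed
  qed
qed

section \<open>Linear-time programs for rooting a forest\<close>

primrec seqs :: "com list \<Rightarrow> com" where
  "seqs [] = Skip"
| "seqs (c # cs) = Seq c (seqs cs)"

text \<open>The arrays with second letter \<open>d\<close> and \<open>s\<close> hold the degrees and the sums of the neighbors, so the
  only neighbor of a leaf is known without adjacency lists. The arrays \<open>p\<close> and \<open>o\<close> receive the
  parents and the order of a rooted forest.\<close>

definition read_edges :: "char \<Rightarrow> com" where
  "read_edges p = For ''i'' ''ec'' (seqs
    [Assign ''a'' (Load ''in'' (Plus (Reg ''eo'') (Plus (Reg ''i'') (Reg ''i'')))),
     Assign ''b'' (Plus (Load ''in'' (Plus (Reg ''eo'') (Plus (Reg ''i'') (Plus (Reg ''i'') (Const 1))))) (Reg ''sh'')),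
     Store [p, CHR ''d''] (Reg ''a'') (Plus (Load [p, CHR ''d''] (Reg ''a'')) (Const 1)),
     Store [p, CHR ''s''] (Reg ''a'') (Plus (Load [p, CHR ''s''] (Reg ''a'')) (Reg ''b'')),
     Store [p, CHR ''d''] (Reg ''b'') (Plus (Load [p, CHR ''d''] (Reg ''b'')) (Const 1)),
     Store [p, CHR ''s''] (Reg ''b'') (Plus (Load [p, CHR ''s''] (Reg ''b'')) (Reg ''a''))])"

text \<open>No queue of leaves is kept. After the removal of \<open>x\<close> only its neighbor
  \<open>y\<close> can have become a leaf, so the scan continues with \<open>y\<close> and returns
  to position \<open>i + 1\<close> once the chain of leaves ends.\<close>

definition strip_leaves :: "char \<Rightarrow> com" where
  "strip_leaves p = While (Less (Reg ''i'') (Reg ''nn''))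
    (If (Equal (Load [p, CHR ''d''] (Reg ''x'')) (Const 1))
      (seqs
       [Assign ''y'' (Load [p, CHR ''s''] (Reg ''x'')),
        Store [p, CHR ''p''] (Reg ''x'') (Reg ''y''),
        Store [p, CHR ''o''] (Reg ''t'') (Reg ''x''),
        Assign ''t'' (Plus (Reg ''t'') (Const 1)),
        Store [p, CHR ''d''] (Reg ''x'') (Const 0),
        Store [p, CHR ''d''] (Reg ''y'') (Minus (Load [p, CHR ''d''] (Reg ''y'')) (Const 1)),
        Store [p, CHR ''s''] (Reg ''x'') (Const 0),
        Store [p, CHR ''s''] (Reg ''y'') (Minus (Load [p, CHR ''s''] (Reg ''y'')) (Reg ''x'')),
        Assign ''x'' (Reg ''y'')])
      (seqs
       [Assign ''i'' (Plus (Reg ''i'') (Const 1)),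
        Assign ''x'' (Reg ''i'')]))"

definition elim :: "char \<Rightarrow> com" where
  "elim p = seqs
    [read_edges p,
     For ''i'' ''nn'' (Store [p, CHR ''p''] (Reg ''i'') (Reg ''nn'')),
     seqs [Assign ''i'' (Const 0), Assign ''x'' (Const 0), Assign ''t'' (Const 0)],
     strip_leaves p,
     For ''i'' ''nn'' (If (Equal (Load [p, CHR ''p''] (Reg ''i'')) (Reg ''nn''))
       (seqs [Store [p, CHR ''o''] (Reg ''t'') (Reg ''i''), Assign ''t'' (Plus (Reg ''t'') (Const 1))])
       Skip)]"

text \<open>\<open>sh\<close> is added to the second entry of a pair; it is 0 for the graph and
  \<open>n\<close> when the second entry is a color. The term \<open>f i + g i - v\<close> is the
  end of the edge other than \<open>v\<close>.\<close>

lemma read_edges: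
  assumes zero: "arrs s [p, CHR ''d''] = (\<lambda>_. 0)" "arrs s [p, CHR ''s''] = (\<lambda>_. 0)"
    and E: "\<And>i. i < regs s ''ec'' \<Longrightarrow> f i = arrs s ''in'' (regs s ''eo'' + 2 * i) \<and>
      g i = arrs s ''in'' (regs s ''eo'' + 2 * i + 1) + regs s ''sh'' \<and> f i \<noteq> g i"
  shows "run (read_edges p) s (6 + regs s ''ec'' * 60) (\<lambda>s'.
    arrs s' [p, CHR ''d''] = (\<lambda>v. \<Sum>i<regs s ''ec''. if v = f i \<or> v = g i then 1 else 0) \<and>
    arrs s' [p, CHR ''s''] = (\<lambda>v. \<Sum>i<regs s ''ec''. if v = f i \<or> v = g i then f i + g i - v else 0))"
  unfolding read_edges_def
proof (rule run_for[where B = 52 and I = "\<lambda>i s'.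
    arrs s' [p, CHR ''d''] = (\<lambda>v. \<Sum>i<i. if v = f i \<or> v = g i then 1 else 0) \<and>
    arrs s' [p, CHR ''s''] = (\<lambda>v. \<Sum>i<i. if v = f i \<or> v = g i then f i + g i - v else 0)"], goal_cases)
  case (5 i s')
  have pres: "arrs s' ''in'' = arrs s ''in''" "regs s' ''eo'' = regs s ''eo''" "regs s' ''sh'' = regs s ''sh''"
    using 5(1) by (simp_all add: frame_def)
  have fg: "arrs s' ''in'' (regs s ''eo'' + (i + i)) = f i" "arrs s' ''in'' (Suc (regs s ''eo'' + (i + i))) + regs s ''sh'' = g i"
    "f i \<noteq> g i"
    using E[OF 5(2)] by (simp_all add: pres mult_2)
  show ?case
    by (rule run_straight) (use fg pres 5(2-4) in \<open>auto simp: fun_eq_iff\<close>)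
qed (use zero in auto)


text \<open>Invariant: among the nodes up to \<open>i\<close> only \<open>x\<close> may have degree
  1. At the end no node has degree 1, and \<open>leafy\<close> leaves no edge. Each round removes a
  leaf or advances \<open>i\<close>, hence at most \<open>2 * N\<close> rounds.\<close>

lemma strip_leaves:
  assumes nn: "regs s ''nn'' = N"
    and s: "regs s ''i'' = 0" "regs s ''x'' = 0" "regs s ''t'' = 0"
    and inv: "elim_inv E N E (arrs s [p, CHR ''d'']) (arrs s [p, CHR ''s'']) (arrs s [p, CHR ''p'']) (arrs s [p, CHR ''o'']) 0"
    and E: "\<And>e. e \<in> E \<Longrightarrow> \<exists>a b. e = {a, b} \<and> a \<noteq> b \<and> a < N \<and> b < N" and leafy: "leafy E"
  shows "run (strip_leaves p) s (4 + 2 * N * 60) (\<lambda>s'. regs s' ''t'' \<le> N \<and>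
    elim_inv E N {} (arrs s' [p, CHR ''d'']) (arrs s' [p, CHR ''s'']) (arrs s' [p, CHR ''p'']) (arrs s' [p, CHR ''o'']) (regs s' ''t''))"
proof -
  let ?I = "\<lambda>s'. regs s' ''i'' \<le> N \<and> regs s' ''t'' \<le> N \<and> (regs s' ''i'' < N \<longrightarrow> regs s' ''x'' < N) \<and>
    (regs s' ''i'' = N \<longrightarrow> regs s' ''x'' = N) \<and> (\<forall>v\<le>regs s' ''i''. v \<noteq> regs s' ''x'' \<longrightarrow> arrs s' [p, CHR ''d''] v \<noteq> 1) \<and>
    (\<exists>F. elim_inv E N F (arrs s' [p, CHR ''d'']) (arrs s' [p, CHR ''s'']) (arrs s' [p, CHR ''p'']) (arrs s' [p, CHR ''o'']) (regs s' ''t''))"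
  let ?m = "\<lambda>s'. (N - regs s' ''i'') + (N - regs s' ''t'')"
  show ?thesis
    unfolding strip_leaves_def
  proof (rule run_mono[OF run_while[where I = ?I and m = ?m and B = 56] order.refl], goal_cases)
    case (1 s')
    have nn': "regs s' ''nn'' = N"
      using 1(1) nn by (simp add: frame_def)
    have i: "regs s' ''i'' < N"
      using 1(3) nn' by simp
    obtain F where F: "elim_inv E N F (arrs s' [p, CHR ''d'']) (arrs s' [p, CHR ''s'']) (arrs s' [p, CHR ''p'']) (arrs s' [p, CHR ''o'']) (regs s' ''t'')"
      using 1(2) by blast
    have scan: "arrs s' [p, CHR ''d''] v \<noteq> 1" if "v \<le> regs s' ''i''" "v \<noteq> regs s' ''x''" for v
      using 1(2) that by blast
    have tN: "regs s' ''t'' \<le> N"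
      using 1(2) by blast
    show ?case
    proof (rule run_If)
      assume "bval (Equal (Load [p, CHR ''d''] (Reg ''x'')) (Const 1)) s'"
      then have x: "arrs s' [p, CHR ''d''] (regs s' ''x'') = 1"
        by simp
      note step = elim_step[OF F x E]
      show "run (seqs
       [Assign ''y'' (Load [p, CHR ''s''] (Reg ''x'')),
        Store [p, CHR ''p''] (Reg ''x'') (Reg ''y''),
        Store [p, CHR ''o''] (Reg ''t'') (Reg ''x''),
        Assign ''t'' (Plus (Reg ''t'') (Const 1)),
        Store [p, CHR ''d''] (Reg ''x'') (Const 0),
        Store [p, CHR ''d''] (Reg ''y'') (Minus (Load [p, CHR ''d''] (Reg ''y'')) (Const 1)),
        Store [p, CHR ''s''] (Reg ''x'') (Const 0),
        Store [p, CHR ''s''] (Reg ''y'') (Minus (Load [p, CHR ''s''] (Reg ''y'')) (Reg ''x'')),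
        Assign ''x'' (Reg ''y'')]) s' 50 (\<lambda>s''. ?I s'' \<and> ?m s'' < ?m s')"
        using step i scan tN
        by (intro run_straight) (auto split: if_splits)
    next
      assume "\<not> bval (Equal (Load [p, CHR ''d''] (Reg ''x'')) (Const 1)) s'"
      then have x: "arrs s' [p, CHR ''d''] (regs s' ''x'') \<noteq> 1"
        by simp
      have scan': "arrs s' [p, CHR ''d''] v \<noteq> 1" if "v \<le> regs s' ''i''" for v
        using scan[OF that] x by (cases "v = regs s' ''x''") auto
      show "run (seqs [Assign ''i'' (Plus (Reg ''i'') (Const 1)), Assign ''x'' (Reg ''i'')]) s' 50
        (\<lambda>s''. ?I s'' \<and> ?m s'' < ?m s')"
        using i F tN scan' by (intro run_straight) (auto simp: le_Suc_eq)
    qed simp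
  next
    case 2
    then show ?case
      using s inv nn by auto
  next
    case 3
    then show ?case
      using s by simp
  next
    case (4 s')
    then obtain F where F: "elim_inv E N F (arrs s' [p, CHR ''d'']) (arrs s' [p, CHR ''s'']) (arrs s' [p, CHR ''p'']) (arrs s' [p, CHR ''o'']) (regs s' ''t'')"
      by blast
    have nn': "regs s' ''nn'' = N"
      using 4(1) nn by (simp add: frame_def)
    have i: "regs s' ''i'' = N" "regs s' ''x'' = N"
      using 4(2) nn' by auto
    have scan: "arrs s' [p, CHR ''d''] v \<noteq> 1" if "v < N" for v
      using 4(2) that i by simp
    have FE: "F \<subseteq> E" and d: "arrs s' [p, CHR ''d''] = (\<lambda>v. card {e \<in> F. v \<in> e})"
      using F unfolding elim_inv_def by blast+
    have "F = {}"
    proof (rule ccontr)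
      assume "F \<noteq> {}"
      with leafy FE obtain x e where xe: "e \<in> F" "{e \<in> F. x \<in> e} = {e}" "x \<in> e"
        by (rule leafyE)
      then have "arrs s' [p, CHR ''d''] x = 1"
        unfolding d xe(2) by simp
      moreover have "x < N"
        using E[of e] FE xe by auto
      ultimately show False
        using scan by blast
    qed
    then show ?case
      using F 4(2) by simp
  qed
qed

lemma elim:
  fixes f g :: "nat \<Rightarrow> nat"
  assumes zero: "arrs s [p, CHR ''d''] = (\<lambda>_. 0)" "arrs s [p, CHR ''s''] = (\<lambda>_. 0)"
    and nn: "regs s ''nn'' = N" and m: "regs s ''ec'' = m"
    and fg: "\<And>i. i < m \<Longrightarrow> f i = arrs s ''in'' (regs s ''eo'' + 2 * i) \<and>
      g i = arrs s ''in'' (regs s ''eo'' + 2 * i + 1) + regs s ''sh'' \<and> f i \<noteq> g i \<and> f i < N \<and> g i < N"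
    and inj: "inj_on (\<lambda>i. {f i, g i}) {..<m}" and E: "E = (\<lambda>i. {f i, g i}) ` {..<m}" and leafy: "leafy E"
  shows "run (elim p) s (60 + 60 * m + 180 * N) (\<lambda>s'. rooted N E (arrs s' [p, CHR ''p'']) (arrs s' [p, CHR ''o'']))"
proof -
  have E2: "\<exists>a b. e = {a, b} \<and> a \<noteq> b \<and> a < N \<and> b < N" if "e \<in> E" for e
    using that fg unfolding E by blast
  have ne: "f i \<noteq> g i" if "i < m" for i
    using fg[OF that] by simp
  have finE: "finite E"
    unfolding E by simp
  have d: "(\<lambda>v. \<Sum>i<m. if v = f i \<or> v = g i then 1 else 0) = (\<lambda>v. card {e \<in> E. v \<in> e})"
  proof
    fix v
    have "card {e \<in> E. v \<in> e} = (\<Sum>e\<in>E. if v \<in> e then 1 else 0)"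
      using finE by (simp add: sum.If_cases Int_def)
    then show "(\<Sum>i<m. if v = f i \<or> v = g i then 1 else 0) = card {e \<in> E. v \<in> e}"
      unfolding E by (simp add: sum.reindex[OF inj])
  qed
  have sm: "(\<lambda>v. \<Sum>i<m. if v = f i \<or> v = g i then f i + g i - v else 0) = (\<lambda>v. \<Sum>e\<in>{e \<in> E. v \<in> e}. \<Sum>e - v)"
  proof
    fix v
    have "(\<Sum>e\<in>{e \<in> E. v \<in> e}. \<Sum>e - v) = (\<Sum>e\<in>E. if v \<in> e then \<Sum>e - v else 0)"
      using finE by (simp add: sum.If_cases Int_def)
    also have "\<dots> = (\<Sum>i<m. if v \<in> {f i, g i} then \<Sum>{f i, g i} - v else 0)"
      unfolding E by (simp only: sum.reindex[OF inj] o_def)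
    also have "\<dots> = (\<Sum>i<m. if v = f i \<or> v = g i then f i + g i - v else 0)"
      using ne by (intro sum.cong) auto
    finally show "(\<Sum>i<m. if v = f i \<or> v = g i then f i + g i - v else 0) = (\<Sum>e\<in>{e \<in> E. v \<in> e}. \<Sum>e - v)"
      by (rule sym)
  qed
  have rd: "f i = arrs s ''in'' (regs s ''eo'' + 2 * i) \<and>
    g i = arrs s ''in'' (regs s ''eo'' + 2 * i + 1) + regs s ''sh'' \<and> f i \<noteq> g i" if "i < m" for i
    using fg[OF that] by (elim conjE) (intro conjI)
  have l1: "run (read_edges p) s (6 + m * 60) (\<lambda>s'. arrs s' [p, CHR ''d''] = (\<lambda>v. card {e \<in> E. v \<in> e}) \<and>
    arrs s' [p, CHR ''s''] = (\<lambda>v. \<Sum>e\<in>{e \<in> E. v \<in> e}. \<Sum>e - v))"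
    by (rule read_edges[OF zero rd, unfolded m d sm]) (simp add: m)
  show ?thesis
    unfolding elim_def seqs.simps
  proof (rule run_seq[OF l1, where U = "45 + 175 * N"], goal_cases)
    case (1 s1)
    have s1: "arrs s1 [p, CHR ''d''] = (\<lambda>v. card {e \<in> E. v \<in> e})"
      "arrs s1 [p, CHR ''s''] = (\<lambda>v. \<Sum>e\<in>{e \<in> E. v \<in> e}. \<Sum>e - v)"
      and nn1: "regs s1 ''nn'' = N"
      using 1 nn by (simp_all add: frame_def read_edges_def)
    have l2: "run (For ''i'' ''nn'' (Store [p, CHR ''p''] (Reg ''i'') (Reg ''nn''))) s1 (6 + N * 11)
      (\<lambda>s'. \<forall>v<N. arrs s' [p, CHR ''p''] v = N)"
      by (rule run_for[where B = 3 and I = "\<lambda>i s'. \<forall>v<i. arrs s' [p, CHR ''p''] v = N"])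
        (use nn1 in \<open>auto intro!: run_straight simp: frame_def less_Suc_eq\<close>)
    show ?case
    proof (rule run_seq[OF l2, where U = "35 + 160 * N"], goal_cases)
      case (1 s2)
      have s1: "arrs s2 [p, CHR ''d''] = (\<lambda>v. card {e \<in> E. v \<in> e})"
        "arrs s2 [p, CHR ''s''] = (\<lambda>v. \<Sum>e\<in>{e \<in> E. v \<in> e}. \<Sum>e - v)"
        and s2: "\<forall>v<N. arrs s2 [p, CHR ''p''] v = N" and nn2: "regs s2 ''nn'' = N"
        using 1 s1 nn1 by (simp_all add: frame_def)
      show ?case
      proof (rule run_seq[where T = 10 and Q = "\<lambda>s'. s' = set_reg (set_reg (set_reg s2 ''i'' 0) ''x'' 0) ''t'' 0" and U = "20 + 150 * N"], goal_cases)
        case 1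
        show ?case
          by (rule run_straight) simp_all
      next
        case (2 s3)
        have l3: "run (strip_leaves p) s3 (4 + 2 * N * 60) (\<lambda>s'. regs s' ''t'' \<le> N \<and>
    elim_inv E N {} (arrs s' [p, CHR ''d'']) (arrs s' [p, CHR ''s'']) (arrs s' [p, CHR ''p'']) (arrs s' [p, CHR ''o'']) (regs s' ''t''))"
        proof (rule strip_leaves[OF _ _ _ _ _ E2 leafy], goal_cases)
          case 5
          have "arrs s3 [p, CHR ''d''] = (\<lambda>v. card {e \<in> E. v \<in> e})"
            "arrs s3 [p, CHR ''s''] = (\<lambda>v. \<Sum>e\<in>{e \<in> E. v \<in> e}. \<Sum>e - v)"
            "\<forall>v<N. arrs s3 [p, CHR ''p''] v = N"
            using s1 s2 2(2) by (simp_all add: frame_def)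
          then show ?case
            by (simp add: elim_inv_def)
        qed (use nn2 2(2) in simp_all)
        show ?case
        proof (rule run_seq[OF l3, where U = "10 + 21 * N"], goal_cases)
          case (1 s4)
          let ?od = "arrs s4 [p, CHR ''o'']" and ?par = "arrs s4 [p, CHR ''p'']" and ?t = "regs s4 ''t''"
          have nn4: "regs s4 ''nn'' = N"
            using 1(1) 2(2) nn2 by (simp add: frame_def strip_leaves_def)
          have inv: "elim_inv E N {} (arrs s4 [p, CHR ''d'']) (arrs s4 [p, CHR ''s'']) ?par ?od ?t"
            using 1(2) by simp
          have inj0: "inj_on ?od {..<?t}" and par0: "\<forall>v<N. ?par v = N \<longleftrightarrow> v \<notin> ?od ` {..<?t}"
            by (insert inv[unfolded elim_inv_def], (elim conjE, assumption)+)
          let ?I = "\<lambda>i s'. inj_on (arrs s' [p, CHR ''o'']) {..<regs s' ''t''} \<and>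
            arrs s' [p, CHR ''o''] ` {..<regs s' ''t''} = ?od ` {..<?t} \<union> {v. v < i \<and> ?par v = N} \<and>
            (\<forall>j<?t. arrs s' [p, CHR ''o''] j = ?od j) \<and> ?t \<le> regs s' ''t''"
          have l4: "run (For ''i'' ''nn'' (If (Equal (Load [p, CHR ''p''] (Reg ''i'')) (Reg ''nn''))
       (seqs [Store [p, CHR ''o''] (Reg ''t'') (Reg ''i''), Assign ''t'' (Plus (Reg ''t'') (Const 1))])
       Skip)) s4 (6 + N * 21) (\<lambda>s'. rooted N E (arrs s' [p, CHR ''p'']) (arrs s' [p, CHR ''o'']))"
          proof (rule run_for[where B = 13 and I = ?I], goal_cases)
            case 4
            then show ?case
              using inj0 by simp
          next
            case (5 i s')
            have fr: "arrs s' [p, CHR ''p''] = ?par" "regs s' ''nn'' = N"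
              using 5(1) nn4 by (simp_all add: frame_def)
            have iN: "i < N"
              using 5(2) nn4 by simp
            let ?o = "arrs s' [p, CHR ''o'']" and ?u = "regs s' ''t''"
            have I: "inj_on ?o {..<?u}" "?o ` {..<?u} = ?od ` {..<?t} \<union> {v. v < i \<and> ?par v = N}"
              "\<forall>j<?t. ?o j = ?od j" "?t \<le> ?u"
              using 5(4) by simp_all
            show ?case
            proof (cases "?par i = N")
              case True
              then have "i \<notin> ?od ` {..<?t}"
                using par0 iN by blast
              then have new: "i \<notin> ?o ` {..<?u}"
                unfolding I(2) by simp
              have im: "(?o(?u := i)) ` {..<Suc ?u} = insert i (?o ` {..<?u})"
                by (simp add: lessThan_Suc) (auto simp: fun_upd_def)
              have "inj_on (?o(?u := i)) {..<Suc ?u}"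
                using I(1) new by (auto simp: inj_on_def less_Suc_eq)
              moreover have "(?o(?u := i)) ` {..<Suc ?u} = ?od ` {..<?t} \<union> {v. v < Suc i \<and> ?par v = N}"
                unfolding im I(2) using True by (auto simp: less_Suc_eq)
              ultimately show ?thesis
                using I(3,4) True 5(3) fr by (intro run_straight) simp_all
            next
              case False
              then have "{v. v < Suc i \<and> ?par v = N} = {v. v < i \<and> ?par v = N}"
                by (auto simp: less_Suc_eq)
              then show ?thesis
                using I False 5(3) fr by (intro run_straight) simp_all
            qed
          next
            case (7 s')
            have "arrs s' [p, CHR ''p''] = ?par"
              using 7(1) by (simp add: frame_def)
            then show ?case
              using elim_rooted[OF inv, of "arrs s' [p, CHR ''o'']" "regs s' ''t''"] 7(3) nn4 by simp
          qed (use nn4 in simp_all)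
          show ?case
            by (rule run_seq[OF l4[unfolded seqs.simps]]) (auto intro!: run_straight)
        qed simp
      qed simp
    qed simp
  qed simp
qed

section \<open>Statuses and identification numbers of classes\<close>

definition load_colors :: com where
  "load_colors = For ''i'' ''k'' (seqs
    [Assign ''y'' (Load ''in'' (Plus (Reg ''mo'') (Reg ''i''))),
     Assign ''sum'' (Plus (Reg ''sum'') (Reg ''y'')),
     Store ''M'' (Plus (Reg ''n'') (Reg ''i'')) (Reg ''y''),
     If (Less (Reg ''mx'') (Reg ''y'')) (Assign ''mx'' (Reg ''y'')) Skip])"

lemma load_colors:
  assumes z: "regs s ''sum'' = 0" "regs s ''mx'' = 0" "arrs s ''M'' = (\<lambda>_. 0)"
    and r: "regs s ''k'' = k" "regs s ''n'' = n"
    and h: "\<And>i. i < k \<Longrightarrow> arrs s ''in'' (regs s ''mo'' + i) = h i"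
  shows "run load_colors s (6 + k * 40) (\<lambda>s'. regs s' ''sum'' = (\<Sum>i<k. h i) \<and>
    arrs s' ''M'' = (\<lambda>x. if n \<le> x \<and> x < n + k then h (x - n) else 0) \<and>
    (\<forall>i<k. h i \<le> regs s' ''mx'') \<and> (regs s' ''mx'' = 0 \<or> (\<exists>i<k. regs s' ''mx'' = h i)))"
  unfolding load_colors_def
proof (rule run_for[where B = 32 and I = "\<lambda>i s'. regs s' ''sum'' = (\<Sum>i<i. h i) \<and>
    arrs s' ''M'' = (\<lambda>x. if n \<le> x \<and> x < n + i then h (x - n) else 0) \<and>
    (\<forall>j<i. h j \<le> regs s' ''mx'') \<and> (regs s' ''mx'' = 0 \<or> (\<exists>j<i. regs s' ''mx'' = h j))"], goal_cases)
  case 4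
  show ?case
    using z by (auto simp: fun_eq_iff)
next
  case (5 i s')
  have pres: "arrs s' ''in'' = arrs s ''in''" "regs s' ''mo'' = regs s ''mo''" "regs s' ''n'' = n"
    using 5(1) r by (simp_all add: frame_def)
  have hi: "arrs s ''in'' (regs s ''mo'' + i) = h i"
    using h 5(2) r by simp
  show ?case
    using 5(4) 5(3) pres hi
    by (intro run_straight) (auto simp: fun_eq_iff less_Suc_eq)
qed (use r in auto)

text \<open>Children come first in the order, so both counters of a node are final when the node is
  visited. Roots report to the dummy at index \<open>N\<close>.\<close>

definition compute_status :: com where
  "compute_status = For ''i'' ''N'' (seqs
    [Assign ''x'' (Load ''Ho'' (Reg ''i'')),
     Assign ''y'' (Load ''Hp'' (Reg ''x'')),
     If (Less (Reg ''x'') (Reg ''n''))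
       (If (Equal (Load ''q'' (Reg ''x'')) (Const 0))
         (Store ''A'' (Reg ''y'') (Plus (Load ''A'' (Reg ''y'')) (Const 1))) Skip)
       (If (Less (Load ''A'' (Reg ''x'')) (Load ''M'' (Reg ''x'')))
         (Store ''q'' (Reg ''y'') (Plus (Load ''q'' (Reg ''y'')) (Const 1))) Skip)])"

definition status_inv :: "nat \<Rightarrow> (nat \<Rightarrow> nat) \<Rightarrow> (nat \<Rightarrow> nat) \<Rightarrow> nat set \<Rightarrow> (nat \<Rightarrow> nat) \<Rightarrow> (nat \<Rightarrow> nat) \<Rightarrow> bool" where
  "status_inv n P M X q a \<longleftrightarrow> (\<forall>y. q y = card {c \<in> X. n \<le> c \<and> P c = y \<and> a c < M c}) \<and>
     (\<forall>y. a y = card {v \<in> X. v < n \<and> P v = y \<and> q v = 0})"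

text \<open>Only the counter of \<open>P x\<close> changes, and \<open>P x\<close> is not in the
  processed set \<open>X\<close>, so no comparison made earlier is revised.\<close>

lemma status_inv_vertex:
  assumes inv: "status_inv n P M X q a" and x: "x < n" "x \<notin> X" "P x \<noteq> x" "P x \<notin> X" and X: "finite X"
  shows "q x = 0 \<Longrightarrow> status_inv n P M (insert x X) q (a(P x := a (P x) + 1))"
    and "q x \<noteq> 0 \<Longrightarrow> status_inv n P M (insert x X) q a"
proof -
  have q: "q y = card {c \<in> X. n \<le> c \<and> P c = y \<and> a c < M c}"
    and a: "a y = card {v \<in> X. v < n \<and> P v = y \<and> q v = 0}" for y
    using inv[unfolded status_inv_def] by blast+
  have 1: "{c \<in> insert x X. n \<le> c \<and> P c = y \<and> a' c < M c} = {c \<in> X. n \<le> c \<and> P c = y \<and> a c < M c}"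
    if a': "\<And>c. c \<noteq> P x \<Longrightarrow> a' c = a c" for y a'
  proof (rule Collect_cong)
    fix c
    show "c \<in> insert x X \<and> n \<le> c \<and> P c = y \<and> a' c < M c \<longleftrightarrow> c \<in> X \<and> n \<le> c \<and> P c = y \<and> a c < M c"
      using a'[of c] x by (cases "c = x"; cases "c = P x") auto
  qed
  have 2: "card {v \<in> insert x X. v < n \<and> P v = y \<and> q v = 0} =
    (if P x = y \<and> q x = 0 then a y + 1 else a y)" for y
  proof (cases "P x = y \<and> q x = 0")
    case True
    then have "{v \<in> insert x X. v < n \<and> P v = y \<and> q v = 0} = insert x {v \<in> X. v < n \<and> P v = y \<and> q v = 0}"
      using x(1) by auto
    then show ?thesis
      using True x(2) X a[of y] by simp
  next
    case False
    then have "{v \<in> insert x X. v < n \<and> P v = y \<and> q v = 0} = {v \<in> X. v < n \<and> P v = y \<and> q v = 0}"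
      by auto
    then show ?thesis
      using False a[of y] by auto
  qed
  have main: "status_inv n P M (insert x X) q a'"
    if "\<And>c. c \<noteq> P x \<Longrightarrow> a' c = a c" "\<And>y. a' y = (if P x = y \<and> q x = 0 then a y + 1 else a y)" for a'
    unfolding status_inv_def 2
  proof (intro conjI allI)
    fix y
    have "{c \<in> insert x X. n \<le> c \<and> P c = y \<and> a' c < M c} = {c \<in> X. n \<le> c \<and> P c = y \<and> a c < M c}"
      by (rule 1) (rule that(1))
    then show "q y = card {c \<in> insert x X. n \<le> c \<and> P c = y \<and> a' c < M c}"
      using q[of y] by (simp only:)
    show "a' y = (if P x = y \<and> q x = 0 then a y + 1 else a y)"
      by (rule that(2))
  qed
  show "q x = 0 \<Longrightarrow> status_inv n P M (insert x X) q (a(P x := a (P x) + 1))"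
    by (rule main) auto
  show "q x \<noteq> 0 \<Longrightarrow> status_inv n P M (insert x X) q a"
    by (rule main) auto
qed

lemma status_inv_color:
  assumes inv: "status_inv n P M X q a" and x: "n \<le> x" "x \<notin> X" "P x \<noteq> x" "P x \<notin> X" and X: "finite X"
  shows "a x < M x \<Longrightarrow> status_inv n P M (insert x X) (q(P x := q (P x) + 1)) a"
    and "\<not> a x < M x \<Longrightarrow> status_inv n P M (insert x X) q a"
proof -
  have q: "q y = card {c \<in> X. n \<le> c \<and> P c = y \<and> a c < M c}"
    and a: "a y = card {v \<in> X. v < n \<and> P v = y \<and> q v = 0}" for y
    using inv[unfolded status_inv_def] by blast+
  have 1: "{c \<in> insert x X. c < n \<and> P c = y \<and> q' c = 0} = {c \<in> X. c < n \<and> P c = y \<and> q c = 0}"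
    if q': "\<And>c. c \<noteq> P x \<Longrightarrow> q' c = q c" for y q'
  proof (rule Collect_cong)
    fix c
    show "c \<in> insert x X \<and> c < n \<and> P c = y \<and> q' c = 0 \<longleftrightarrow> c \<in> X \<and> c < n \<and> P c = y \<and> q c = 0"
      using q'[of c] x by (cases "c = x"; cases "c = P x") auto
  qed
  have 2: "card {v \<in> insert x X. n \<le> v \<and> P v = y \<and> a v < M v} =
    (if P x = y \<and> a x < M x then q y + 1 else q y)" for y
  proof (cases "P x = y \<and> a x < M x")
    case True
    then have "{v \<in> insert x X. n \<le> v \<and> P v = y \<and> a v < M v} = insert x {v \<in> X. n \<le> v \<and> P v = y \<and> a v < M v}"
      using x(1) by auto
    then show ?thesis
      using True x(2) X q[of y] by simp
  next
    case False
    then have "{v \<in> insert x X. n \<le> v \<and> P v = y \<and> a v < M v} = {v \<in> X. n \<le> v \<and> P v = y \<and> a v < M v}"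
      by auto
    then show ?thesis
      using False q[of y] by auto
  qed
  have main: "status_inv n P M (insert x X) q' a"
    if "\<And>c. c \<noteq> P x \<Longrightarrow> q' c = q c" "\<And>y. q' y = (if P x = y \<and> a x < M x then q y + 1 else q y)" for q'
    unfolding status_inv_def 2
  proof (intro conjI allI)
    fix y
    have "{c \<in> insert x X. c < n \<and> P c = y \<and> q' c = 0} = {c \<in> X. c < n \<and> P c = y \<and> q c = 0}"
      by (rule 1) (rule that(1))
    then show "a y = card {c \<in> insert x X. c < n \<and> P c = y \<and> q' c = 0}"
      using a[of y] by (simp only:)
    show "q' y = (if P x = y \<and> a x < M x then q y + 1 else q y)"
      by (rule that(2))
  qed
  show "a x < M x \<Longrightarrow> status_inv n P M (insert x X) (q(P x := q (P x) + 1)) a"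
    by (rule main) auto
  show "\<not> a x < M x \<Longrightarrow> status_inv n P M (insert x X) q a"
    by (rule main) auto
qed

lemma (in vcforest) status_inv_all:
  "status_inv n P M {..<N} q a \<Longrightarrow> status q a"
  unfolding status_inv_def status_def
proof (intro conjI allI impI; elim conjE)
  fix y assume "\<forall>y. q y = card {c \<in> {..<N}. n \<le> c \<and> P c = y \<and> a c < M c}"
  moreover have "{c \<in> {..<N}. n \<le> c \<and> P c = y \<and> a c < M c} = {c \<in> cc y. a c < M c}"
    by (auto simp: cc_def)
  ultimately show "q y = card {c \<in> cc y. a c < M c}"
    by simp
next
  fix c assume "\<forall>y. a y = card {v \<in> {..<N}. v < n \<and> P v = y \<and> q v = 0}"
  moreover have "{v \<in> {..<N}. v < n \<and> P v = c \<and> q v = 0} = {v \<in> vc c. q v = 0}"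
    using nN by (auto simp: vc_def)
  ultimately show "a c = card {v \<in> vc c. q v = 0}"
    by simp
qed

lemma (in vcforest) compute_status:
  assumes z: "arrs s ''q'' = (\<lambda>_. 0)" "arrs s ''A'' = (\<lambda>_. 0)"
    and r: "regs s ''n'' = n" "regs s ''N'' = N"
    and a: "arrs s ''Hp'' = P" "arrs s ''Ho'' = od" "arrs s ''M'' = M"
  shows "run compute_status s (6 + N * 50) (\<lambda>s'. status (arrs s' ''q'') (arrs s' ''A''))"
  unfolding compute_status_def
proof (rule run_for[where B = 42 and I = "\<lambda>i s'. status_inv n P M (od ` {..<i}) (arrs s' ''q'') (arrs s' ''A'')"], goal_cases)
  case 4
  show ?case
    using z by (simp add: status_inv_def)
next
  case (5 i s')
  have pres: "arrs s' ''Hp'' = P" "arrs s' ''Ho'' = od" "arrs s' ''M'' = M" "regs s' ''n'' = n"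
    using 5(1) r a by (simp_all add: frame_def)
  let ?x = "od i"
  have iN: "i < N"
    using 5(2) r by simp
  have xN: "?x < N"
    using O_less[OF rt iN] .
  have new: "?x \<notin> od ` {..<i}"
  proof
    assume "?x \<in> od ` {..<i}"
    then obtain j where "j < i" "od j = ?x"
      by force
    then show False
      using rank_O[OF rt iN] rank_O[OF rt, of j] iN by simp
  qed
  have newP: "P ?x \<notin> od ` {..<i}"
  proof
    assume "P ?x \<in> od ` {..<i}"
    then obtain j where "j < i" "od j = P ?x"
      by force
    then show False
      using rank_parent[OF rt xN] rank_O[OF rt iN] rank_O[OF rt, of j] iN by simp
  qed
  have Px: "P ?x \<noteq> ?x"
    using rank_parent[OF rt xN] by auto
  have im: "od ` {..<Suc i} = insert ?x (od ` {..<i})"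
    by (simp add: lessThan_Suc)
  note v = status_inv_vertex[OF 5(4) _ new Px newP finite_imageI[OF finite_lessThan]]
  note c = status_inv_color[OF 5(4) _ new Px newP finite_imageI[OF finite_lessThan]]
  show ?case
    unfolding im
    using pres 5(3) v c by (intro run_straight) (auto simp: not_less)
next
  case (7 s')
  have "od ` {..<N} = {..<N}"
    using rt by (simp add: rooted_def bij_betw_def)
  then show ?case
    using 7(3) r status_inv_all by simp
qed (use r in auto)

text \<open>\<open>bad\<close> collects violations of \<open>feasible\<close>. The last loop runs
  over \<open>k + 1\<close> indices, because the dummy owns classes too.\<close>

definition compute_first :: com where
  "compute_first = seqs
    [Assign ''bad'' (Load ''q'' (Reg ''N'')),
     For ''i'' ''n'' (If (Less (Const 1) (Load ''q'' (Reg ''i''))) (Assign ''bad'' (Const 1)) Skip),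
     For ''i'' ''k'' (If (Less (Plus (Load ''A'' (Plus (Reg ''n'') (Reg ''i''))) (Const 1)) (Load ''M'' (Plus (Reg ''n'') (Reg ''i''))))
       (Assign ''bad'' (Const 1)) Skip),
     Assign ''k1'' (Plus (Reg ''k'') (Const 1)),
     Assign ''t'' (Const 0),
     For ''i'' ''k1'' (seqs
       [Assign ''x'' (Plus (Reg ''n'') (Reg ''i'')),
        Store ''fi'' (Reg ''x'') (Reg ''t''),
        Assign ''t'' (Plus (Reg ''t'') (Minus (Load ''A'' (Reg ''x'')) (Load ''M'' (Reg ''x'')))),
        Store ''en'' (Reg ''x'') (Reg ''t'')])]"

lemma (in vcforest) compute_first:
  assumes r: "regs s ''n'' = n" "regs s ''N'' = N" "regs s ''k'' = k" and N: "N = n + k"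
    and a: "arrs s ''q'' = q" "arrs s ''A'' = a" "arrs s ''M'' = M"
  shows "run compute_first s (100 + n * 20 + k * 80) (\<lambda>s'. (regs s' ''bad'' = 0 \<longleftrightarrow> feasible q a) \<and>
    regs s' ''k1'' = k + 1 \<and>
    (\<forall>c. n \<le> c \<and> c \<le> N \<longrightarrow> arrs s' ''fi'' c = first a c \<and> arrs s' ''en'' c = first a (Suc c)))"
  unfolding compute_first_def seqs.simps
proof (rule run_seq[where T = 10 and Q = "\<lambda>s'. s' = set_reg s ''bad'' (q N)" and U = "90 + n * 20 + k * 80"], goal_cases)
  case 1
  show ?case
    using r a by (intro run_straight) simp_all
next
  case (2 s1)
  have s1: "regs s1 ''n'' = n" "regs s1 ''N'' = N" "regs s1 ''k'' = k" "arrs s1 ''q'' = q" "arrs s1 ''A'' = a" "arrs s1 ''M'' = M"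
    "regs s1 ''bad'' = q N"
    using 2(2) r a by simp_all
  have l2: "run (For ''i'' ''n'' (If (Less (Const 1) (Load ''q'' (Reg ''i''))) (Assign ''bad'' (Const 1)) Skip)) s1 (6 + n * 20)
    (\<lambda>s'. regs s' ''bad'' = 0 \<longleftrightarrow> q N = 0 \<and> (\<forall>v<n. q v \<le> 1))"
  proof (rule run_for[where B = 12 and I = "\<lambda>i s'. regs s' ''bad'' = 0 \<longleftrightarrow> q N = 0 \<and> (\<forall>v<i. q v \<le> 1)"], goal_cases)
    case (5 i s')
    have "arrs s' ''q'' = q"
      using 5(1) s1 by (simp add: frame_def)
    then show ?case
      using 5(3,4) by (intro run_straight) (auto simp: less_Suc_eq not_less)
  qed (use s1 in auto)
  show ?case
  proof (rule run_seq[OF l2, where U = "80 + k * 80"], goal_cases)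
    case (1 s2)
    have s2: "regs s2 ''n'' = n" "regs s2 ''N'' = N" "regs s2 ''k'' = k" "arrs s2 ''q'' = q" "arrs s2 ''A'' = a" "arrs s2 ''M'' = M"
      using 1 s1 by (simp_all add: frame_def)
    have l3: "run (For ''i'' ''k'' (If (Less (Plus (Load ''A'' (Plus (Reg ''n'') (Reg ''i''))) (Const 1)) (Load ''M'' (Plus (Reg ''n'') (Reg ''i''))))
       (Assign ''bad'' (Const 1)) Skip)) s2 (6 + k * 30) (\<lambda>s'. regs s' ''bad'' = 0 \<longleftrightarrow> feasible q a)"
    proof (rule run_for[where B = 22 and I = "\<lambda>i s'. regs s' ''bad'' = 0 \<longleftrightarrow> q N = 0 \<and> (\<forall>v<n. q v \<le> 1) \<and>
        (\<forall>j<i. M (n + j) \<le> a (n + j) + 1)"], goal_cases)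
      case (5 i s')
      have "arrs s' ''A'' = a" "arrs s' ''M'' = M" "regs s' ''n'' = n"
        using 5(1) s2 by (simp_all add: frame_def)
      then show ?case
        using 5(3,4) by (intro run_straight) (auto simp: less_Suc_eq not_less)
    next
      case (7 s')
      have "(\<forall>j<k. M (n + j) \<le> a (n + j) + 1) \<longleftrightarrow> (\<forall>c. n \<le> c \<and> c < N \<longrightarrow> M c \<le> a c + 1)"
        unfolding N by (metis add_less_cancel_left le_Suc_ex le_add1)
      then show ?case
        using 7(3) s2 by (auto simp: feasible_def)
    qed (use s2 1 in auto)
    show ?case
    proof (rule run_seq[OF l3, where U = "70 + k * 50"], goal_cases)
      case (1 s3)
      show ?case
      proof (rule run_seq[where T = 10 and Q = "\<lambda>s'. s' = set_reg s3 ''k1'' (regs s3 ''k'' + 1)" and U = "60 + k * 50"], goal_cases)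
        case 1
        show ?case
          by (intro run_straight) simp_all
      next
        case s4: (2 s4)
        show ?case
        proof (rule run_seq[where T = 10 and Q = "\<lambda>s'. s' = set_reg s4 ''t'' 0" and U = "50 + k * 50"], goal_cases)
          case 1
          show ?case
            by (intro run_straight) simp_all
        next
          case (2 s5)
          have s5: "regs s5 ''n'' = n" "regs s5 ''k1'' = k + 1" "arrs s5 ''A'' = a" "arrs s5 ''M'' = M" "regs s5 ''t'' = 0"
            "regs s5 ''bad'' = 0 \<longleftrightarrow> feasible q a"
            using 1 2(2) s4(2) s2 by (simp_all add: frame_def)
          have l6: "run (For ''i'' ''k1'' (seqs
       [Assign ''x'' (Plus (Reg ''n'') (Reg ''i'')),
        Store ''fi'' (Reg ''x'') (Reg ''t''),
        Assign ''t'' (Plus (Reg ''t'') (Minus (Load ''A'' (Reg ''x'')) (Load ''M'' (Reg ''x'')))),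
        Store ''en'' (Reg ''x'') (Reg ''t'')])) s5 (6 + (k + 1) * 40)
            (\<lambda>s'. (regs s' ''bad'' = 0 \<longleftrightarrow> feasible q a) \<and> regs s' ''k1'' = k + 1 \<and>
    (\<forall>c. n \<le> c \<and> c \<le> N \<longrightarrow> arrs s' ''fi'' c = first a c \<and> arrs s' ''en'' c = first a (Suc c)))"
          proof (rule run_for[where B = 32 and I = "\<lambda>i s'. regs s' ''t'' = first a (n + i) \<and>
            (\<forall>c. n \<le> c \<and> c < n + i \<longrightarrow> arrs s' ''fi'' c = first a c \<and> arrs s' ''en'' c = first a (Suc c))"], goal_cases)
            case 4
            show ?case
              using s5 by (simp add: first_def)
          next
            case (5 i s')
            have "arrs s' ''A'' = a" "arrs s' ''M'' = M" "regs s' ''n'' = n"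
              using 5(1) s5 by (simp_all add: frame_def)
            then show ?case
              using 5(3,4) first_Suc[of "n + i" a] by (intro run_straight) (auto simp: less_Suc_eq)
          next
            case (7 s')
            have "regs s' ''bad'' = regs s5 ''bad''" "regs s' ''k1'' = regs s5 ''k1''"
              using 7(1) by (simp_all add: frame_def)
            then show ?case
              using 7(3) s5 by (auto simp: N)
          qed (use s5 in auto)
          show ?case
            by (rule run_seq[OF l6[unfolded seqs.simps]]) (auto intro!: run_straight)
        qed simp
      qed simp
    qed simp
  qed simp
qed simp

text \<open>The machine can only add: powers of two arise by doubling, and the factor
  \<open>l + 1\<close> of the target by adding \<open>2 ^ l\<close> once more for each
  class.\<close>

definition compute_weights :: com where
  "compute_weights = seqs
    [Assign ''p'' (Const 1),
     For ''i'' ''l'' (seqs [Store ''e'' (Reg ''i'') (Reg ''p''), Assign ''p'' (Plus (Reg ''p'') (Reg ''p''))]),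
     Assign ''T'' (Reg ''p''),
     For ''i'' ''l'' (seqs
       [Store ''w'' (Plus (Reg ''i'') (Const 1)) (Plus (Reg ''p'') (Load ''e'' (Reg ''i''))),
        Assign ''T'' (Plus (Reg ''T'') (Reg ''p''))]),
     Store ''w'' (Const 0) (Reg ''T'')]"

lemma compute_weights:
  assumes r: "regs s ''l'' = l"
  shows "run compute_weights s (60 + l * 60) (\<lambda>s'. regs s' ''T'' = (l + 1) * 2 ^ l \<and>
    (\<forall>j\<le>l. arrs s' ''w'' j = weight l j))"
  unfolding compute_weights_def seqs.simps
proof (rule run_seq[where T = 4 and Q = "\<lambda>s'. s' = set_reg s ''p'' 1" and U = "50 + l * 60"], goal_cases)
  case 1
  show ?case
    by (intro run_straight) simp_all
next
  case (2 s1)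
  have s1: "regs s1 ''l'' = l" "regs s1 ''p'' = 1"
    using 2(2) r by simp_all
  have l2: "run (For ''i'' ''l'' (seqs [Store ''e'' (Reg ''i'') (Reg ''p''), Assign ''p'' (Plus (Reg ''p'') (Reg ''p''))])) s1 (6 + l * 20)
    (\<lambda>s'. regs s' ''p'' = 2 ^ l \<and> (\<forall>j<l. arrs s' ''e'' j = 2 ^ j))"
    by (rule run_for[where B = 12 and I = "\<lambda>i s'. regs s' ''p'' = 2 ^ i \<and> (\<forall>j<i. arrs s' ''e'' j = 2 ^ j)"])
      (use s1 in \<open>auto intro!: run_straight simp: less_Suc_eq\<close>)
  show ?case
  proof (rule run_seq[OF l2[unfolded seqs.simps], where U = "44 + l * 40"], goal_cases)
    case (1 s2)
    show ?case
    proof (rule run_seq[where T = 4 and Q = "\<lambda>s'. s' = set_reg s2 ''T'' (regs s2 ''p'')" and U = "40 + l * 40"], goal_cases)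
      case 1
      show ?case
        by (intro run_straight) simp_all
    next
      case (2 s3)
      have s3: "regs s3 ''l'' = l" "regs s3 ''p'' = 2 ^ l" "regs s3 ''T'' = 2 ^ l" "\<forall>j<l. arrs s3 ''e'' j = 2 ^ j"
        using 1 2(2) s1 by (simp_all add: frame_def)
      have l4: "run (For ''i'' ''l'' (seqs
       [Store ''w'' (Plus (Reg ''i'') (Const 1)) (Plus (Reg ''p'') (Load ''e'' (Reg ''i''))),
        Assign ''T'' (Plus (Reg ''T'') (Reg ''p''))])) s3 (6 + l * 30)
        (\<lambda>s'. regs s' ''T'' = (l + 1) * 2 ^ l \<and> (\<forall>j<l. arrs s' ''w'' (Suc j) = 2 ^ l + 2 ^ j))"
      proof (rule run_for[where B = 22 and I = "\<lambda>i s'. regs s' ''T'' = (i + 1) * 2 ^ l \<and>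
          (\<forall>j<i. arrs s' ''w'' (Suc j) = 2 ^ l + 2 ^ j)"], goal_cases)
        case (5 i s')
        have "regs s' ''p'' = 2 ^ l" "arrs s' ''e'' i = 2 ^ i"
          using 5(1,2) s3 by (simp_all add: frame_def)
        then show ?case
          using 5(3,4) by (intro run_straight) (auto simp: less_Suc_eq)
      qed (use s3 in auto)
      show ?case
      proof (rule run_seq[OF l4[unfolded seqs.simps], where U = 10], goal_cases)
        case (1 s4)
        have "arrs s4 ''w'' j = weight l j" if "0 < j" "j \<le> l" for j
          using 1(2) that by (cases j) (auto simp: weight_def)
        then show ?case
          using 1(2) by (intro run_straight) (auto simp: weight_def)
      qed simp
    qed simp
  qed simp
qed simp

section \<open>Testing one tape\<close>

text \<open>For a color, \<open>fi\<close> and \<open>en\<close> delimit its class numbers, \<open>cu\<close> is the next free one, and \<open>hc\<close> counts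
  the held children. For a vertex, \<open>cl\<close> is its own class (\<open>0\<close> if none was opened), \<open>lb\<close> the label and \<open>dn\<close>
  the weight of its subtree of \<open>G\<close>; \<open>tp\<close> is the tape and \<open>R\<close> the knapsack table.\<close>

definition assign_classes :: com where
  "assign_classes = seqs
    [For ''i'' ''k1'' (seqs
       [Assign ''x'' (Plus (Reg ''n'') (Reg ''i'')),
        Store ''cu'' (Reg ''x'') (Load ''fi'' (Reg ''x'')),
        Store ''hc'' (Reg ''x'') (Const 0)]),
     For ''i'' ''n'' (If (Equal (Load ''q'' (Reg ''i'')) (Const 0))
       (seqs
         [Assign ''c'' (Load ''Hp'' (Reg ''i'')),
          If (And (Less (Load ''cu'' (Reg ''c'')) (Load ''en'' (Reg ''c'')))
               (Equal (Load ''tp'' (Load ''cu'' (Reg ''c''))) (Load ''hc'' (Reg ''c''))))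
            (seqs
              [Store ''cu'' (Reg ''c'') (Plus (Load ''cu'' (Reg ''c'')) (Const 1)),
               Store ''cl'' (Reg ''i'') (Load ''cu'' (Reg ''c''))])
            (seqs
              [Store ''cl'' (Reg ''i'') (Const 0),
               Store ''hc'' (Reg ''c'') (Plus (Load ''hc'' (Reg ''c'')) (Const 1))])])
       Skip)]"

text \<open>The order is traversed backwards, so that the label of the parent is ready. The entry of
  the dummy is never written and keeps its initial 0.\<close>

definition compute_labels :: com where
  "compute_labels = For ''i'' ''N'' (seqs
    [Assign ''x'' (Load ''Ho'' (Minus (Minus (Reg ''N'') (Const 1)) (Reg ''i''))),
     If (And (Less (Reg ''x'') (Reg ''n'')) (Not (Equal (Load ''q'' (Reg ''x'')) (Const 0))))
       (Store ''lb'' (Reg ''x'') (Const 0))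
       (If (And (Less (Reg ''x'') (Reg ''n'')) (Not (Equal (Load ''cl'' (Reg ''x'')) (Const 0))))
         (Store ''lb'' (Reg ''x'') (Load ''cl'' (Reg ''x'')))
         (Store ''lb'' (Reg ''x'') (Load ''lb'' (Load ''Hp'' (Reg ''x'')))))])"

text \<open>The roots pass their sums on to index \<open>n\<close>, where the total weight appears;
  subtracting a subtree from it gives the branch of the upper kind.\<close>

definition compute_sums :: com where
  "compute_sums = seqs
    [Store ''dn'' (Reg ''n'') (Const 0),
     For ''i'' ''n'' (Store ''dn'' (Reg ''i'') (Load ''w'' (Load ''lb'' (Reg ''i'')))),
     For ''i'' ''n'' (seqs
       [Assign ''x'' (Load ''Go'' (Reg ''i'')),
        Assign ''y'' (Load ''Gp'' (Reg ''x'')),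
        Store ''dn'' (Reg ''y'') (Plus (Load ''dn'' (Reg ''y'')) (Load ''dn'' (Reg ''x'')))])]"

definition try_item :: com where
  "try_item = If (And (Not (Less (Reg ''z'') (Reg ''x'')))
      (Equal (Load ''R'' (Minus (Reg ''z'') (Reg ''x''))) (Const 1)))
    (Store ''R'' (Reg ''z'') (Const 1)) Skip"

definition compute_reach :: com where
  "compute_reach = For ''z'' ''T'' (seqs
    [If (Equal (Reg ''z'') (Const 0)) (Store ''R'' (Reg ''z'') (Const 1)) (Store ''R'' (Reg ''z'') (Const 0)),
     For ''i'' ''n'' (seqs
       [Assign ''x'' (Load ''dn'' (Reg ''i'')),
        try_item,
        Assign ''x'' (Minus (Load ''dn'' (Reg ''n'')) (Load ''dn'' (Reg ''i''))),
        try_item])])"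

section \<open>Correctness of the passes that test one tape\<close>

context vcforest
begin

text \<open>The count behind \<open>before\<close>, with color and bound set free: it describes the
  counters of all colors at any moment of the pass.\<close>

definition cnt :: "(nat \<Rightarrow> nat) \<Rightarrow> (nat \<Rightarrow> bool) \<Rightarrow> nat \<Rightarrow> nat \<Rightarrow> nat" where
  "cnt q Z c i = card {w \<in> vc c. w < i \<and> q w = 0 \<and> Z w}"

lemma before_cnt: "before q Z v = cnt q Z (P v) v"
  by (simp add: before_def cnt_def)

lemma cnt_0 [simp]: "cnt q Z c 0 = 0"
  by (simp add: cnt_def)

lemma cnt_cong: "(\<And>w. w < i \<Longrightarrow> Z w = Z' w) \<Longrightarrow> cnt q Z c i = cnt q Z' c i"
  unfolding cnt_def by (intro arg_cong[where f = card] Collect_cong) auto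

lemma cnt_Suc:
  assumes "i < n"
  shows "cnt q Z c (Suc i) = cnt q Z c i + (if P i = c \<and> q i = 0 \<and> Z i then 1 else 0)"
proof (cases "P i = c \<and> q i = 0 \<and> Z i")
  case True
  then have "{w \<in> vc c. w < Suc i \<and> q w = 0 \<and> Z w} = insert i {w \<in> vc c. w < i \<and> q w = 0 \<and> Z w}"
    using assms by (auto simp: vc_def less_Suc_eq)
  then show ?thesis
    using True by (simp add: cnt_def)
next
  case False
  then have "{w \<in> vc c. w < Suc i \<and> q w = 0 \<and> Z w} = {w \<in> vc c. w < i \<and> q w = 0 \<and> Z w}"
    by (auto simp: vc_def less_Suc_eq)
  then show ?thesis
    using False by (simp add: cnt_def)
qed

definition assign_inv where
  "assign_inv q a \<tau> i cu hc cls \<longleftrightarrow>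
    (\<forall>c. n \<le> c \<and> c \<le> N \<longrightarrow> cu c = first a c + cnt q (\<lambda>w. cls w \<noteq> 0) c i \<and> hc c = cnt q (\<lambda>w. cls w = 0) c i) \<and>
    (\<forall>v<i. q v = 0 \<longrightarrow> cls v =
     (if cnt q (\<lambda>w. cls w \<noteq> 0) (P v) v < a (P v) - M (P v) \<and>
         \<tau> (first a (P v) + cnt q (\<lambda>w. cls w \<noteq> 0) (P v) v) = cnt q (\<lambda>w. cls w = 0) (P v) v
      then first a (P v) + cnt q (\<lambda>w. cls w \<noteq> 0) (P v) v + 1 else 0))"

lemma assign_inv_skip:
  assumes inv: "assign_inv q a \<tau> i cu hc cls" and i: "i < n" "q i \<noteq> 0"
  shows "assign_inv q a \<tau> (Suc i) cu hc cls"
  using inv i unfolding assign_inv_def by (simp add: cnt_Suc less_Suc_eq)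

lemma assign_inv_step:
  assumes inv: "assign_inv q a \<tau> i cu hc cls" and i: "i < n" "q i = 0"
    and en: "en = first a (Suc (P i))"
  shows "cu (P i) < en \<Longrightarrow> \<tau> (cu (P i)) = hc (P i) \<Longrightarrow>
      assign_inv q a \<tau> (Suc i) (cu(P i := cu (P i) + 1)) hc (cls(i := cu (P i) + 1))"
    and "\<not> (cu (P i) < en \<and> \<tau> (cu (P i)) = hc (P i)) \<Longrightarrow>
      assign_inv q a \<tau> (Suc i) cu (hc(P i := hc (P i) + 1)) (cls(i := 0))"
proof -
  let ?b = "cnt q (\<lambda>w. cls w \<noteq> 0)" and ?h = "cnt q (\<lambda>w. cls w = 0)"
  have c: "n \<le> P i" "P i \<le> N"
    using vertex_parent i(1) by auto
  have cu: "cu c = first a c + ?b c i" "hc c = ?h c i" if "n \<le> c" "c \<le> N" for c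
    using inv that unfolding assign_inv_def by blast+
  have old: "cls v = (if ?b (P v) v < a (P v) - M (P v) \<and> \<tau> (first a (P v) + ?b (P v) v) = ?h (P v) v
      then first a (P v) + ?b (P v) v + 1 else 0)" if "v < i" "q v = 0" for v
    using inv that unfolding assign_inv_def by blast
  have main: "assign_inv q a \<tau> (Suc i) cu' hc' (cls(i := x))"
    if cu': "\<And>c. n \<le> c \<Longrightarrow> c \<le> N \<Longrightarrow> cu' c = cu c + (if P i = c \<and> x \<noteq> 0 then 1 else 0) \<and>
        hc' c = hc c + (if P i = c \<and> x = 0 then 1 else 0)"
      and x: "x = (if ?b (P i) i < a (P i) - M (P i) \<and> \<tau> (first a (P i) + ?b (P i) i) = ?h (P i) i
        then first a (P i) + ?b (P i) i + 1 else 0)" for cu' hc' x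
  proof -
    let ?cls = "cls(i := x)"
    \<comment> \<open>The counts at positions up to \<open>i\<close> look only at vertices below
      \<open>i\<close> and do not see the new value.\<close>
    have b: "cnt q (\<lambda>w. ?cls w \<noteq> 0) c j = ?b c j" "cnt q (\<lambda>w. ?cls w = 0) c j = ?h c j" if "j \<le> i" for c j
      using that by (intro cnt_cong; simp)+
    show ?thesis
      unfolding assign_inv_def
    proof (intro conjI allI impI; (elim conjE)?)
      fix c assume c: "n \<le> c" "c \<le> N"
      show "cu' c = first a c + cnt q (\<lambda>w. ?cls w \<noteq> 0) c (Suc i)" "hc' c = cnt q (\<lambda>w. ?cls w = 0) c (Suc i)"
      proof -
        have "cnt q (\<lambda>w. ?cls w \<noteq> 0) c (Suc i) = ?b c i + (if P i = c \<and> x \<noteq> 0 then 1 else 0)"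
          "cnt q (\<lambda>w. ?cls w = 0) c (Suc i) = ?h c i + (if P i = c \<and> x = 0 then 1 else 0)"
          unfolding cnt_Suc[OF i(1)] b[OF order.refl] using i(2) by simp_all
        then show "cu' c = first a c + cnt q (\<lambda>w. ?cls w \<noteq> 0) c (Suc i)" "hc' c = cnt q (\<lambda>w. ?cls w = 0) c (Suc i)"
          using cu'[OF c] cu[OF c] by (simp_all only: add.assoc)
      qed
    next
      fix v assume v: "v < Suc i" "q v = 0"
      show "?cls v = (if cnt q (\<lambda>w. ?cls w \<noteq> 0) (P v) v < a (P v) - M (P v) \<and>
         \<tau> (first a (P v) + cnt q (\<lambda>w. ?cls w \<noteq> 0) (P v) v) = cnt q (\<lambda>w. ?cls w = 0) (P v) v
        then first a (P v) + cnt q (\<lambda>w. ?cls w \<noteq> 0) (P v) v + 1 else 0)"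
      proof (cases "v = i")
        case True
        then show ?thesis
          unfolding True b[OF order.refl] using x by simp
      next
        case False
        then have "v < i"
          using v by simp
        then show ?thesis
          unfolding b[OF less_imp_le[OF \<open>v < i\<close>]]
          using old[OF \<open>v < i\<close> v(2)] False by (simp only: fun_upd_apply if_False)
      qed
    qed
  qed
  have en': "cu (P i) < en \<longleftrightarrow> ?b (P i) i < a (P i) - M (P i)"
    using cu[OF c] first_Suc[OF c(1), of a] en by simp
  show "cu (P i) < en \<Longrightarrow> \<tau> (cu (P i)) = hc (P i) \<Longrightarrow>
      assign_inv q a \<tau> (Suc i) (cu(P i := cu (P i) + 1)) hc (cls(i := cu (P i) + 1))"
    by (rule main) (use cu[OF c] en' in auto)
  show "\<not> (cu (P i) < en \<and> \<tau> (cu (P i)) = hc (P i)) \<Longrightarrow>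
      assign_inv q a \<tau> (Suc i) cu (hc(P i := hc (P i) + 1)) (cls(i := 0))"
    by (rule main) (use cu[OF c] en' in auto)
qed

lemma assign_classes:
  assumes r: "regs s ''n'' = n" "regs s ''k1'' = k + 1" and N: "N = n + k"
    and a: "arrs s ''q'' = q" "arrs s ''Hp'' = P"
    and fi: "\<And>c. n \<le> c \<Longrightarrow> c \<le> N \<Longrightarrow> arrs s ''fi'' c = first a c \<and> arrs s ''en'' c = first a (Suc c)"
  shows "run assign_classes s (50 + k * 30 + n * 60) (\<lambda>s'. assigned q a (arrs s ''tp'') (arrs s' ''cl''))"
proof -
  have l1: "run (For ''i'' ''k1'' (seqs
       [Assign ''x'' (Plus (Reg ''n'') (Reg ''i'')),
        Store ''cu'' (Reg ''x'') (Load ''fi'' (Reg ''x'')),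
        Store ''hc'' (Reg ''x'') (Const 0)])) s (6 + (k + 1) * 30)
     (\<lambda>s'. \<forall>c. n \<le> c \<and> c \<le> N \<longrightarrow> arrs s' ''cu'' c = first a c \<and> arrs s' ''hc'' c = 0)"
  proof (rule run_for[where B = 22 and I = "\<lambda>i s'. \<forall>c. n \<le> c \<and> c < n + i \<longrightarrow> arrs s' ''cu'' c = first a c \<and> arrs s' ''hc'' c = 0"], goal_cases)
    case (5 i s')
    have "arrs s' ''fi'' = arrs s ''fi''" "regs s' ''n'' = n"
      using 5(1) r by (simp_all add: frame_def)
    moreover have "arrs s ''fi'' (n + i) = first a (n + i)"
      using fi[of "n + i"] 5(2) r N by simp
    ultimately show ?case
      using 5(3,4) by (intro run_straight) (auto simp: less_Suc_eq)
  qed (use r N in auto)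
  show ?thesis
    unfolding assign_classes_def seqs.simps
  proof (rule run_seq[OF l1[unfolded seqs.simps], where U = "10 + n * 60"], goal_cases)
    case (1 s1)
    have s1: "regs s1 ''n'' = n" "arrs s1 ''q'' = q" "arrs s1 ''Hp'' = P" "arrs s1 ''tp'' = arrs s ''tp''"
      "arrs s1 ''en'' = arrs s ''en''"
      using 1(1) r a by (simp_all add: frame_def)
    show ?case
    proof (rule run_seq[where T = "6 + n * 60" and U = 2], rule run_for[where B = 52 and I = "\<lambda>i s'. assign_inv q a (arrs s ''tp'') i (arrs s' ''cu'') (arrs s' ''hc'') (arrs s' ''cl'')"], goal_cases)
      case 4
      show ?case
        using 1(2) by (simp add: assign_inv_def)
    next
      case (5 i s')
      have s': "arrs s' ''q'' = q" "arrs s' ''Hp'' = P" "arrs s' ''tp'' = arrs s ''tp''" "arrs s' ''en'' = arrs s ''en''"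
        using 5(1) s1 by (simp_all add: frame_def)
      have i: "i < n"
        using 5(2) s1 by simp
      have en: "arrs s ''en'' (P i) = first a (Suc (P i))"
        using fi[of "P i"] vertex_parent[OF i] by simp
      show ?case
        using assign_inv_skip[OF 5(4) i] assign_inv_step[OF 5(4) i _ en] s' 5(3)
        by (intro run_straight) auto
    next
      case (7 s')
      show "assigned q a (arrs s ''tp'') (arrs s' ''cl'')"
        using 7(3) unfolding s1(1) assign_inv_def assigned_def before_cnt by (elim conjE)
    qed (use s1 in \<open>auto intro: run_straight\<close>)
  qed simp
qed

definition label_inv where
  "label_inv q cls i lb \<longleftrightarrow> lb N = 0 \<and> (\<forall>x<N. N - i \<le> rank N od x \<longrightarrow> lb x =
     (if x < n \<and> q x \<noteq> 0 then 0 else if x < n \<and> cls x \<noteq> 0 then cls x else lb (P x)))"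

lemma label_inv_step:
  assumes inv: "label_inv q cls i lb" and i: "i < N" and x: "x = od (N - Suc i)"
  shows "label_inv q cls (Suc i) (lb(x :=
    if x < n \<and> q x \<noteq> 0 then 0 else if x < n \<and> cls x \<noteq> 0 then cls x else lb (P x)))"
    (is "label_inv q cls (Suc i) ?lb")
proof -
  have x: "x < N" "rank N od x = N - Suc i"
    using O_less[OF rt, of "N - Suc i"] rank_O[OF rt, of "N - Suc i"] i by (simp_all add: x)
  have Px: "P x \<noteq> x"
    using rank_parent[OF rt x(1)] by auto
  have lb: "lb N = 0" and old: "\<And>y. y < N \<Longrightarrow> N - i \<le> rank N od y \<Longrightarrow> lb y =
     (if y < n \<and> q y \<noteq> 0 then 0 else if y < n \<and> cls y \<noteq> 0 then cls y else lb (P y))"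
    using inv unfolding label_inv_def by blast+
  show ?thesis
    unfolding label_inv_def
  proof (intro conjI allI impI)
    show "?lb N = 0"
      using lb x by simp
    fix y assume y: "y < N" "N - Suc i \<le> rank N od y"
    show "?lb y = (if y < n \<and> q y \<noteq> 0 then 0 else if y < n \<and> cls y \<noteq> 0 then cls y else ?lb (P y))"
    proof (cases "y = x")
      case True
      then show ?thesis
        using Px by simp
    next
      case False
      have "rank N od y \<noteq> rank N od x"
        using O_rank[OF rt y(1)] O_rank[OF rt x(1)] False by metis
      then have ge: "N - i \<le> rank N od y"
        using y(2) x(2) i by simp
      have "P y \<noteq> x"
        using rank_parent[OF rt y(1)] ge x(2) i by auto
      then show ?thesis
        using old[OF y(1) ge] False by simp
    qed
  qed
qed

lemma compute_labels:
  assumes r: "regs s ''n'' = n" "regs s ''N'' = N"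
    and a: "arrs s ''q'' = q" "arrs s ''Hp'' = P" "arrs s ''Ho'' = od" "arrs s ''cl'' = cls" and z: "arrs s ''lb'' N = 0"
  shows "run compute_labels s (6 + N * 60) (\<lambda>s'. labelled q cls (arrs s' ''lb''))"
  unfolding compute_labels_def
proof (rule run_for[where B = 52 and I = "\<lambda>i s'. label_inv q cls i (arrs s' ''lb'')"], goal_cases)
  case 4
  have "\<not> N \<le> rank N od x" if "x < N" for x
    using rank_less[OF rt that] by simp
  then show ?case
    using z by (simp add: label_inv_def)
next
  case (5 i s')
  have pres: "arrs s' ''q'' = q" "arrs s' ''Hp'' = P" "arrs s' ''Ho'' = od" "arrs s' ''cl'' = cls" "regs s' ''n'' = n" "regs s' ''N'' = N"
    using 5(1) r a by (simp_all add: frame_def)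
  have i: "i < N"
    using 5(2) r by simp
  show ?case
    using label_inv_step[OF 5(4) i refl] pres 5(3)
    by (intro run_straight) (auto split: if_splits)
next
  case (7 s')
  then show ?case
    using r by (simp add: labelled_def label_inv_def)
qed (use r in auto)

end

text \<open>Every chain of parents ends at the dummy; this makes the entry at \<open>n\<close> the
  sum over all vertices.\<close>

lemma sub_dummy:
  assumes rt: "rooted n E P od"
  shows "sub n P n = {..n}"
proof (intro equalityI subsetI)
  fix x assume "x \<in> {..n}"
  then show "x \<in> sub n P n"
  proof (induction "n - rank n od x" arbitrary: x rule: less_induct)
    case less
    show ?case
    proof (cases "x = n")
      case False
      then have x: "x < n"
        using less.prems by simp
      have "n - rank n od (P x) < n - rank n od x"
        using rank_parent[OF rt x] rank_less[OF rt x] by (auto intro!: diff_less_mono2)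
      then have "P x \<in> sub n P n"
        using less.hyps parent_le[OF rt x] by simp
      then show ?thesis
        using desc_step[of "\<lambda>y. y < n" x x P] x desc_trans[of x _ P "P x" n] by simp
    qed simp
  qed
next
  fix x assume "x \<in> sub n P n"
  then show "x \<in> {..n}"
    using desc_up[of x _ P n] by fastforce
qed

lemma compute_sums:
  assumes rt: "rooted n E P od" and r: "regs s ''n'' = n"
    and a: "arrs s ''Gp'' = P" "arrs s ''Go'' = od" and W: "\<And>v. v < n \<Longrightarrow> arrs s ''w'' (arrs s ''lb'' v) = W v"
  shows "run compute_sums s (20 + n * 50) (\<lambda>s'. (\<forall>v<n. arrs s' ''dn'' v = sum W (sub n P v)) \<and> arrs s' ''dn'' n = sum W {..<n})"
  unfolding compute_sums_def seqs.simps
proof (rule run_seq[where T = 3 and Q = "\<lambda>s'. s' = s\<lparr>arrs := (arrs s)(''dn'' := (arrs s ''dn'')(n := 0))\<rparr>" and U = "16 + n * 50"], goal_cases)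
  case 1
  show ?case
    using r by (intro run_straight) simp_all
next
  case (2 s1)
  have s1: "regs s1 ''n'' = n" "arrs s1 ''Gp'' = P" "arrs s1 ''Go'' = od" "arrs s1 ''w'' = arrs s ''w''" "arrs s1 ''lb'' = arrs s ''lb''"
    "arrs s1 ''dn'' n = 0"
    using 2(2) r a by simp_all
  let ?g = "\<lambda>y. if y < n then W y else 0"
  have l2: "run (For ''i'' ''n'' (Store ''dn'' (Reg ''i'') (Load ''w'' (Load ''lb'' (Reg ''i''))))) s1 (6 + n * 15)
    (\<lambda>s'. \<forall>y\<le>n. arrs s' ''dn'' y = ?g y)"
  proof (rule run_for[where B = 7 and I = "\<lambda>i s'. arrs s' ''dn'' n = 0 \<and> (\<forall>y<i. arrs s' ''dn'' y = W y)"], goal_cases)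
    case (5 i s')
    have "arrs s' ''w'' = arrs s ''w''" "arrs s' ''lb'' = arrs s ''lb''"
      using 5(1) s1 by (simp_all add: frame_def)
    then show ?case
      using 5 W s1 by (intro run_straight) (auto simp: less_Suc_eq)
  qed (use s1 in \<open>auto simp: le_less\<close>)
  show ?case
  proof (rule run_seq[OF l2, where U = "9 + n * 35"], goal_cases)
    case (1 s2)
    have s2: "regs s2 ''n'' = n" "arrs s2 ''Gp'' = P" "arrs s2 ''Go'' = od"
      using 1(1) s1 by (simp_all add: frame_def)
    \<comment> \<open>The sum runs over current values at the processed children. They are final, as
      a processed node is written no more.\<close>
    let ?I = "\<lambda>i s'. \<forall>y\<le>n. arrs s' ''dn'' y = ?g y + (\<Sum>x\<in>{x \<in> od ` {..<i}. P x = y}. arrs s' ''dn'' x)"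
    show ?case
    proof (rule run_seq[where T = "6 + n * 35" and U = 2], rule run_for[where B = 27 and I = ?I], goal_cases)
      case 4
      show ?case
        using 1(2) by simp
    next
      case (5 i s')
      have s': "arrs s' ''Gp'' = P" "arrs s' ''Go'' = od"
        using 5(1) s2 by (simp_all add: frame_def)
      have i: "i < n"
        using 5(2) s2 by simp
      let ?x = "od i" and ?d = "arrs s' ''dn''"
      let ?X = "od ` {..<i}"
      have xn: "?x < n"
        using O_less[OF rt i] .
      have new: "?x \<notin> ?X"
      proof
        assume "?x \<in> ?X"
        then obtain j where "j < i" "od j = ?x"
          by force
        then show False
          using rank_O[OF rt i] rank_O[OF rt, of j] i by simp
      qed
      have newP: "P ?x \<notin> ?X"
      proof
        assume "P ?x \<in> ?X"
        then obtain j where "j < i" "od j = P ?x"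
          by force
        then show False
          using rank_parent[OF rt xn] rank_O[OF rt i] rank_O[OF rt, of j] i by simp
      qed
      have Px: "P ?x \<noteq> ?x"
        using rank_parent[OF rt xn] by auto
      let ?d' = "?d(P ?x := ?d (P ?x) + ?d ?x)"
      have "?d' y = ?g y + (\<Sum>x\<in>{x \<in> od ` {..<Suc i}. P x = y}. ?d' x)" if y: "y \<le> n" for y
      proof -
        have eq: "(\<Sum>x\<in>{x \<in> ?X. P x = y}. ?d' x) = (\<Sum>x\<in>{x \<in> ?X. P x = y}. ?d x)"
        proof (rule sum.cong[OF refl])
          fix x assume "x \<in> {x \<in> ?X. P x = y}"
          then have "x \<noteq> P ?x"
            using newP by blast
          then show "?d' x = ?d x"
            by simp
        qed
        have old: "?d y = ?g y + (\<Sum>x\<in>{x \<in> ?X. P x = y}. ?d x)"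
          by (rule 5(4)[rule_format, OF y])
        show ?thesis
        proof (cases "P ?x = y")
          case True
          then have "{x \<in> od ` {..<Suc i}. P x = y} = insert ?x {x \<in> ?X. P x = y}"
            by (auto simp: lessThan_Suc)
          then have "(\<Sum>x\<in>{x \<in> od ` {..<Suc i}. P x = y}. ?d' x) = ?d ?x + (\<Sum>x\<in>{x \<in> ?X. P x = y}. ?d x)"
          proof -
            assume "{x \<in> od ` {..<Suc i}. P x = y} = insert ?x {x \<in> ?X. P x = y}"
            moreover have "(\<Sum>x\<in>insert ?x {x \<in> ?X. P x = y}. ?d' x) = ?d' ?x + (\<Sum>x\<in>{x \<in> ?X. P x = y}. ?d' x)"
              using new by (intro sum.insert) auto
            ultimately show ?thesis
              using Px unfolding eq by simp
          qed
          then show ?thesis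
            using True old by simp
        next
          case False
          then have "{x \<in> od ` {..<Suc i}. P x = y} = {x \<in> ?X. P x = y}"
            by (auto simp: lessThan_Suc)
          then have "(\<Sum>x\<in>{x \<in> od ` {..<Suc i}. P x = y}. ?d' x) = (\<Sum>x\<in>{x \<in> ?X. P x = y}. ?d x)"
            using eq by (simp only:)
          moreover have "?d' y = ?d y"
            using False by simp
          ultimately show ?thesis
            using old by (simp only:)
        qed
      qed
      then have "\<forall>y\<le>n. ?d' y = ?g y + (\<Sum>x\<in>{x \<in> od ` {..<Suc i}. P x = y}. ?d' x)"
        by blast
      then show ?case
        using s' 5(3) by (intro run_straight) simp_all
    next
      case (7 s')
      have odn: "od ` {..<n} = {..<n}"
        using rt by (simp add: rooted_def bij_betw_def)
      \<comment> \<open>After the last round the invariant is the recursion of subtree sums, which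
        has a unique solution.\<close>
      have "arrs s' ''dn'' y = sum ?g (sub n P y)" if "y \<le> n" for y
      proof (rule sum_desc_unique[where rk = "rank n od" and X = "{..n}"])
        show "arrs s' ''dn'' x = ?g x + (\<Sum>y\<in>{y. y < n \<and> P y = x}. arrs s' ''dn'' y)" if "x \<in> {..n}" for x
          using 7(3) that unfolding s2(1) odn by (simp add: lessThan_def)
      qed (use rank_parent[OF rt] that in auto)
      moreover have "sum ?g (sub n P v) = sum W (sub n P v)" if "v < n" for v
        using sub_less[OF rt _ that] by (intro sum.cong) auto
      moreover have "sum ?g (sub n P n) = sum W {..<n}"
        unfolding sub_dummy[OF rt] by (simp add: lessThan_Suc_atMost[symmetric])
      ultimately show "(\<forall>v<n. arrs s' ''dn'' v = sum W (sub n P v)) \<and> arrs s' ''dn'' n = sum W {..<n}"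
        by simp
    qed (use s2 in \<open>auto intro: run_straight\<close>)
  qed simp
qed simp

lemma sums_iff: "z \<in> sums W \<longleftrightarrow> z = 0 \<or> (\<exists>w\<in>W. 0 < w \<and> w \<le> z \<and> z - w \<in> sums W)"
proof
  assume "z \<in> sums W"
  then show "z = 0 \<or> (\<exists>w\<in>W. 0 < w \<and> w \<le> z \<and> z - w \<in> sums W)"
  proof (induction rule: sums.induct)
    case (add z w)
    show ?case
    proof (cases "w = 0")
      case False
      then show ?thesis
        using add.hyps by (intro disjI2 bexI[of _ w]) auto
    qed (use add.IH in simp)
  qed simp
next
  assume "z = 0 \<or> (\<exists>w\<in>W. 0 < w \<and> w \<le> z \<and> z - w \<in> sums W)"
  then show "z \<in> sums W"
    using sums.add[of "z - w" W w for w] by (auto intro: sums.zero) (metis add.commute le_add_diff_inverse sums.add)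
qed

definition reach_inv :: "nat set \<Rightarrow> nat \<Rightarrow> nat set \<Rightarrow> (nat \<Rightarrow> nat) \<Rightarrow> bool" where
  "reach_inv S z X R \<longleftrightarrow> (\<forall>y<z. R y = 1 \<longleftrightarrow> y \<in> S) \<and>
     (R z = 1 \<longleftrightarrow> z = 0 \<or> (\<exists>w\<in>X. 0 < w \<and> w \<le> z \<and> z - w \<in> S))"

text \<open>For weight 0 the entry at \<open>z\<close> is compared with itself, and the update
  changes nothing.\<close>

definition reach_upd :: "nat \<Rightarrow> nat \<Rightarrow> (nat \<Rightarrow> nat) \<Rightarrow> nat \<Rightarrow> nat" where
  "reach_upd w z R = (if w \<le> z \<and> R (z - w) = 1 then R(z := 1) else R)"

lemma reach_inv_step:
  assumes "reach_inv S z X R"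
  shows "reach_inv S z (insert w X) (reach_upd w z R)"
proof (cases "w = 0")
  case True
  then show ?thesis
    using assms by (auto simp: reach_inv_def reach_upd_def)
next
  case False
  then have "w \<le> z \<Longrightarrow> R (z - w) = 1 \<longleftrightarrow> z - w \<in> S"
    using assms by (simp add: reach_inv_def)
  then show ?thesis
    using assms False unfolding reach_inv_def reach_upd_def by (auto split: if_splits)
qed

lemma run_Skip: "Q s \<Longrightarrow> 1 \<le> T \<Longrightarrow> run Skip s T Q"
  by (rule run_straight) simp_all

lemma try_item:
  "arrs (cval try_item s) ''R'' = reach_upd (regs s ''x'') (regs s ''z'') (arrs s ''R'')"
  "a \<noteq> ''R'' \<Longrightarrow> arrs (cval try_item s) a = arrs s a" "regs (cval try_item s) = regs s"
  "straight try_item" "ccost try_item = 15"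
  by (auto simp: try_item_def reach_upd_def not_less)

lemma compute_reach:
  assumes r: "regs s ''n'' = n" "regs s ''T'' = T" and d: "arrs s ''dn'' = d"
    and W: "W = (\<Union>j<n. {d j, d n - d j})"
  shows "run compute_reach s (6 + T * (28 + n * 48)) (\<lambda>s'. \<forall>y<T. arrs s' ''R'' y = 1 \<longleftrightarrow> y \<in> sums W)"
  unfolding compute_reach_def
proof (rule run_for[where B = "20 + n * 48" and I = "\<lambda>z s'. \<forall>y<z. arrs s' ''R'' y = 1 \<longleftrightarrow> y \<in> sums W"], goal_cases)
  case (5 z s1)
  have s1: "regs s1 ''n'' = n" "arrs s1 ''dn'' = d" "regs s1 ''z'' = z"
    using 5(1,3) r d by (simp_all add: frame_def try_item_def)
  let ?init = "If (Equal (Reg ''z'') (Const 0)) (Store ''R'' (Reg ''z'') (Const 1)) (Store ''R'' (Reg ''z'') (Const 0))"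
  show ?case
    unfolding seqs.simps
  proof (rule run_seq[where T = 7 and U = "7 + n * 48" and Q = "\<lambda>s'. reach_inv (sums W) z {} (arrs s' ''R'')"], goal_cases)
    case 1
    show ?case
      using 5(4) s1 by (intro run_straight) (auto simp: reach_inv_def)
  next
    case (2 s2)
    have s2: "regs s2 ''n'' = n" "arrs s2 ''dn'' = d" "regs s2 ''z'' = z"
      using 2(1) s1 by (simp_all add: frame_def)
    show ?case
    proof (rule run_seq[where T = "6 + n * 48" and U = 1 and Q = "\<lambda>s'. reach_inv (sums W) z W (arrs s' ''R'')"],
        rule run_for[where B = 40 and I = "\<lambda>i s'. reach_inv (sums W) z (\<Union>j<i. {d j, d n - d j}) (arrs s' ''R'')"], goal_cases)
      case 4
      show ?case
        using 2(2) by simp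
    next
      case (5 i s3)
      have s3: "regs s3 ''n'' = n" "arrs s3 ''dn'' = d" "regs s3 ''z'' = z"
        using 5(1) s2 by (simp_all add: frame_def try_item_def)
      have un: "(\<Union>j<Suc i. {d j, d n - d j}) = insert (d n - d i) (insert (d i) (\<Union>j<i. {d j, d n - d j}))"
        by (auto simp: lessThan_Suc)
      note st = reach_inv_step[OF reach_inv_step[OF 5(4)], of "d n - d i" "d i"]
      show ?case
        unfolding un using st s3 5(3) by (intro run_straight) (simp_all add: try_item)
    next
      case (7 s')
      then show ?case
        using s2(1) by (simp add: W)
    next
      case (8 s')
      have inv: "\<forall>y<z. arrs s' ''R'' y = 1 \<longleftrightarrow> y \<in> sums W"
        "arrs s' ''R'' z = 1 \<longleftrightarrow> z = 0 \<or> (\<exists>w\<in>W. 0 < w \<and> w \<le> z \<and> z - w \<in> sums W)"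
        by (insert 8(2)[unfolded reach_inv_def], (elim conjE, assumption)+)
      have "arrs s' ''R'' y = 1 \<longleftrightarrow> y \<in> sums W" if "y < Suc z" for y
      proof (cases "y = z")
        case True
        show ?thesis
          unfolding True inv(2) sums_iff[of z W] ..
      next
        case False
        then show ?thesis
          using inv(1) that by simp
      qed
      then show ?case
        by (intro run_straight) simp_all
    qed (use s2 in \<open>auto simp: try_item_def\<close>)
  qed simp
qed (use r in \<open>auto simp: try_item_def\<close>)

section \<open>Enumerating all tapes\<close>

text \<open>The tape read as a number in base \<open>B\<close>, lowest digit first. Enumeration is
  counting, and the search is measured by this number.\<close>

definition val :: "nat \<Rightarrow> nat \<Rightarrow> (nat \<Rightarrow> nat) \<Rightarrow> nat" where
  "val B l \<tau> = (\<Sum>j<l. \<tau> j * B ^ j)"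

lemma val_less:
  assumes "\<And>j. j < l \<Longrightarrow> \<tau> j < B"
  shows "val B l \<tau> < B ^ l"
  using assms
proof (induction l)
  case (Suc l)
  then have "val B l \<tau> < B ^ l" "\<tau> l + 1 \<le> B"
    by (simp_all add: less_eq_Suc_le)
  then have "val B l \<tau> + \<tau> l * B ^ l < B ^ l + \<tau> l * B ^ l" "(\<tau> l + 1) * B ^ l \<le> B * B ^ l"
    by (simp, intro mult_right_mono) auto
  then show ?case
    by (simp add: val_def)
qed (simp add: val_def)

lemma val_inj:
  assumes "\<And>j. j < l \<Longrightarrow> \<tau> j < B" "\<And>j. j < l \<Longrightarrow> \<tau>' j < B" "val B l \<tau> = val B l \<tau>'" "j < l"
  shows "\<tau> j = \<tau>' j"
  using assms
proof (induction l)
  case (Suc l)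
  have less: "val B l \<tau> < B ^ l" "val B l \<tau>' < B ^ l"
    using Suc.prems by (auto intro: val_less)
  have eq: "val B l \<tau> + \<tau> l * B ^ l = val B l \<tau>' + \<tau>' l * B ^ l"
    using Suc.prems(3) by (simp add: val_def)
  have div: "(x + t * p) div p = t" if "x < p" for x t p :: nat
    using that by simp
  have "(val B l \<tau> + \<tau> l * B ^ l) div B ^ l = \<tau> l" "(val B l \<tau>' + \<tau>' l * B ^ l) div B ^ l = \<tau>' l"
    using div less by blast+
  then have "\<tau> l = \<tau>' l"
    using eq by simp
  moreover have "val B l \<tau> = val B l \<tau>'"
    using eq \<open>\<tau> l = \<tau>' l\<close> by simp
  ultimately show ?case
    using Suc by (cases "j = l") auto
qed simp

definition next_tape :: com where
  "next_tape = seqs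
    [Assign ''i'' (Const 0),
     While (And (Less (Reg ''i'') (Reg ''l'')) (Equal (Load ''tp'' (Reg ''i'')) (Reg ''mx'')))
       (seqs [Store ''tp'' (Reg ''i'') (Const 0), Assign ''i'' (Plus (Reg ''i'') (Const 1))]),
     If (Less (Reg ''i'') (Reg ''l'')) (Store ''tp'' (Reg ''i'') (Plus (Load ''tp'' (Reg ''i'')) (Const 1)))
       (Assign ''go'' (Const 0))]"

lemma val_split:
  assumes "i < l"
  shows "val B l \<tau> = val B i \<tau> + \<tau> i * B ^ i + (\<Sum>j\<in>{Suc i..<l}. \<tau> j * B ^ j)"
proof -
  have "{..<l} = {..<i} \<union> {i} \<union> {Suc i..<l}"
    using assms by auto
  then have "val B l \<tau> = (\<Sum>j\<in>{..<i} \<union> {i} \<union> {Suc i..<l}. \<tau> j * B ^ j)"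
    by (simp add: val_def)
  also have "\<dots> = val B i \<tau> + \<tau> i * B ^ i + (\<Sum>j\<in>{Suc i..<l}. \<tau> j * B ^ j)"
    unfolding val_def by (subst sum.union_disjoint; auto)+
  finally show ?thesis .
qed

lemma val_max: "val (mx + 1) i (\<lambda>_. mx) + 1 = (mx + 1) ^ i"
  by (induction i) (simp_all add: val_def)

lemma val_cong: "(\<And>j. j < l \<Longrightarrow> \<tau> j = \<tau>' j) \<Longrightarrow> val B l \<tau> = val B l \<tau>'"
  by (simp add: val_def)

lemma next_tape:
  assumes r: "regs s ''l'' = l" "regs s ''mx'' = mx" "arrs s ''tp'' = \<tau>" and d: "\<And>j. j < l \<Longrightarrow> \<tau> j \<le> mx"
  shows "run next_tape s (30 + l * 30) (\<lambda>s'. (\<forall>j<l. arrs s' ''tp'' j \<le> mx) \<and>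
    (if val (mx + 1) l \<tau> + 1 < (mx + 1) ^ l
     then regs s' ''go'' = regs s ''go'' \<and> val (mx + 1) l (arrs s' ''tp'') = val (mx + 1) l \<tau> + 1
     else regs s' ''go'' = 0))"
  unfolding next_tape_def seqs.simps
proof (rule run_seq[where T = 2 and Q = "\<lambda>s'. s' = set_reg s ''i'' 0" and U = "28 + l * 30"], goal_cases)
  case 1
  show ?case
    by (intro run_straight) simp_all
next
  case (2 s1)
  let ?I = "\<lambda>s'. regs s' ''i'' \<le> l \<and> (\<forall>j<regs s' ''i''. \<tau> j = mx) \<and>
    arrs s' ''tp'' = (\<lambda>j. if j < regs s' ''i'' then 0 else \<tau> j)"
  let ?b = "And (Less (Reg ''i'') (Reg ''l'')) (Equal (Load ''tp'' (Reg ''i'')) (Reg ''mx''))"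
  have s1: "regs s1 ''l'' = l" "regs s1 ''mx'' = mx" "regs s1 ''go'' = regs s ''go''" "arrs s1 ''tp'' = \<tau>" "regs s1 ''i'' = 0"
    using 2(2) r by simp_all
  show ?case
  proof (rule run_seq[where T = "9 + l * 20" and Q = "\<lambda>s'. ?I s' \<and> \<not> bval ?b s'" and U = 15],
      rule run_while[where m = "\<lambda>s'. l - regs s' ''i''" and B = 8], goal_cases)
    case (1 s')
    have "regs s' ''l'' = l" "regs s' ''mx'' = mx"
      using 1(1) s1 by (simp_all add: frame_def)
    then show ?case
      using 1(2,3) by (intro run_straight) (auto simp: fun_eq_iff less_Suc_eq)
  next
    case (4 s2)
    have s2: "regs s2 ''l'' = l" "regs s2 ''mx'' = mx" "regs s2 ''go'' = regs s ''go''"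
      using 4(1) s1 by (simp_all add: frame_def)
    define i where "i = regs s2 ''i''"
    have i: "i \<le> l" "\<And>j. j < i \<Longrightarrow> \<tau> j = mx" "arrs s2 ''tp'' = (\<lambda>j. if j < i then 0 else \<tau> j)"
      using 4(2) by (simp_all add: i_def)
    \<comment> \<open>The cleared digits were all \<open>mx\<close> and thus worth one less than
      \<open>(mx + 1) ^ i\<close>, which the carry into position \<open>i\<close> restores with one
      to spare.\<close>
    have vi: "val (mx + 1) i \<tau> + 1 = (mx + 1) ^ i"
      using val_max[of mx i] val_cong[of i \<tau> "\<lambda>_. mx" "mx + 1"] i(2) by simp
    show ?case
    proof (cases "i < l")
      case True
      let ?t = "(\<lambda>j. if j < i then 0 else \<tau> j)(i := \<tau> i + 1)"
      have "\<tau> i \<noteq> mx"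
        using 4(2) True s2 i(3) by (simp add: i_def)
      then have ti: "\<tau> i + 1 \<le> mx"
        using d[OF True] by simp
      have dt: "?t j \<le> mx" if "j < l" for j
        using d[OF that] ti by simp
      have "val (mx + 1) i ?t = 0"
        by (simp add: val_def)
      moreover have "(\<Sum>j\<in>{Suc i..<l}. ?t j * (mx + 1) ^ j) = (\<Sum>j\<in>{Suc i..<l}. \<tau> j * (mx + 1) ^ j)"
        by (intro sum.cong) auto
      ultimately have "val (mx + 1) l ?t = (\<tau> i + 1) * (mx + 1) ^ i + (\<Sum>j\<in>{Suc i..<l}. \<tau> j * (mx + 1) ^ j)"
        unfolding val_split[OF True] by simp
      also have "\<dots> = val (mx + 1) l \<tau> + 1"
        unfolding val_split[OF True] using vi by simp
      finally have v: "val (mx + 1) l ?t = val (mx + 1) l \<tau> + 1" .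
      moreover have "val (mx + 1) l ?t < (mx + 1) ^ l"
        using dt by (intro val_less) (simp add: less_Suc_eq_le)
      ultimately have less: "val (mx + 1) l \<tau> + 1 < (mx + 1) ^ l"
        by simp
      have "regs s2 ''i'' = i"
        by (simp add: i_def)
      then show ?thesis
        using True s2 i(3) dt v less by (intro run_straight) simp_all
    next
      case False
      then have il: "i = l"
        using i(1) by simp
      have "regs s2 ''i'' = i"
        by (simp add: i_def)
      then show ?thesis
        using il s2 i(3) vi by (intro run_straight) simp_all
    qed
  qed (use s1 r in auto)
qed simp

section \<open>The search\<close>

definition test_tape :: com where
  "test_tape = seqs
    [assign_classes, compute_labels, compute_sums, compute_reach,
     If (Equal (Load ''R'' (Minus (Reg ''T'') (Const 1))) (Const 1)) (Assign ''out'' (Const 1)) Skip]"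

definition test_all :: com where
  "test_all = seqs
    [Assign ''go'' (Const 1),
     While (Equal (Reg ''go'') (Const 1)) (seqs [test_tape, next_tape])]"

lemma writes_search:
  "wregs assign_classes = {''i'', ''x'', ''c''}" "warrs assign_classes = {''cu'', ''hc'', ''cl''}"
  "wregs compute_labels = {''i'', ''x''}" "warrs compute_labels = {''lb''}"
  "wregs compute_sums = {''i'', ''x'', ''y''}" "warrs compute_sums = {''dn''}"
  "wregs compute_reach = {''i'', ''x'', ''z''}" "warrs compute_reach = {''R''}"
  "wregs next_tape = {''i'', ''go''}" "warrs next_tape = {''tp''}"
  by (auto simp: assign_classes_def compute_labels_def compute_sums_def compute_reach_def try_item_def next_tape_def)

section \<open>The test of one tape and the loop over all tapes\<close>

context motif_problem
begin

text \<open>The results of the preparation that every test reads and must leave intact. The label of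
  the dummy is included since \<open>lb\<close> is overwritten for each tape.\<close>

definition env :: "nat \<Rightarrow> (nat \<Rightarrow> nat) \<Rightarrow> (nat \<Rightarrow> nat) \<Rightarrow> nat \<Rightarrow> state \<Rightarrow> bool" where
  "env k q a mx s \<longleftrightarrow> regs s ''n'' = n \<and> regs s ''N'' = N \<and> regs s ''k1'' = k + 1 \<and> regs s ''l'' = l \<and>
     regs s ''mx'' = mx \<and> regs s ''T'' = (l + 1) * 2 ^ l \<and> arrs s ''q'' = q \<and> arrs s ''Hp'' = P \<and>
     arrs s ''Ho'' = od \<and> arrs s ''Gp'' = GP \<and> arrs s ''Go'' = Go \<and>
     (\<forall>c. n \<le> c \<and> c \<le> N \<longrightarrow> arrs s ''fi'' c = first a c \<and> arrs s ''en'' c = first a (Suc c)) \<and>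
     (\<forall>j\<le>l. arrs s ''w'' j = weight l j) \<and> arrs s ''lb'' N = 0"

lemma hit_iff:
  assumes d: "\<And>v. v < n \<Longrightarrow> d v = sum (\<lambda>v. weight l (lab v)) (sub n GP v)" "d n = sum (\<lambda>v. weight l (lab v)) {..<n}"
  shows "hit lab \<longleftrightarrow> (l + 1) * 2 ^ l - 1 \<in> sums (\<Union>j<n. {d j, d n - d j})"
proof -
  let ?W = "\<lambda>v. weight l (lab v)"
  have "sum ?W ({..<n} - sub n GP v) = d n - d v" if "v < n" for v
    unfolding d(2) d(1)[OF that] using sub_less[OF Grt _ that]
    by (intro sum_diff_nat) (auto intro: finite_desc)
  then have "sum ?W ` branches n GP = (\<Union>j<n. {d j, d n - d j})"
    unfolding branches_def image_Un image_image using d(1) by (auto simp: image_iff)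
  moreover have "z + 1 = (l + 1) * 2 ^ l \<longleftrightarrow> z = (l + 1) * 2 ^ l - 1" for z
    by auto
  ultimately show ?thesis
    unfolding hit_def by simp
qed

text \<open>The witnesses \<open>cls\<close> and \<open>lab\<close> are the contents of the arrays
  after the test. \<open>out\<close> is only ever raised, so a success of an earlier tape
  persists.\<close>

lemma test_tape:
  assumes env: "env k q a mx s" and N: "N = n + k" and kn: "k \<le> n"
    and st: "status q a" and fe: "feasible q a"
  shows "run test_tape s (500 * (n * ((l + 1) * 2 ^ l))) (\<lambda>s'. env k q a mx s' \<and> arrs s' ''tp'' = arrs s ''tp'' \<and>
    regs s' ''go'' = regs s ''go'' \<and>
    (\<exists>cls lab. assigned q a (arrs s ''tp'') cls \<and> labelled q cls lab \<and>
      regs s' ''out'' = (if hit lab then 1 else regs s ''out'')))"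
proof -
  let ?T = "(l + 1) * 2 ^ l"
  have tot: "first a (Suc N) = l"
    using first_total[OF st fe size] .
  have e: "regs s ''n'' = n" "regs s ''N'' = N" "regs s ''k1'' = k + 1" "regs s ''T'' = ?T"
    "arrs s ''q'' = q" "arrs s ''Hp'' = P" "arrs s ''Ho'' = od" "arrs s ''Gp'' = GP" "arrs s ''Go'' = Go"
    "\<And>c. n \<le> c \<Longrightarrow> c \<le> N \<Longrightarrow> arrs s ''fi'' c = first a c \<and> arrs s ''en'' c = first a (Suc c)"
    "\<And>j. j \<le> l \<Longrightarrow> arrs s ''w'' j = weight l j" "arrs s ''lb'' N = 0"
    using env unfolding env_def by blast+
  have n1: "1 \<le> n"
    using l_less by simp
  have "0 < ?T"
    by (intro mult_pos_pos) simp_all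
  then have T1: "1 \<le> ?T"
    by linarith
  have nT: "n \<le> n * ?T" "?T \<le> n * ?T"
    using mult_le_mono2[OF T1, of n] mult_le_mono1[OF n1, of ?T] by (simp_all only: mult_1 mult_1_right)
  have "run test_tape s ((50 + k * 30 + n * 60) + ((6 + N * 60) + ((20 + n * 50) + ((6 + ?T * (28 + n * 48)) + (11 + 1)))))
    (\<lambda>s'. env k q a mx s' \<and> arrs s' ''tp'' = arrs s ''tp'' \<and> regs s' ''go'' = regs s ''go'' \<and>
    (\<exists>cls lab. assigned q a (arrs s ''tp'') cls \<and> labelled q cls lab \<and>
      regs s' ''out'' = (if hit lab then 1 else regs s ''out'')))"
    unfolding test_tape_def seqs.simps
  proof (rule run_seq[OF assign_classes[OF e(1,3) N e(5,6,10)] _ order.refl], assumption, assumption, goal_cases)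
    case (1 s1)
    define cls where "cls = arrs s1 ''cl''"
    have s1: "regs s1 ''n'' = n" "regs s1 ''N'' = N" "arrs s1 ''q'' = q" "arrs s1 ''Hp'' = P" "arrs s1 ''Ho'' = od"
      "arrs s1 ''cl'' = cls" "arrs s1 ''lb'' N = 0"
      using 1(1) e by (simp_all add: frame_def writes_search cls_def)
    show ?case
    proof (rule run_seq[OF compute_labels[OF s1] _ order.refl], goal_cases)
      case s2: (1 s2)
      define lab where "lab = arrs s2 ''lb''"
      have lab: "labelled q cls lab" and as: "assigned q a (arrs s ''tp'') cls"
        using s2(2) 1(2) by (simp_all add: lab_def cls_def)
      let ?W = "\<lambda>v. weight l (lab v)"
      have f2: "regs s2 ''n'' = n" "arrs s2 ''Gp'' = GP" "arrs s2 ''Go'' = Go" "arrs s2 ''w'' = arrs s ''w''"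
        using s2(1) 1(1) e by (simp_all add: frame_def writes_search)
      have W: "arrs s2 ''w'' (arrs s2 ''lb'' v) = ?W v" if "v < n" for v
        using lab_le[OF as lab, of v] that nN e(11) unfolding tot f2(4) by (simp add: lab_def)
      show ?case
      proof (rule run_seq[OF compute_sums[OF Grt f2(1,2,3) W] _ order.refl], assumption, goal_cases)
        case s3: (1 s3)
        have f3: "regs s3 ''n'' = n" "regs s3 ''T'' = ?T"
          using s3(1) s2(1) 1(1) e by (simp_all add: frame_def writes_search)
        show ?case
        proof (rule run_seq[OF compute_reach[OF f3 refl refl] _ order.refl], goal_cases)
          case s4: (1 s4)
          have "hit lab \<longleftrightarrow> ?T - 1 \<in> sums (\<Union>j<n. {arrs s3 ''dn'' j, arrs s3 ''dn'' n - arrs s3 ''dn'' j})"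
            using s3(2) by (intro hit_iff) auto
          then have hit: "arrs s4 ''R'' (?T - 1) = 1 \<longleftrightarrow> hit lab"
            using s4(2) T1 by simp
          have rs: "regs s4 x = regs s x" if "x \<notin> {''i'', ''x'', ''c'', ''y'', ''z''}" for x
            using that s4(1) s3(1) s2(1) 1(1) by (simp add: frame_def writes_search)
          have ars: "arrs s4 x = arrs s x" if "x \<notin> {''cu'', ''hc'', ''cl'', ''lb'', ''dn'', ''R''}" for x
            using that s4(1) s3(1) s2(1) 1(1) by (simp add: frame_def writes_search)
          have lb: "arrs s4 ''lb'' = lab"
            using s4(1) s3(1) by (simp add: frame_def writes_search lab_def)
          have env4: "env k q a mx s4"
            using env lab unfolding env_def by (simp add: rs ars lb labelled_def)
          have ex: "\<exists>cls lab. assigned q a (arrs s ''tp'') cls \<and> labelled q cls lab \<and>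
              r = (if hit lab then 1 else regs s ''out'')"
            if "r = (if hit lab then 1 else regs s ''out'')" for r
            using as lab that by blast
          have "regs s4 ''T'' = ?T"
            using rs[of "''T''"] e(4) by simp
          then have c: "bval (Equal (Load ''R'' (Minus (Reg ''T'') (Const 1))) (Const 1)) s4 \<longleftrightarrow> hit lab"
            using hit by (simp del: One_nat_def)
          have envo: "env k q a mx (set_reg s4 ''out'' 1)"
            using env4 by (simp add: env_def)
          let ?s5 = "cval (Seq (If (Equal (Load ''R'' (Minus (Reg ''T'') (Const 1))) (Const 1)) (Assign ''out'' (Const 1)) Skip) Skip) s4"
          show ?case
          proof (rule run_straight)
            show "env k q a mx ?s5 \<and>
              arrs ?s5 ''tp'' = arrs s ''tp'' \<and>
              regs ?s5 ''go'' = regs s ''go'' \<and>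
              (\<exists>cls lab. assigned q a (arrs s ''tp'') cls \<and> labelled q cls lab \<and>
                regs ?s5 ''out'' =
                  (if hit lab then 1 else regs s ''out''))"
              unfolding cval.simps c
              using env4 envo rs[of "''go''"] rs[of "''out''"] ars[of "''tp''"]
              by (intro conjI ex; cases "hit lab") simp_all
          qed simp_all
        qed
      qed
    qed
  qed
  then show ?thesis
  proof (rule run_mono)
    have "k * 30 \<le> n * 30" "N * 60 \<le> n * 120"
      using kn N by simp_all
    then have "(50 + k * 30 + n * 60) + ((6 + N * 60) + ((20 + n * 50) + ((6 + ?T * (28 + n * 48)) + (11 + 1))))
      \<le> 94 + n * 260 + 28 * ?T + 48 * (n * ?T)"
      by (simp add: algebra_simps)
    also have "\<dots> \<le> 500 * (n * ?T)"
      using nT n1 by linarith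
    finally show "(50 + k * 30 + n * 60) + ((6 + N * 60) + ((20 + n * 50) + ((6 + ?T * (28 + n * 48)) + (11 + 1)))) \<le> 500 * (n * ?T)" .
  qed
qed

text \<open>Each color reads digits in its own interval only, and all intervals lie below
  \<open>first a (Suc N)\<close>. Hence tapes of equal value behave alike.\<close>

lemma assigned_cong:
  assumes "\<And>j. j < first a (Suc N) \<Longrightarrow> \<tau> j = \<tau>' j"
  shows "assigned q a \<tau> cls \<longleftrightarrow> assigned q a \<tau>' cls"
proof -
  have "\<tau> (first a (P v) + b) = \<tau>' (first a (P v) + b)" if "v < n" "b < a (P v) - M (P v)" for v b
  proof (rule assms)
    have "first a (P v) + b < first a (Suc (P v))"
      using first_Suc vertex_parent[OF that(1)] that(2) by simp
    also have "\<dots> \<le> first a (Suc N)"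
      using vertex_parent[OF that(1)] by (intro first_mono) simp
    finally show "first a (P v) + b < first a (Suc N)" .
  qed
  then show ?thesis
    unfolding assigned_def by (intro all_cong1 imp_cong refl) (simp cong: conj_cong)
qed

lemma test_all:
  assumes env: "env k q a mx s" and N: "N = n + k" and kn: "k \<le> n"
    and st: "status q a" and fe: "feasible q a" and mx: "\<And>c. n \<le> c \<Longrightarrow> c < N \<Longrightarrow> M c \<le> mx"
    and tp: "arrs s ''tp'' = (\<lambda>_. 0)" and out: "regs s ''out'' = 0"
  shows "run test_all s (20 + (mx + 1) ^ l * (600 * (n * ((l + 1) * 2 ^ l))))
    (\<lambda>s'. regs s' ''out'' = (if solution then 1 else 0))"
proof -
  let ?B = "mx + 1"
  let ?T = "(l + 1) * 2 ^ l"
  have tot: "first a (Suc N) = l"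
    using first_total[OF st fe size] .
  \<comment> \<open>A tape that must be recognized whatever classes and labels the program computes
    from it.\<close>
  define good where "good \<tau> \<longleftrightarrow> (\<forall>j<l. \<tau> j \<le> mx) \<and>
    (\<forall>cls lab. assigned q a \<tau> cls \<longrightarrow> labelled q cls lab \<longrightarrow> hit lab)" for \<tau>
  \<comment> \<open>Soundness: \<open>out\<close> is 1 only if a solution exists. Completeness:
    every good tape with a smaller value than the current one has already set \<open>out\<close>,
    and after the last tape this holds for all good tapes.\<close>
  let ?I = "\<lambda>s'. env k q a mx s' \<and> (\<forall>j<l. arrs s' ''tp'' j \<le> mx) \<and> (regs s' ''out'' = 0 \<or> regs s' ''out'' = 1 \<and> solution) \<and>
    (\<forall>\<tau>. good \<tau> \<longrightarrow> val ?B l \<tau> < val ?B l (arrs s' ''tp'') \<or> regs s' ''go'' \<noteq> 1 \<longrightarrow> regs s' ''out'' = 1)"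
  let ?m = "\<lambda>s'. if regs s' ''go'' = 1 then ?B ^ l - val ?B l (arrs s' ''tp'') else 0"
  have n1: "1 \<le> n" and ln: "l \<le> n"
    using l_less by simp_all
  have "0 < ?T"
    by (intro mult_pos_pos) simp_all
  then have T1: "1 \<le> ?T"
    by linarith
  have nT: "n \<le> n * ?T"
    using mult_le_mono2[OF T1, of n] by (simp only: mult_1_right)
  show ?thesis
    unfolding test_all_def seqs.simps
  proof (rule run_seq[where T = 2 and Q = "\<lambda>s'. s' = set_reg s ''go'' 1" and U = "10 + ?B ^ l * (600 * (n * ?T))"], goal_cases)
    case 1
    show ?case
      by (intro run_straight) simp_all
  next
    case (2 s0)
    have I0: "?I s0"
      using env out tp 2(2) by (auto simp: env_def val_def)
    show ?case
    proof (rule run_seq[where T = "4 + ?B ^ l * (600 * (n * ?T))" and U = 1 and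
          Q = "\<lambda>s'. ?I s' \<and> \<not> bval (Equal (Reg ''go'') (Const 1)) s'"],
        rule run_while[where m = ?m and B = "590 * (n * ?T)"], goal_cases)
      case (1 s1)
      have e1: "env k q a mx s1" and d1: "\<And>j. j < l \<Longrightarrow> arrs s1 ''tp'' j \<le> mx"
        and o1: "regs s1 ''out'' = 0 \<or> regs s1 ''out'' = 1 \<and> solution"
        and old: "\<And>\<tau>. good \<tau> \<Longrightarrow> val ?B l \<tau> < val ?B l (arrs s1 ''tp'') \<Longrightarrow> regs s1 ''out'' = 1"
        using 1(2) by blast+
      have go1: "regs s1 ''go'' = 1"
        using 1(3) by simp
      show ?case
      proof (rule run_seq[OF test_tape[OF e1 N kn st fe], where U = "90 * (n * ?T)"], goal_cases)
        case s2: (1 s2)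
        have e2: "env k q a mx s2" and t2: "arrs s2 ''tp'' = arrs s1 ''tp''" and go2: "regs s2 ''go'' = 1"
          using s2(2) go1 by auto
        obtain cls lab where cl: "assigned q a (arrs s1 ''tp'') cls" "labelled q cls lab"
          "regs s2 ''out'' = (if hit lab then 1 else regs s1 ''out'')"
          using s2(2) by blast
        have o2: "regs s2 ''out'' = 0 \<or> regs s2 ''out'' = 1 \<and> solution"
          using o1 cl(3) hit_imp_solution[OF st fe cl(1,2)] by auto
        have good2: "regs s2 ''out'' = 1" if g: "good \<tau>" "val ?B l \<tau> \<le> val ?B l (arrs s1 ''tp'')" for \<tau>
        proof (cases "val ?B l \<tau> = val ?B l (arrs s1 ''tp'')")
          case True
          have "\<tau> j = arrs s1 ''tp'' j" if "j < l" for j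
            using val_inj[OF _ _ True that] g(1) d1 by (simp add: good_def less_Suc_eq_le)
          then have "assigned q a \<tau> cls"
            using assigned_cong[of a \<tau> "arrs s1 ''tp''" q cls] cl(1) tot by simp
          then have "hit lab"
            using g(1) cl(2) unfolding good_def by blast
          then show ?thesis
            using cl(3) by simp
        next
          case False
          then have "regs s1 ''out'' = 1"
            using old[OF g(1)] g(2) by simp
          then show ?thesis
            using cl(3) by simp
        qed
        have lm: "regs s2 ''l'' = l" "regs s2 ''mx'' = mx"
          using e2 by (simp_all add: env_def)
        show ?case
        proof (rule run_seq[OF next_tape[OF lm t2 d1], where U = 1], assumption, goal_cases)
          case s3: (1 s3)
          have e3: "env k q a mx s3"
            using e2 s3(1) by (simp add: env_def frame_def writes_search)
          have o3: "regs s3 ''out'' = regs s2 ''out''"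
            using s3(1) by (simp add: frame_def writes_search)
          have d3: "\<forall>j<l. arrs s3 ''tp'' j \<le> mx"
            using s3(2) by blast
          have less: "val ?B l (arrs s1 ''tp'') < ?B ^ l"
            using d1 by (intro val_less) (simp add: less_Suc_eq_le)
          show ?case
          proof (cases "val ?B l (arrs s1 ''tp'') + 1 < ?B ^ l")
            case True
            then have v3: "regs s3 ''go'' = 1" "val ?B l (arrs s3 ''tp'') = val ?B l (arrs s1 ''tp'') + 1"
              using s3(2) go2 by simp_all
            have I3: "?I s3"
              using e3 d3 o2 o3 good2 v3 by (auto simp: less_Suc_eq_le)
            have m3: "?m s3 < ?m s1"
              using v3 go1 True by simp
            show ?thesis
              by (rule run_Skip) (rule conjI[OF I3 m3], simp)
          next
            case False
            then have v3: "regs s3 ''go'' = 0"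
              using s3(2) by simp
            have "val ?B l \<tau> \<le> val ?B l (arrs s1 ''tp'')" if "good \<tau>" for \<tau>
            proof -
              have "val ?B l \<tau> < ?B ^ l"
                using that by (intro val_less) (simp add: good_def less_Suc_eq_le)
              then show ?thesis
                using False by linarith
            qed
            then have I3: "?I s3"
              using e3 d3 o2 o3 good2 v3 by auto
            have m3: "?m s3 < ?m s1"
              using v3 go1 less by simp
            show ?thesis
              by (rule run_Skip) (rule conjI[OF I3 m3], simp)
          qed
        next
          case 2
          show ?case
            using nT ln n1 by linarith
        qed
      qed simp
    next
      case 2
      show ?case
        by (rule I0)
    next
      case 3
      have "?m s0 \<le> ?B ^ l"
        by simp
      then have "?m s0 * (600 * (n * ?T)) \<le> ?B ^ l * (600 * (n * ?T))"
        by (rule mult_right_mono) simp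
      moreover have "?m s0 * (bcost (Equal (Reg ''go'') (Const 1)) + 1 + 590 * (n * ?T)) \<le> ?m s0 * (600 * (n * ?T))"
      proof (rule mult_le_mono2)
        have "1 \<le> n * ?T"
          using nT n1 by linarith
        then show "bcost (Equal (Reg ''go'') (Const 1)) + 1 + 590 * (n * ?T) \<le> 600 * (n * ?T)"
          unfolding bcost.simps acost.simps by linarith
      qed
      ultimately show ?case
        by (simp only: bcost.simps acost.simps)
    next
      case (4 s')
      have "regs s' ''out'' = 1" if sol: solution
      proof -
        obtain \<tau> where "\<forall>j. \<tau> j \<le> mx" "\<forall>cls lab. assigned q a \<tau> cls \<longrightarrow> labelled q cls lab \<longrightarrow> hit lab"
          using solution_imp_hit[OF sol st mx] by blast
        then have "good \<tau>"
          by (simp add: good_def)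
        then show ?thesis
          using 4(2) by simp
      qed
      then show ?case
        using 4(2) by (intro run_straight) auto
    qed simp
  qed simp
qed

end

section \<open>The program\<close>

text \<open>\<open>k\<close> is compared with \<open>n\<close> before any multiplicity is read,
  since a pass over more than \<open>n\<close> colors could exceed the time bound. Rejection is
  right: every color has a copy, so more colors than vertices mean a motif larger than the vertex
  set. \<open>out\<close> starts at 0, so \<open>Skip\<close> answers no.\<close>

definition solve :: com where
  "solve = seqs
    [Assign ''n'' (Load ''in'' (Const 0)),
     Assign ''k'' (Load ''in'' (Const 1)),
     If (Less (Reg ''n'') (Reg ''k'')) Skip (seqs
      [Assign ''mo'' (Plus (Const 4) (Plus (Load ''in'' (Const 2)) (Load ''in'' (Const 2)))),
       load_colors,
       If (Less (Reg ''n'') (Reg ''sum'')) Skip (seqs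
        [seqs
          [Assign ''N'' (Plus (Reg ''n'') (Reg ''k'')),
           Assign ''l'' (Minus (Reg ''n'') (Reg ''sum'')),
           Assign ''nn'' (Reg ''n''),
           Assign ''ec'' (Load ''in'' (Const 2)),
           Assign ''eo'' (Const 4)],
         elim (CHR ''G''),
         seqs
          [Assign ''nn'' (Reg ''N''),
           Assign ''ec'' (Load ''in'' (Const 3)),
           Assign ''eo'' (Plus (Reg ''mo'') (Reg ''k'')),
           Assign ''sh'' (Reg ''n'')],
         elim (CHR ''H''),
         compute_status,
         compute_first,
         If (Equal (Reg ''bad'') (Const 0)) (seqs [compute_weights, test_all]) Skip])])]"

lemma writes_setup:
  "wregs load_colors = {''i'', ''y'', ''sum'', ''mx''}" "warrs load_colors = {''M''}"
  "wregs (elim p) = {''i'', ''a'', ''b'', ''x'', ''y'', ''t''}"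
  "warrs (elim p) = {[p, CHR ''d''], [p, CHR ''s''], [p, CHR ''p''], [p, CHR ''o'']}"
  "wregs compute_status = {''i'', ''x'', ''y''}" "warrs compute_status = {''q'', ''A''}"
  "wregs compute_first = {''bad'', ''i'', ''k1'', ''t'', ''x''}" "warrs compute_first = {''fi'', ''en''}"
  "wregs compute_weights = {''p'', ''i'', ''T''}" "warrs compute_weights = {''e'', ''w''}"
  by (auto simp: load_colors_def elim_def read_edges_def strip_leaves_def compute_status_def
    compute_first_def compute_weights_def)

lemma (in motif_problem) solve_core:
  assumes r: "regs s ''n'' = n" "regs s ''N'' = N" "regs s ''k'' = k" "regs s ''l'' = l" "regs s ''mx'' = mx" "regs s ''out'' = 0"
    and N: "N = n + k" and kn: "k \<le> n"
    and a: "arrs s ''Hp'' = P" "arrs s ''Ho'' = od" "arrs s ''Gp'' = GP" "arrs s ''Go'' = Go" "arrs s ''M'' = M"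
    and z: "arrs s ''q'' = (\<lambda>_. 0)" "arrs s ''A'' = (\<lambda>_. 0)" "arrs s ''tp'' = (\<lambda>_. 0)" "arrs s ''lb'' = (\<lambda>_. 0)"
    and mx: "\<And>c. n \<le> c \<Longrightarrow> c < N \<Longrightarrow> M c \<le> mx"
  shows "run (seqs [compute_status, compute_first,
      If (Equal (Reg ''bad'') (Const 0)) (seqs [compute_weights, test_all]) Skip]) s
    (500 * n + (mx + 1) ^ l * (600 * (n * ((l + 1) * 2 ^ l)))) (\<lambda>s'. regs s' ''out'' = (if solution then 1 else 0))"
proof -
  let ?T = "(mx + 1) ^ l * (600 * (n * ((l + 1) * 2 ^ l)))"
  have n1: "1 \<le> n" "l \<le> n"
    using l_less by simp_all
  show ?thesis
    unfolding seqs.simps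
  proof (rule run_seq[OF compute_status[OF z(1,2) r(1,2) a(1,2,5)], where U = "390 * n + ?T"], goal_cases)
    case (1 s1)
    define q where "q = arrs s1 ''q''"
    define b where "b = arrs s1 ''A''"
    have st: "status q b"
      using 1(2) by (simp add: q_def b_def)
    have s1: "regs s1 ''n'' = n" "regs s1 ''N'' = N" "regs s1 ''k'' = k" "arrs s1 ''q'' = q" "arrs s1 ''A'' = b" "arrs s1 ''M'' = M"
      using 1(1) r a by (simp_all add: frame_def q_def b_def writes_setup)
    show ?case
    proof (rule run_seq[OF compute_first[OF s1(1,2,3) N s1(4,5,6)], where U = "190 * n + ?T"], goal_cases)
      case s2: (1 s2)
      show ?case
      proof (rule run_seq[where T = "180 * n + ?T" and U = 1 and Q = "\<lambda>s'. regs s' ''out'' = (if solution then 1 else 0)"],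
          rule run_If[where T = "150 * n + ?T"], goal_cases)
        case 1
        then have fe: "feasible q b"
          using s2(2) by simp
        have l2: "regs s2 ''l'' = l"
          using s2(1) \<open>frame compute_status s s1\<close> r by (simp add: frame_def writes_setup)
        show ?case
          unfolding seqs.simps
        proof (rule run_seq[OF compute_weights[OF l2], where U = "30 * n + ?T"], goal_cases)
          case s3: (1 s3)
          have rs: "regs s3 x = regs s x" if "x \<notin> {''i'', ''x'', ''y'', ''bad'', ''k1'', ''t'', ''p'', ''T''}" for x
            using that s3(1) s2(1) \<open>frame compute_status s s1\<close> by (simp add: frame_def writes_setup)
          have ars: "arrs s3 x = arrs s x" if "x \<notin> {''A'', ''q'', ''fi'', ''en'', ''e'', ''w''}" for x
            using that s3(1) s2(1) \<open>frame compute_status s s1\<close> by (simp add: frame_def writes_setup)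
          have s32: "regs s3 ''k1'' = regs s2 ''k1''" "arrs s3 ''fi'' = arrs s2 ''fi''" "arrs s3 ''en'' = arrs s2 ''en''" "arrs s3 ''q'' = q"
            using s3(1) s2(1) s1(4) by (simp_all add: frame_def writes_setup)
          have env: "env k q b mx s3"
            using s3(2) s2(2) s32 r a z unfolding env_def by (simp add: rs ars)
          have t: "arrs s3 ''tp'' = (\<lambda>_. 0)" "regs s3 ''out'' = 0"
            using z r by (simp_all add: rs ars)
          show ?case
            by (rule run_seq[OF test_all[OF env N kn st fe mx t], where U = 1])
              (use n1 in \<open>auto intro: run_Skip\<close>)
        next
          case 2
          show ?case
            using n1 by linarith
        qed
      next
        case 2
        then have "\<not> feasible q b"
          using s2(2) by simp
        then have "\<not> solution"
          using solution_imp_feasible[OF _ st] by blast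
        moreover have "regs s2 ''out'' = 0"
          using s2(1) \<open>frame compute_status s s1\<close> r by (simp add: frame_def writes_setup)
        ultimately show ?case
          using n1 by (intro run_Skip) simp_all
      next
        case 3
        show ?case
          using n1 by simp
      next
        case 5
        show ?case
          using n1 by simp
      qed (auto intro: run_Skip)
    next
      case 2
      show ?case
        using n1 kn by linarith
    qed
  next
    case 2
    show ?case
      using n1 kn N by linarith
  qed
qed

text \<open>Trades the factor \<open>l + 1\<close> for the base 3: the left side doubles and gains
  \<open>2 * 2 ^ l\<close>, which is at most half of the right side, while the right side
  triples.\<close>

lemma two_pow_bound: "(l + 1) * 2 ^ l \<le> 2 * 3 ^ (l :: nat)"
proof (induction l)
  case (Suc l)
  have "(Suc l + 1) * 2 ^ Suc l = 2 * ((l + 1) * 2 ^ l) + 2 * 2 ^ l"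
    by (simp add: algebra_simps)
  moreover have "2 * 2 ^ l \<le> (2 * 3 ^ l :: nat)"
    by (simp add: power_mono)
  ultimately show ?case
    using Suc by simp
qed simp

section \<open>Layout of the input word\<close>

lemma flatten_nth:
  "i < length ps \<Longrightarrow> flatten ps ! (2 * i) = fst (ps ! i) \<and> flatten ps ! (2 * i + 1) = snd (ps ! i)"
proof (induction ps arbitrary: i)
  case (Cons p ps)
  show ?case
  proof (cases i)
    case 0
    then show ?thesis
      by (cases p) (simp add: flatten_def)
  next
    case (Suc j)
    then show ?thesis
      using Cons by (cases p) (simp add: flatten_def)
  qed
qed simp

lemma length_flatten: "length (flatten ps) = 2 * length ps"
  by (induction ps) (auto simp: flatten_def)


lemma has_motif_size:
  assumes "lcgm_instance I" "has_motif I"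
  shows "size (motif I) \<le> num_verts I"
proof -
  obtain S f where S: "S \<subseteq> verts (graph I)" "image_mset f (mset_set S) = motif I"
    using assms(2) unfolding has_motif_def by (elim exE conjE) blast
  have "size (motif I) = card S"
    unfolding S(2)[symmetric] by simp
  also have "\<dots> \<le> num_verts I"
    using S(1) assms(1) by (auto simp: num_verts_def lcgm_instance_def ugraph_def intro: card_mono)
  finally show ?thesis .
qed

lemma nth_layout:
  assumes "xs = [n, k, m, p] @ es @ ms @ ps"
  shows "xs ! 0 = n" "xs ! 1 = k" "xs ! 2 = m" "xs ! 3 = p"
    "i < length es \<Longrightarrow> xs ! (4 + i) = es ! i"
    "i < length ms \<Longrightarrow> xs ! (4 + length es + i) = ms ! i"
    "i < length ps \<Longrightarrow> xs ! (4 + length es + length ms + i) = ps ! i"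
  using assms by (simp_all add: nth_append numeral_2_eq_2 numeral_3_eq_3)

lemma induced_verts: "ugraph G \<Longrightarrow> connected (induced G (verts G)) \<longleftrightarrow> connected G"
proof -
  assume "ugraph G"
  then have "adj (induced G (verts G)) = adj G"
    by (auto simp: adj_def induced_def ugraph_def)
  then show ?thesis
    by (simp add: connected_def induced_def)
qed

text \<open>Gathers all that is used of an encoded instance in terms of numbers. Both forest
  properties are turned into \<open>leafy\<close> before the renaming, which then carries them
  over.\<close>

lemma decode:
  fixes I :: "('v, 'c) lcgm"
  assumes I: "lcgm_instance I" and ne: "motif I \<noteq> {#}" and tr: "tree (graph I)"
    and fo: "forest (vertex_color_graph I)" and enc: "encodes xs I"
    and n: "n = num_verts I" and k: "k = card (colors I)"
  obtains es ms ps where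
    "xs = [n, k, length es, length ps] @ flatten es @ ms @ flatten ps" "length ms = k"
    "inj_on (\<lambda>i. {fst (es ! i), snd (es ! i)}) {..<length es}"
    "\<And>i. i < length es \<Longrightarrow> fst (es ! i) \<noteq> snd (es ! i) \<and> fst (es ! i) < n \<and> snd (es ! i) < n"
    "leafy ((\<lambda>i. {fst (es ! i), snd (es ! i)}) ` {..<length es})"
    "conn ((\<lambda>i. {fst (es ! i), snd (es ! i)}) ` {..<length es}) {..<n}"
    "inj_on (\<lambda>i. {fst (ps ! i), snd (ps ! i) + n}) {..<length ps}"
    "\<And>i. i < length ps \<Longrightarrow> fst (ps ! i) < n \<and> snd (ps ! i) < k"
    "leafy ((\<lambda>i. {fst (ps ! i), snd (ps ! i) + n}) ` {..<length ps})"
    "(\<Sum>i<k. ms ! i) = size (motif I)" "\<And>i. i < k \<Longrightarrow> 1 \<le> ms ! i \<and> ms ! i \<le> max_mult I"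
    "\<exists>i<k. ms ! i = max_mult I" "1 \<le> k" "1 \<le> n"
    "has_motif I \<longleftrightarrow> (\<exists>S \<subseteq> {..<n}. conn ((\<lambda>i. {fst (es ! i), snd (es ! i)}) ` {..<length es}) S \<and>
      (\<exists>f. (\<forall>v\<in>S. {v, f v} \<in> (\<lambda>i. {fst (ps ! i), snd (ps ! i) + n}) ` {..<length ps}) \<and>
      (\<forall>c\<in>{n..<n + k}. card {v \<in> S. f v = c} = mult_of n k ms c)))"
proof -
  obtain \<nu> \<kappa> es ms ps where
    \<nu>: "bij_betw \<nu> (verts (graph I)) {..<n}" and \<kappa>: "bij_betw \<kappa> (colors I) {..<k}"
    and des: "distinct (map (\<lambda>(a, b). {a, b}) es)"
    and ses: "(\<lambda>(a, b). {a, b}) ` set es = (\<lambda>e. \<nu> ` e) ` edges (graph I)"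
    and lms: "length ms = k" and ms: "\<forall>c\<in>colors I. ms ! \<kappa> c = count (motif I) c"
    and dps: "distinct ps" and sps: "set ps = {(\<nu> v, \<kappa> c) | v c. v \<in> verts (graph I) \<and> c \<in> clist I v}"
    and xs: "xs = [n, k, length es, length ps] @ flatten es @ ms @ flatten ps"
    using enc unfolding encodes_def n[symmetric] k[symmetric] by (elim exE conjE)
  let ?V = "verts (graph I)" and ?C = "colors I"
  let ?EG = "(\<lambda>i. {fst (es ! i), snd (es ! i)}) ` {..<length es}"
  let ?EH = "(\<lambda>i. {fst (ps ! i), snd (ps ! i) + n}) ` {..<length ps}"
  have finV: "finite ?V" and E: "\<And>e. e \<in> edges (graph I) \<Longrightarrow> e \<subseteq> ?V \<and> card e = 2"
    and cl: "\<And>v. v \<in> ?V \<Longrightarrow> clist I v \<subseteq> ?C" and ug: "ugraph (graph I)"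
    using I by (auto simp: lcgm_instance_def ugraph_def)
  have inj\<nu>: "inj_on \<nu> ?V" and im\<nu>: "\<nu> ` ?V = {..<n}" and inj\<kappa>: "inj_on \<kappa> ?C" and im\<kappa>: "\<kappa> ` ?C = {..<k}"
    using \<nu> \<kappa> by (auto simp: bij_betw_def)
  have finC: "finite ?C"
    by (simp add: colors_def)
  have nth_image: "h ` set ys = (\<lambda>i. h (ys ! i)) ` {..<length ys}" for h :: "nat \<times> nat \<Rightarrow> nat set" and ys
  proof -
    have "set ys = (\<lambda>i. ys ! i) ` {..<length ys}"
      by (auto simp: set_conv_nth)
    then show ?thesis
      by (simp only: image_image)
  qed
  have EG: "?EG = (\<lambda>e. \<nu> ` e) ` edges (graph I)"
    unfolding ses[symmetric] nth_image by (simp add: case_prod_unfold)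
  have EH: "?EH = {{\<nu> v, n + \<kappa> c} | v c. v \<in> ?V \<and> c \<in> clist I v}"
  proof -
    have "?EH = (\<lambda>p. {fst p, snd p + n}) ` set ps"
      unfolding nth_image ..
    also have "\<dots> = {{\<nu> v, n + \<kappa> c} | v c. v \<in> ?V \<and> c \<in> clist I v}"
    proof (intro equalityI subsetI)
      fix e assume "e \<in> (\<lambda>p. {fst p, snd p + n}) ` set ps"
      then obtain p where "p \<in> set ps" "e = {fst p, snd p + n}"
        by (elim imageE)
      then obtain v c where "v \<in> ?V" "c \<in> clist I v" "e = {\<nu> v, \<kappa> c + n}"
        unfolding sps by auto
      then show "e \<in> {{\<nu> v, n + \<kappa> c} | v c. v \<in> ?V \<and> c \<in> clist I v}"
        by (intro CollectI exI[of _ v] exI[of _ c]) (simp only: add.commute)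
    next
      fix e assume "e \<in> {{\<nu> v, n + \<kappa> c} | v c. v \<in> ?V \<and> c \<in> clist I v}"
      then obtain v c where vc: "v \<in> ?V" "c \<in> clist I v" "e = {\<nu> v, n + \<kappa> c}"
        by blast
      then have "(\<nu> v, \<kappa> c) \<in> set ps"
        unfolding sps by blast
      then show "e \<in> (\<lambda>p. {fst p, snd p + n}) ` set ps"
        by (rule rev_image_eqI) (simp add: vc(3) add.commute)
    qed
    finally show ?thesis .
  qed
  show ?thesis
  proof (rule that[OF xs lms])
    show "inj_on (\<lambda>i. {fst (es ! i), snd (es ! i)}) {..<length es}"
      using des by (auto simp: inj_on_def distinct_conv_nth case_prod_unfold)
    show "fst (es ! i) \<noteq> snd (es ! i) \<and> fst (es ! i) < n \<and> snd (es ! i) < n" if i: "i < length es" for i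
    proof -
      have "{fst (es ! i), snd (es ! i)} \<in> ?EG"
        using i by blast
      then obtain e where e: "e \<in> edges (graph I)" "{fst (es ! i), snd (es ! i)} = \<nu> ` e"
        unfolding EG by (elim imageE)
      have "card (\<nu> ` e) = card e"
        by (rule card_image[OF inj_on_subset[OF inj\<nu>]]) (use E[OF e(1)] in blast)
      then have "card (\<nu> ` e) = 2"
        using E[OF e(1)] by simp
      then have "fst (es ! i) \<noteq> snd (es ! i)"
        unfolding e(2)[symmetric] by (auto simp: card_insert_if split: if_splits)
      moreover have "\<nu> ` e \<subseteq> {..<n}"
        using E[OF e(1)] im\<nu> by blast
      ultimately show ?thesis
        unfolding e(2)[symmetric] by simp
    qed
    have "leafy (edges (graph I))"
      using tr by (intro forest_leafy) (simp add: tree_def)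
    then show "leafy ?EG"
      unfolding EG by (rule leafy_image) (rule inj_on_subset[OF inj\<nu>], use E in blast)
    have "conn ((`) \<nu> ` edges (graph I)) (\<nu> ` ?V)"
      using conn_image[OF inj\<nu> order.refl] E induced_verts[OF ug] tr by (simp add: tree_def)
    then show "conn ?EG {..<n}"
      unfolding EG im\<nu> .
    show p: "fst (ps ! i) < n \<and> snd (ps ! i) < k" if "i < length ps" for i
    proof -
      have "ps ! i \<in> set ps"
        using that by simp
      then obtain v c where "ps ! i = (\<nu> v, \<kappa> c)" "v \<in> ?V" "c \<in> clist I v"
        unfolding sps by blast
      then show ?thesis
        using cl[of v] im\<nu> im\<kappa> by auto
    qed
    show "inj_on (\<lambda>i. {fst (ps ! i), snd (ps ! i) + n}) {..<length ps}"
    proof (rule inj_onI)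
      fix i j assume ij: "i \<in> {..<length ps}" "j \<in> {..<length ps}"
        "{fst (ps ! i), snd (ps ! i) + n} = {fst (ps ! j), snd (ps ! j) + n}"
      then have "ps ! i = ps ! j"
        using p[of i] p[of j] by (auto simp: doubleton_eq_iff prod_eq_iff)
      then show "i = j"
        using dps ij(1,2) by (simp add: nth_eq_iff_index_eq)
    qed
    \<comment> \<open>The numbering of the nodes of the vertex-color graph; it is injective because
      vertices get numbers below \<open>n\<close> and colors numbers from \<open>n\<close>
      on.\<close>
    define h where "h = case_sum \<nu> (\<lambda>c. n + \<kappa> c)"
    have \<nu>n: "\<nu> v < n" if "v \<in> ?V" for v
      using im\<nu> that by blast
    have "inj_on h (Inl ` ?V \<union> Inr ` ?C)"
    proof (rule inj_onI)
      fix x y assume x: "x \<in> Inl ` ?V \<union> Inr ` ?C" and y: "y \<in> Inl ` ?V \<union> Inr ` ?C" and eq: "h x = h y"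
      show "x = y"
      proof (cases x)
        case xl: (Inl v)
        show ?thesis
        proof (cases y)
          case (Inl w)
          then show ?thesis
            using xl x y eq inj_onD[OF inj\<nu>, of v w] by (auto simp: h_def)
        next
          case (Inr c)
          then show ?thesis
            using xl x eq \<nu>n[of v] by (auto simp: h_def)
        qed
      next
        case xr: (Inr c)
        show ?thesis
        proof (cases y)
          case (Inl w)
          then show ?thesis
            using xr y eq \<nu>n[of w] by (auto simp: h_def)
        next
          case (Inr d)
          then show ?thesis
            using xr x y eq inj_onD[OF inj\<kappa>, of c d] by (auto simp: h_def)
        qed
      qed
    qed
    moreover have "\<Union>(edges (vertex_color_graph I)) \<subseteq> Inl ` ?V \<union> Inr ` ?C"
      using cl by (auto simp: vertex_color_graph_def)
    ultimately have "inj_on h (\<Union>(edges (vertex_color_graph I)))"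
      by (rule inj_on_subset)
    then have "leafy ((`) h ` edges (vertex_color_graph I))"
      by (rule leafy_image[OF forest_leafy[OF fo]])
    moreover have "(`) h ` edges (vertex_color_graph I) = ?EH"
      unfolding EH
    proof (intro equalityI subsetI)
      fix e assume "e \<in> (`) h ` edges (vertex_color_graph I)"
      then obtain v c where "v \<in> ?V" "c \<in> clist I v" "e = h ` {Inl v, Inr c}"
        unfolding vertex_color_graph_def by auto
      then show "e \<in> {{\<nu> v, n + \<kappa> c} | v c. v \<in> ?V \<and> c \<in> clist I v}"
        by (intro CollectI exI[of _ v] exI[of _ c]) (simp add: h_def)
    next
      fix e assume "e \<in> {{\<nu> v, n + \<kappa> c} | v c. v \<in> ?V \<and> c \<in> clist I v}"
      then obtain v c where vc: "v \<in> ?V" "c \<in> clist I v" "e = {\<nu> v, n + \<kappa> c}"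
        by blast
      then have "{Inl v, Inr c} \<in> edges (vertex_color_graph I)"
        unfolding vertex_color_graph_def by auto
      then show "e \<in> (`) h ` edges (vertex_color_graph I)"
        by (rule rev_image_eqI) (simp add: vc(3) h_def)
    qed
    ultimately show "leafy ?EH"
      by simp
    have "(\<Sum>i<k. ms ! i) = (\<Sum>c\<in>?C. ms ! \<kappa> c)"
      using sum.reindex_bij_betw[OF \<kappa>, of "\<lambda>i. ms ! i"] by simp
    also have "\<dots> = size (motif I)"
      using ms by (simp add: size_multiset_overloaded_eq colors_def)
    finally show "(\<Sum>i<k. ms ! i) = size (motif I)" .
    have inv: "\<exists>c\<in>?C. i = \<kappa> c" if "i < k" for i
    proof -
      have "i \<in> \<kappa> ` ?C"
        unfolding im\<kappa> using that by simp
      then show ?thesis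
        by blast
    qed
    show "1 \<le> ms ! i \<and> ms ! i \<le> max_mult I" if i: "i < k" for i
    proof -
      obtain c where c: "c \<in> ?C" "i = \<kappa> c"
        using inv[OF i] by (elim bexE)
      then have "ms ! i = count (motif I) c"
        using ms by simp
      moreover have "0 < count (motif I) c"
        using c(1) by (simp add: colors_def)
      moreover have "count (motif I) c \<le> max_mult I"
        unfolding max_mult_def using finC c(1) by (intro Max_ge) auto
      ultimately show ?thesis
        by simp
    qed
    have "?C \<noteq> {}"
      using ne by (simp add: colors_def)
    then have "max_mult I \<in> count (motif I) ` ?C"
      unfolding max_mult_def using finC by (intro Max_in) auto
    then obtain c where c: "c \<in> ?C" "max_mult I = count (motif I) c"
      by blast
    then have "\<kappa> c < k" "ms ! \<kappa> c = max_mult I"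
      using ms im\<kappa> by auto
    then show "\<exists>i<k. ms ! i = max_mult I"
      by blast
    show "1 \<le> k"
      using \<open>\<kappa> c < k\<close> by simp
    have "?V \<noteq> {}"
      using tr by (simp add: tree_def connected_def)
    then show "1 \<le> n"
      using finV by (simp add: n num_verts_def card_gt_0_iff Suc_le_eq)
    show "has_motif I \<longleftrightarrow> (\<exists>S \<subseteq> {..<n}. conn ?EG S \<and> (\<exists>f. (\<forall>v\<in>S. {v, f v} \<in> ?EH) \<and>
      (\<forall>c\<in>{n..<n + k}. card {v \<in> S. f v = c} = mult_of n k ms c)))"
      by (rule has_motif_numbered[OF I \<nu> \<kappa> ms EG EH])
  qed
qed

lemma solve_correct:
  fixes I :: "('v, 'c) lcgm"
  assumes I: "lcgm_instance I" and ne: "motif I \<noteq> {#}" and tr: "tree (graph I)"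
    and fo: "forest (vertex_color_graph I)" and enc: "encodes xs I"
  shows "run solve (initial xs) (4000 * ((max_mult I + 1) ^ (ell I + 1) * 3 ^ ell I * num_verts I))
    (\<lambda>s. regs s ''out'' = (if has_motif I then 1 else 0))"
proof -
  define n where "n = num_verts I"
  define k where "k = card (colors I)"
  define B where "B = max_mult I + 1"
  obtain es ms ps where xs: "xs = [n, k, length es, length ps] @ flatten es @ ms @ flatten ps" and lms: "length ms = k"
    and injG: "inj_on (\<lambda>i. {fst (es ! i), snd (es ! i)}) {..<length es}"
    and es: "\<And>i. i < length es \<Longrightarrow> fst (es ! i) \<noteq> snd (es ! i) \<and> fst (es ! i) < n \<and> snd (es ! i) < n"
    and leafyG: "leafy ((\<lambda>i. {fst (es ! i), snd (es ! i)}) ` {..<length es})"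
    and connG: "conn ((\<lambda>i. {fst (es ! i), snd (es ! i)}) ` {..<length es}) {..<n}"
    and injH: "inj_on (\<lambda>i. {fst (ps ! i), snd (ps ! i) + n}) {..<length ps}"
    and ps: "\<And>i. i < length ps \<Longrightarrow> fst (ps ! i) < n \<and> snd (ps ! i) < k"
    and leafyH: "leafy ((\<lambda>i. {fst (ps ! i), snd (ps ! i) + n}) ` {..<length ps})"
    and summs: "(\<Sum>i<k. ms ! i) = size (motif I)"
    and ms1: "\<And>i. i < k \<Longrightarrow> 1 \<le> ms ! i \<and> ms ! i \<le> max_mult I"
    and msmax: "\<exists>i<k. ms ! i = max_mult I" and k1: "1 \<le> k" and n1: "1 \<le> n"
    and motif: "has_motif I \<longleftrightarrow> (\<exists>S \<subseteq> {..<n}. conn ((\<lambda>i. {fst (es ! i), snd (es ! i)}) ` {..<length es}) S \<and>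
      (\<exists>f. (\<forall>v\<in>S. {v, f v} \<in> (\<lambda>i. {fst (ps ! i), snd (ps ! i) + n}) ` {..<length ps}) \<and>
      (\<forall>c\<in>{n..<n + k}. card {v \<in> S. f v = c} = mult_of n k ms c)))"
    by (rule decode[OF I ne tr fo enc n_def k_def]) (rule that, assumption+)
  define EG where "EG = (\<lambda>i. {fst (es ! i), snd (es ! i)}) ` {..<length es}"
  define EH where "EH = (\<lambda>i. {fst (ps ! i), snd (ps ! i) + n}) ` {..<length ps}"
  define V where "V S \<longleftrightarrow> (\<exists>f. (\<forall>v\<in>S. {v, f v} \<in> EH) \<and>
    (\<forall>c\<in>{n..<n + k}. card {v \<in> S. f v = c} = mult_of n k ms c))" for S
  have motifV: "has_motif I \<longleftrightarrow> (\<exists>S \<subseteq> {..<n}. conn EG S \<and> V S)"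
    unfolding motif V_def EG_def EH_def ..
  define m where "m = length es"
  define p where "p = length ps"
  define inp where "inp = arrs (initial xs) ''in''"
  have inp: "inp i = xs ! i" if "i < length xs" for i
    using that by (simp add: inp_def initial_def)
  have len: "length xs = 4 + 2 * m + k + 2 * p"
    by (simp add: xs lms length_flatten m_def p_def)
  note lay = nth_layout[OF xs]
  have in0: "inp 0 = n" "inp 1 = k" "inp 2 = m" "inp 3 = p"
    using inp[of 0] inp[of 1] inp[of 2] inp[of 3] lay(1-4) unfolding len m_def p_def by simp_all
  have inG: "fst (es ! i) = inp (4 + 2 * i) \<and> snd (es ! i) = inp (4 + 2 * i + 1) + 0" if i: "i < m" for i
  proof -
    have "2 * i < length (flatten es)" "2 * i + 1 < length (flatten es)"
      using i by (simp_all add: length_flatten m_def)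
    from lay(5)[OF this(1)] lay(5)[OF this(2)] show ?thesis
      using inp[of "4 + 2 * i"] inp[of "4 + 2 * i + 1"] flatten_nth[of i es] i by (simp add: len m_def add.assoc)
  qed
  have inM: "inp (4 + 2 * m + i) = ms ! i" if i: "i < k" for i
    using lay(6)[of i] inp[of "4 + 2 * m + i"] i by (simp add: len lms length_flatten m_def)
  have inH: "fst (ps ! i) = inp (4 + 2 * m + k + 2 * i) \<and> snd (ps ! i) = inp (4 + 2 * m + k + 2 * i + 1)" if i: "i < p" for i
  proof -
    have "2 * i < length (flatten ps)" "2 * i + 1 < length (flatten ps)"
      using i by (simp_all add: length_flatten p_def)
    from lay(7)[OF this(1)] lay(7)[OF this(2)] show ?thesis
      using inp[of "4 + 2 * m + k + 2 * i"] inp[of "4 + 2 * m + k + 2 * i + 1"] flatten_nth[of i ps] i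
      by (simp add: len m_def p_def add.assoc length_flatten lms)
  qed
  have size1: "k \<le> size (motif I)"
    using sum_mono[of "{..<k}" "\<lambda>_. 1 :: nat" "\<lambda>i. ms ! i"] ms1 summs by simp
  define l where "l = ell I"
  define X where "X = B ^ (l + 1) * 3 ^ l * n"
  have B1: "1 \<le> B"
    by (simp add: B_def)
  have nX: "n \<le> X"
  proof -
    have "1 \<le> B ^ (l + 1) * 3 ^ l"
      using B1 by (simp add: Suc_le_eq)
    from mult_le_mono1[OF this, of n] show ?thesis
      by (simp add: X_def)
  qed
  \<comment> \<open>Each \<open>U\<close> below is what remains of the budget. The preparation is
    linear in \<open>n\<close> and is charged to \<open>X\<close> by \<open>nX\<close>; 2000 of the
    4000 units are reserved for the search together with the statuses and weights.\<close>
  have goal: "run solve (initial xs) (4000 * X) (\<lambda>s. regs s ''out'' = (if has_motif I then 1 else 0))"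
    unfolding solve_def seqs.simps
  proof (rule run_seq[where T = 3 and U = "3900 * X" and Q = "\<lambda>s'. s' = set_reg (initial xs) ''n'' n"], goal_cases)
    case 1
    show ?case
      using in0 by (intro run_straight) (simp_all add: inp_def)
  next
    case (2 s1)
    show ?case
    proof (rule run_seq[where T = 3 and U = "3800 * X" and Q = "\<lambda>s'. s' = set_reg s1 ''k'' k"], goal_cases)
      case 1
      show ?case
        using in0 2(2) by (intro run_straight) (simp_all add: inp_def)
    next
      case s2: (2 s2)
      have st2: "regs s2 = (\<lambda>_. 0)(''n'' := n, ''k'' := k)" "arrs s2 ''in'' = inp" "\<And>a. a \<noteq> ''in'' \<Longrightarrow> arrs s2 a = (\<lambda>_. 0)"
        using 2(2) s2(2) by (auto simp: inp_def initial_def fun_eq_iff)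
      show ?case
      proof (rule run_seq[where T = "3700 * X" and U = 1 and Q = "\<lambda>s'. regs s' ''out'' = (if has_motif I then 1 else 0)"],
          rule run_If[where T = "3600 * X"], goal_cases)
        case 1
        then have "n < size (motif I)"
          using size1 st2(1) by simp
        then have "\<not> has_motif I"
          using has_motif_size[OF I] by (auto simp: n_def)
        then show ?case
          using st2(1) nX n1 by (intro run_Skip) simp_all
      next
        case 2
        have kn: "k \<le> n"
          using 2 st2(1) by simp
        show ?case
        proof (rule run_seq[where T = 10 and U = "3500 * X" and Q = "\<lambda>s'. s' = set_reg s2 ''mo'' (4 + 2 * m)"], goal_cases)
          case 1
          show ?case
            using st2 in0 by (intro run_straight) (simp_all add: add.commute)
        next
          case s3: (2 s3)
          have st3: "regs s3 ''sum'' = 0" "regs s3 ''mx'' = 0" "arrs s3 ''M'' = (\<lambda>_. 0)" "regs s3 ''k'' = k" "regs s3 ''n'' = n"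
            and h3: "\<And>i. i < k \<Longrightarrow> arrs s3 ''in'' (regs s3 ''mo'' + i) = ms ! i"
            using s3(2) st2 inM by simp_all
          show ?case
          proof (rule run_seq[OF load_colors[OF st3 h3], where U = "3400 * X"], assumption, goal_cases)
            case s4: (1 s4)
            have rs4: "regs s4 x = regs s2 x" if "x \<notin> {''i'', ''y'', ''sum'', ''mx'', ''mo''}" for x
              using that s4(1) s3(2) by (simp add: frame_def writes_setup)
            have as4: "arrs s4 x = arrs s2 x" if "x \<noteq> ''M''" for x
              using that s4(1) s3(2) by (simp add: frame_def writes_setup)
            have mo4: "regs s4 ''mo'' = 4 + 2 * m"
              using s4(1) s3(2) by (simp add: frame_def writes_setup)
            have sum4: "regs s4 ''sum'' = size (motif I)"
              using s4(2) summs by simp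
            have M4: "arrs s4 ''M'' = mult_of n k ms"
              using s4(2) by (simp add: mult_of_def fun_eq_iff)
            have mx4: "regs s4 ''mx'' = max_mult I"
            proof (rule antisym)
              show "regs s4 ''mx'' \<le> max_mult I"
                using s4(2) ms1 by auto
              show "max_mult I \<le> regs s4 ''mx''"
                using s4(2) msmax by auto
            qed
            show ?case
            proof (rule run_seq[where T = "3300 * X" and U = 1 and Q = "\<lambda>s'. regs s' ''out'' = (if has_motif I then 1 else 0)"],
                rule run_If[where T = "3200 * X"], goal_cases)
              case 1
              then have "n < size (motif I)"
                using sum4 rs4[of "''n''"] st2(1) by simp
              then have "\<not> has_motif I"
                using has_motif_size[OF I] by (auto simp: n_def)
              then show ?case
                using rs4[of "''out''"] st2(1) nX n1 by (intro run_Skip) simp_all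
            next
              case 2
              have sn: "size (motif I) \<le> n"
                using 2 sum4 rs4[of "''n''"] st2(1) by simp
              have l: "l = n - size (motif I)"
                by (simp add: l_def ell_def n_def)
              \<comment> \<open>The test has excluded motifs larger than the vertex set, so the
                subtraction in \<open>ell\<close> is exact; at least one color makes
                \<open>l\<close> smaller than \<open>n\<close>.\<close>
              have ln: "l < n" "size (motif I) + l = n"
                using sn size1 k1 by (simp_all add: l)
              define N where "N = n + k"
              show ?case
              proof (rule run_seq[where T = 20 and U = "3100 * X" and Q = "\<lambda>s'. s' = s4\<lparr>regs := (regs s4)
                  (''N'' := N, ''l'' := l, ''nn'' := n, ''ec'' := m, ''eo'' := 4)\<rparr>"], goal_cases)
                case 1
                show ?case
                  using rs4[of "''n''"] rs4[of "''k''"] as4[of "''in''"] st2 sum4 in0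
                  by (intro run_straight) (simp_all add: N_def l)
              next
                case s5: (2 s5)
                have r5: "regs s5 = (regs s4)(''N'' := N, ''l'' := l, ''nn'' := n, ''ec'' := m, ''eo'' := 4)"
                  and a5: "arrs s5 = arrs s4"
                  using s5(2) by simp_all
                have z5: "arrs s5 [CHR ''G'', CHR ''d''] = (\<lambda>_. 0)" "arrs s5 [CHR ''G'', CHR ''s''] = (\<lambda>_. 0)"
                  "regs s5 ''nn'' = n" "regs s5 ''ec'' = m"
                  by (simp_all add: a5 r5 as4 st2)
                have fg5: "fst (es ! i) = arrs s5 ''in'' (regs s5 ''eo'' + 2 * i) \<and>
                    snd (es ! i) = arrs s5 ''in'' (regs s5 ''eo'' + 2 * i + 1) + regs s5 ''sh'' \<and>
                    fst (es ! i) \<noteq> snd (es ! i) \<and> fst (es ! i) < n \<and> snd (es ! i) < n" if i: "i < m" for i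
                  using inG[OF i] es[of i] i by (simp add: a5 r5 as4 st2 rs4 m_def)
                have mn: "m \<le> n"
                proof -
                  have "card EG = m"
                    unfolding EG_def m_def by (simp add: card_image[OF injG])
                  moreover have "card EG \<le> card {..<n}"
                    using es leafyG unfolding EG_def by (intro leafy_card_le) auto
                  ultimately show ?thesis
                    by simp
                qed
                show ?case
                proof (rule run_seq[OF elim[OF z5 fg5 injG[folded m_def] EG_def[folded m_def] leafyG[folded EG_def]], where U = "2800 * X"],
                    assumption, goal_cases)
                  case s6: (1 s6)
                  define GP where "GP = arrs s6 ''Gp''"
                  define Go where "Go = arrs s6 ''Go''"
                  have Grt: "rooted n EG GP Go"
                    using s6(2) by (simp add: GP_def Go_def)
                  have r6: "regs s6 x = regs s5 x" if "x \<notin> {''i'', ''a'', ''b'', ''x'', ''y'', ''t''}" for x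
                    using that s6(1) by (simp add: frame_def writes_setup)
                  have a6: "arrs s6 x = arrs s5 x" if "x \<notin> {''Gd'', ''Gs'', ''Gp'', ''Go''}" for x
                    using that s6(1) by (simp add: frame_def writes_setup)
                  show ?case
                  proof (rule run_seq[where T = 20 and U = "2700 * X" and Q = "\<lambda>s'. s' = s6\<lparr>regs := (regs s6)
                      (''nn'' := N, ''ec'' := p, ''eo'' := 4 + 2 * m + k, ''sh'' := n)\<rparr>"], goal_cases)
                    case 1
                    show ?case
                      using in0 by (intro run_straight) (simp_all add: r6 a6 r5 a5 rs4 as4 st2 mo4)
                  next
                    case s7: (2 s7)
                    have r7: "regs s7 = (regs s6)(''nn'' := N, ''ec'' := p, ''eo'' := 4 + 2 * m + k, ''sh'' := n)"
                      and a7: "arrs s7 = arrs s6"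
                      using s7(2) by simp_all
                    have z7: "arrs s7 [CHR ''H'', CHR ''d''] = (\<lambda>_. 0)" "arrs s7 [CHR ''H'', CHR ''s''] = (\<lambda>_. 0)"
                      "regs s7 ''nn'' = N" "regs s7 ''ec'' = p"
                      by (simp_all add: a7 r7 a6 a5 as4 st2)
                    have fg7: "fst (ps ! i) = arrs s7 ''in'' (regs s7 ''eo'' + 2 * i) \<and>
                        snd (ps ! i) + n = arrs s7 ''in'' (regs s7 ''eo'' + 2 * i + 1) + regs s7 ''sh'' \<and>
                        fst (ps ! i) \<noteq> snd (ps ! i) + n \<and> fst (ps ! i) < N \<and> snd (ps ! i) + n < N" if i: "i < p" for i
                      using inH[OF i] ps[of i] i by (simp add: a7 r7 a6 a5 as4 st2 p_def N_def)
                    have pN: "p \<le> N"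
                    proof -
                      have "card EH = p"
                        unfolding EH_def p_def by (simp add: card_image[OF injH])
                      moreover have "e \<subseteq> {..<N}" if "e \<in> EH" for e
                        using that ps unfolding EH_def N_def by fastforce
                      then have "card EH \<le> card {..<N}"
                        using leafyH unfolding EH_def by (intro leafy_card_le) auto
                      ultimately show ?thesis
                        by simp
                    qed
                    show ?case
                    proof (rule run_seq[OF elim[OF z7 fg7 injH[folded p_def] EH_def[folded p_def] leafyH[folded EH_def]], where U = "2000 * X"],
                        assumption, goal_cases)
                      case s8: (1 s8)
                      define P where "P = arrs s8 ''Hp''"
                      define od where "od = arrs s8 ''Ho''"
                      have rt: "rooted N EH P od"
                        using s8(2) by (simp add: P_def od_def)
                      have r8: "regs s8 x = regs s7 x" if "x \<notin> {''i'', ''a'', ''b'', ''x'', ''y'', ''t''}" for x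
                        using that s8(1) by (simp add: frame_def writes_setup)
                      have a8: "arrs s8 x = arrs s7 x" if "x \<notin> {''Hd'', ''Hs'', ''Hp'', ''Ho''}" for x
                        using that s8(1) by (simp add: frame_def writes_setup)
                      let ?M = "mult_of n k ms"
                      interpret motif_problem n N EH P od ?M EG GP Go l
                      proof
                        show "rooted N EH P od"
                          by (rule rt)
                        show "n \<le> N"
                          by (simp add: N_def)
                        show "\<exists>v c. v < n \<and> n \<le> c \<and> c < N \<and> e = {v, c}" if e: "e \<in> EH" for e
                        proof -
                          obtain i where i: "i < length ps" "e = {fst (ps ! i), snd (ps ! i) + n}"
                            using e unfolding EH_def by auto
                          then show ?thesis
                            using ps[OF i(1)] by (intro exI[of _ "fst (ps ! i)"] exI[of _ "snd (ps ! i) + n"]) (simp add: N_def)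
                        qed
                        show "?M N = 0"
                          by (simp add: mult_of_def N_def)
                        show "rooted n EG GP Go"
                          by (rule Grt)
                        show "conn EG {..<n}"
                          using connG by (simp add: EG_def)
                        have "(\<Sum>c\<in>{n..<N}. ?M c) = (\<Sum>i<k. ms ! i)"
                          unfolding N_def
                          by (rule sum.reindex_bij_witness[of _ "\<lambda>i. n + i" "\<lambda>c. c - n"]) (auto simp: mult_of_def)
                        then show "(\<Sum>c\<in>{n..<N}. ?M c) + l = n"
                          using summs ln(2) by simp
                        show "l < n"
                          by (rule ln(1))
                      qed
                      have vV: "valid D \<longleftrightarrow> V ({..<n} - D)" for D
                        unfolding valid_def V_def by (simp only: N_def)
                      \<comment> \<open>Deleted sets and motif sets are complements of each
                        other.\<close>
                      have sol: "solution \<longleftrightarrow> has_motif I"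
                      proof
                        assume solution
                        then obtain D where D: "conn EG ({..<n} - D)" "valid D"
                          unfolding solution_def by (elim exE conjE)
                        then show "has_motif I"
                          unfolding motifV vV by (intro exI[of _ "{..<n} - D"] conjI Diff_subset)
                      next
                        assume "has_motif I"
                        then obtain S where S: "S \<subseteq> {..<n}" "conn EG S" "V S"
                          unfolding motifV by (elim exE conjE)
                        have eq: "{..<n} - ({..<n} - S) = S"
                          using S(1) by blast
                        show solution
                          unfolding solution_def vV
                        proof (intro exI conjI)
                          show "{..<n} - S \<subseteq> {..<n}"
                            by (rule Diff_subset)
                          show "conn EG ({..<n} - ({..<n} - S))" "V ({..<n} - ({..<n} - S))"
                            unfolding eq by (rule S)+
                        qed
                      qed
                      have core: "run (seqs [compute_status, compute_first,
      If (Equal (Reg ''bad'') (Const 0)) (seqs [compute_weights, test_all]) Skip]) s8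
    (500 * n + (max_mult I + 1) ^ l * (600 * (n * ((l + 1) * 2 ^ l)))) (\<lambda>s'. regs s' ''out'' = (if solution then 1 else 0))"
                      proof (rule solve_core[where k = k])
                        show "k \<le> n"
                          by (rule kn)
                        show "n \<le> c \<Longrightarrow> c < N \<Longrightarrow> ?M c \<le> max_mult I" for c
                          using ms1[of "c - n"] by (simp add: mult_of_def N_def)
                      qed (simp_all add: r8 a8 r7 a7 r6 a6 r5 a5 rs4 as4 st2 M4 mx4 N_def P_def od_def GP_def Go_def)
                      have "500 * n + (max_mult I + 1) ^ l * (600 * (n * ((l + 1) * 2 ^ l))) \<le> 2000 * X"
                      proof -
                        \<comment> \<open>There are \<open>B ^ l\<close> tapes, and one tape costs a
                          multiple of \<open>n * ((l + 1) * 2 ^ l)\<close>, which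
                          \<open>two_pow_bound\<close> turns into \<open>n * 3 ^ l\<close>.\<close>
                        have "B ^ l \<le> B ^ (l + 1)"
                          using B1 by simp
                        then have "B ^ l * (n * ((l + 1) * 2 ^ l)) \<le> B ^ (l + 1) * (n * (2 * 3 ^ l))"
                          by (rule mult_le_mono[OF _ mult_le_mono2[OF two_pow_bound]])
                        also have "\<dots> = 2 * X"
                          unfolding X_def by (simp only: mult.commute mult.left_commute mult.assoc)
                        finally have "B ^ l * (n * ((l + 1) * 2 ^ l)) \<le> 2 * X" .
                        moreover have "B ^ l * (600 * (n * ((l + 1) * 2 ^ l))) = 600 * (B ^ l * (n * ((l + 1) * 2 ^ l)))"
                          by (simp only: mult.left_commute)
                        ultimately show ?thesis
                          using nX unfolding B_def[symmetric] by linarith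
                      qed
                      from run_mono[OF core this] show ?case
                        unfolding seqs.simps sol by simp
                    next
                      case 2
                      show ?case
                      proof -
                        have "60 + 60 * p + 180 * N \<le> 540 * n"
                          using pN kn n1 unfolding N_def by simp
                        moreover have "540 * n \<le> 700 * X"
                          using nX by simp
                        ultimately show ?thesis
                          by simp
                      qed
                    qed
                  qed (use nX n1 in linarith)
                next
                  case 2
                  show ?case
                    using mn nX n1 by linarith
                qed
              qed (use nX n1 in linarith)
            qed (use nX n1 in \<open>auto intro: run_Skip\<close>)
          next
            case 2
            show ?case
              using kn nX n1 by linarith
          qed
        qed (use nX n1 in linarith)
      qed (use nX n1 in \<open>auto intro: run_Skip\<close>)
    qed (use nX n1 in linarith)
  qed (use nX n1 in linarith)
  then show ?thesis
    by (simp only: X_def B_def l_def n_def)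
qed

theorem theorem9:
  shows "\<exists>(P :: com) (K :: nat). \<forall>(I :: (nat, nat) lcgm) (xs :: nat list).
    lcgm_instance I \<and> motif I \<noteq> {#} \<and>
    tree (graph I) \<and> forest (vertex_color_graph I) \<and> encodes xs I \<longrightarrow>
    answers_within P xs (has_motif I)
      (K * ((max_mult I + 1) ^ (ell I + 1) * 3 ^ ell I * num_verts I))"
proof (rule exI[of _ solve], rule exI[of _ 4000], intro allI impI, elim conjE)
  fix I :: "(nat, nat) lcgm" and xs
  assume "lcgm_instance I" "motif I \<noteq> {#}" "tree (graph I)" "forest (vertex_color_graph I)" "encodes xs I"
  then show "answers_within solve xs (has_motif I)
      (4000 * ((max_mult I + 1) ^ (ell I + 1) * 3 ^ ell I * num_verts I))"
    using solve_correct unfolding run_def answers_within_def by blast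
qed

end
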